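(* Let $R>1$. There is a constant $C>0$ (depending only on $R$) such that the following holds. Let $H$ be a sufficiently smooth function on $[0,\infty)\times\mathbb R^2$ with $\operatorname{supp}H(t,\cdot)\subset\{x:|x|\le R\}$ for every $t\ge0$, and let $v$ be the solution of the Cauchy problem $$\Box v=H(t,x),\quad (t,x)\in[0,\infty)\times\mathbb R^2,\qquad (v,\partial_tv)(0,x)=(0,0),\quad x\in\mathbb R^2 .$$ Then for all $(t,x)\in[0,\infty)\times\mathbb R^2$, $$\langle x\rangle^{1/2}\langle t-|x|\rangle\,|\partial v(t,x)|\le C\sup_{(s,y)\in[0,t]\times\mathbb R^2}\langle s\rangle\,|(1-\Delta)^3H(s,y)|.$$
   Context: $\Box=\partial_t^2-\Delta$ with $\Delta=\partial_{x_1}^2+\partial_{x_2}^2$ on $\mathbb R^2$; $\partial=(\partial_t,\partial_{x_1},\partial_{x_2})$; $\langle y\rangle=\sqrt{1+|y|^2}$. *)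

theory Defs
  imports "HOL-Analysis.Analysis"
begin

(* Functions of (t,x) on [0,\<infinity>) \<times> R^2 are curried total functions; all notions below only
   inspect times t \<ge> 0, so the values at negative times are irrelevant. *)

definition japanese_bracket :: "'a::real_normed_vector \<Rightarrow> real" where
  "japanese_bracket y = sqrt (1 + (norm y)\<^sup>2)"

(* One-sided at t = 0, the ordinary derivative for t > 0. *)
definition dt :: "(real \<Rightarrow> real^2 \<Rightarrow> real) \<Rightarrow> real \<Rightarrow> real^2 \<Rightarrow> real" where
  "dt f t x = vector_derivative (\<lambda>s. f s x) (at t within {0..})"

definition dx :: "2 \<Rightarrow> (real \<Rightarrow> real^2 \<Rightarrow> real) \<Rightarrow> real \<Rightarrow> real^2 \<Rightarrow> real" where
  "dx i f t x = deriv (\<lambda>h. f t (x + h *\<^sub>R axis i 1)) 0"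

definition grad_tx :: "(real \<Rightarrow> real^2 \<Rightarrow> real) \<Rightarrow> real \<Rightarrow> real^2 \<Rightarrow> real \<times> (real^2)" where
  "grad_tx f t x = (dt f t x, \<chi> i. dx i f t x)"

definition laplacian :: "(real \<Rightarrow> real^2 \<Rightarrow> real) \<Rightarrow> real \<Rightarrow> real^2 \<Rightarrow> real" where
  "laplacian f t x = (\<Sum>i\<in>UNIV. dx i (dx i f) t x)"

definition dalembertian :: "(real \<Rightarrow> real^2 \<Rightarrow> real) \<Rightarrow> real \<Rightarrow> real^2 \<Rightarrow> real" where
  "dalembertian f t x = dt (dt f) t x - laplacian f t x"

definition one_minus_laplacian :: "(real \<Rightarrow> real^2 \<Rightarrow> real) \<Rightarrow> real \<Rightarrow> real^2 \<Rightarrow> real" where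
  "one_minus_laplacian f t x = f t x - laplacian f t x"

(* C^k([0,\<infinity>) \<times> R^2): all partial derivatives of order at most k, mixed ones in any order, exist
   and are jointly continuous up to and including t = 0. Existence is required explicitly, since
   dt and dx are total operators. *)
fun C_k :: "nat \<Rightarrow> (real \<Rightarrow> real^2 \<Rightarrow> real) \<Rightarrow> bool" where
  "C_k 0 f \<longleftrightarrow> continuous_on ({0..} \<times> UNIV) (\<lambda>(t, x). f t x)"
| "C_k (Suc k) f \<longleftrightarrow>
     continuous_on ({0..} \<times> UNIV) (\<lambda>(t, x). f t x) \<and>
     (\<forall>t\<ge>0. \<forall>x. (\<lambda>s. f s x) differentiable (at t within {0..})) \<and>
     (\<forall>t\<ge>0. \<forall>x i. (\<lambda>h. f t (x + h *\<^sub>R axis i 1)) differentiable (at 0)) \<and>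
     C_k k (dt f) \<and> (\<forall>i. C_k k (dx i f))"

(* Classical solution; uniqueness holds in this class. *)
definition solves_zero_cauchy ::
    "(real \<Rightarrow> real^2 \<Rightarrow> real) \<Rightarrow> (real \<Rightarrow> real^2 \<Rightarrow> real) \<Rightarrow> bool" where
  "solves_zero_cauchy H v \<longleftrightarrow>
     C_k 2 v \<and>
     (\<forall>t\<ge>0. \<forall>x. dalembertian v t x = H t x) \<and>
     (\<forall>x. v 0 x = 0 \<and> dt v 0 x = 0)"

end

theory Submission
  imports Defs
begin

text \<open>Descent from three dimensions writes \<open>2 pi v(t,x)\<close> as the integral over \<open>0 \<le> s \<le> t\<close> of
  \<open>\<tau> = t - s\<close> times the integral of \<open>H(s, \<cdot>)\<close> over the hemisphere with centre \<open>x\<close> and radius \<open>\<tau>\<close>,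
  projected to the plane by \<open>y = x - \<tau> sin \<phi> (cos \<theta>, sin \<theta>)\<close>. This is proved pointwise on the hemisphere:
  the \<open>s\<close>-derivative of Kirchhoff's integrand for \<open>v(s, \<cdot>)\<close> is \<open>\<tau> H sin \<phi>\<close> plus
  a \<open>\<phi>\<close>-derivative plus a \<open>\<theta>\<close>-derivative that integrate to zero.

  For \<open>\<partial>v\<close> the derivative is put on \<open>H\<close> while \<open>\<tau> \<le> |x| + R + 1\<close>; later the support of
  \<open>H\<close> stays away from the equator of the hemisphere and integration by parts moves the derivative
  to the kernel. Both regimes give the bound \<open>(1 + |x|)\<^sup>-\<^sup>1\<^sup>/\<^sup>2 (1 + |\<tau> - |x||)\<^sup>-\<^sup>3\<^sup>/\<^sup>2\<close>, whose convolution with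
  \<open>(1 + s)\<^sup>-\<^sup>1\<close> decays like \<open>(1 + |t - |x||)\<^sup>-\<^sup>1\<close>. Only the sup norms of \<open>H\<close> and of its spatial
  gradient enter, and the maximum principle for \<open>1 - \<Delta>\<close> bounds them by that of \<open>(1 - \<Delta>)\<^sup>3 H\<close>.\<close>

subsection \<open>Differentiation on the closed half-space\<close>

text \<open>With y on the projected hemisphere, the planar kernel dy / sqrt (tau^2 - |x - y|^2)
  becomes tau sin phi dphi dtheta: its singularity on the light cone disappears, every integral runs
  over a fixed box with a continuous integrand, and differentiation under the integral is
  legitimate. The two regimes are forced. Put r = |x|. With the derivative on H the kernel is that
  of v, which behind the cone decays only like tau^-1/2 (tau - r)^-1/2; this is not integrable in
  tau. Moving the derivative to the kernel gains (tau - r)^-1 but costs 1 / cos^2 phi, which is not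
  integrable up to the equator, that is, up to the light cone. The exchange is therefore made once
  the cone has passed the support, and the extra 1 in r + R + 1 keeps tau - r - R above 1. The
  factor (1 + r)^-1/2 is the angle of order (1 + r)^-1 under which the support is seen from x, times
  a phi-integral of order at most (1 + r)^1/2.\<close>

lemma dt_has_derivative:
  assumes "(\<lambda>s. f s x) differentiable (at t within {0..})" "t \<ge> 0"
  shows "((\<lambda>s. f s x) has_vector_derivative dt f t x) (at t within {0..})"
  using assms by (simp add: dt_def vector_derivative_works)

lemma dx_has_derivative:
  assumes "(\<lambda>h. f t (x + h *\<^sub>R axis i 1)) differentiable (at 0)"
  shows "((\<lambda>h. f t (x + h *\<^sub>R axis i 1)) has_real_derivative dx i f t x) (at 0)"
  using assms by (metis dx_def DERIV_deriv_iff_real_differentiable)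

text \<open>A one-sided derivative is unique because t is a limit point of \<open>{0..}\<close>,
  which is connected and not a singleton.\<close>

lemma dt_unique:
  assumes "((\<lambda>s. f s x) has_vector_derivative D) (at t within {0..})" "t \<ge> 0"
  shows "dt f t x = D"
proof -
  have "{0::real..} \<noteq> {x}" for x
    by (metis atLeast_iff order_refl singletonD zero_le_one zero_neq_one)
  then have "t islimpt {0..}" using assms(2) by (intro connected_imp_perfect) auto
  then show ?thesis
    unfolding dt_def by (intro vector_derivative_within[OF _ assms(1)]) (simp add: trivial_limit_within)
qed

lemma dx_unique:
  assumes "((\<lambda>h. f t (x + h *\<^sub>R axis i 1)) has_real_derivative D) (at 0)"
  shows "dx i f t x = D"
  unfolding dx_def using assms by (rule DERIV_imp_deriv)

lemma dt_cong:
  assumes "\<And>s. s \<ge> 0 \<Longrightarrow> f s x = g s x" "t \<ge> 0"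
  shows "dt f t x = dt g t x"
proof -
  have "((\<lambda>s. f s x) has_vector_derivative D) (at t within {0..}) \<longleftrightarrow>
        ((\<lambda>s. g s x) has_vector_derivative D) (at t within {0..})" for D
    by (rule has_vector_derivative_cong_ev) (use assms in \<open>auto simp: eventually_at_filter\<close>)
  then show ?thesis by (simp add: dt_def vector_derivative_def)
qed

text \<open>For t < 0 the filter \<open>at t within {0..}\<close> is trivial and \<open>dt\<close>
  returns an unspecified value, so identities such as linearity of \<open>dt\<close> are available
  only for t >= 0. Replacing a function by one that agrees with it there is what lets the inductions
  over \<open>k\<close> go through.\<close>

lemma C_k_cong:
  assumes "\<And>t x. t \<ge> 0 \<Longrightarrow> f t x = g t x" "C_k k f"
  shows "C_k k g"
  using assms
proof (induction k arbitrary: f g)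
  case 0
  have "continuous_on ({0..} \<times> UNIV) (\<lambda>(t, x). f t x) \<longleftrightarrow> continuous_on ({0..} \<times> UNIV) (\<lambda>(t, x). g t x)"
    by (rule continuous_on_cong) (use 0 in auto)
  with 0 show ?case by simp
next
  case (Suc k)
  have c: "continuous_on ({0..} \<times> UNIV) (\<lambda>(t, x). f t x) \<longleftrightarrow> continuous_on ({0..} \<times> UNIV) (\<lambda>(t, x). g t x)"
    by (rule continuous_on_cong) (use Suc in auto)
  have eq: "dt f t x = dt g t x" if "t \<ge> 0" for t x
    using Suc.prems(1) that by (intro dt_cong) auto
  have eqx: "dx i f t x = dx i g t x" if "t \<ge> 0" for t x i
    using Suc.prems(1) that by (simp add: dx_def)
  have "(\<lambda>s. g s x) differentiable (at t within {0..})" if "t \<ge> 0" for t x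
  proof (rule differentiable_transform_within[of "\<lambda>s. f s x" t _ 1])
    show "(\<lambda>s. f s x) differentiable (at t within {0..})" using Suc.prems(2) that by simp
  qed (use that Suc.prems in auto)
  moreover have "(\<lambda>h. g t (x + h *\<^sub>R axis i 1)) differentiable (at 0)" if "t \<ge> 0" for t x i
  proof -
    have "(\<lambda>h. f t (x + h *\<^sub>R axis i 1)) differentiable (at 0)" using Suc.prems(2) that by simp
    moreover have "f t = g t" using Suc.prems(1) that by auto
    ultimately show ?thesis by simp
  qed
  moreover have "C_k k (dt g)" using Suc.IH[of "dt f" "dt g"] Suc.prems(2) eq by simp
  moreover have "C_k k (dx i g)" for i using Suc.IH[of "dx i f" "dx i g"] Suc.prems(2) eqx by simp
  ultimately show ?case using c Suc.prems(2) by simp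
qed

lemma C_k_Suc_imp: "C_k (Suc k) f \<Longrightarrow> C_k k f"
proof (induction k arbitrary: f)
  case (Suc k)
  then show ?case by (metis C_k.simps(2))
qed simp

lemma C_k_lincomb:
  assumes "C_k k f" "C_k k g"
  shows "C_k k (\<lambda>t x. a * f t x + b * g t x)"
  using assms
proof (induction k arbitrary: f g)
  case 0
  then show ?case by (auto simp: case_prod_unfold intro!: continuous_intros)
next
  case (Suc k)
  let ?h = "\<lambda>t x. a * f t x + b * g t x"
  have cf: "(\<lambda>s. f s x) differentiable (at t within {0..})"
    "(\<lambda>s. g s x) differentiable (at t within {0..})" if "t \<ge> 0" for t x
    using Suc.prems that by auto
  have cx: "(\<lambda>h. f t (x + h *\<^sub>R axis i 1)) differentiable (at 0)"
    "(\<lambda>h. g t (x + h *\<^sub>R axis i 1)) differentiable (at 0)" if "t \<ge> 0" for t x i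
    using Suc.prems that by auto
  have Dt: "((\<lambda>s. ?h s x) has_vector_derivative (a * dt f t x + b * dt g t x)) (at t within {0..})"
    if "t \<ge> 0" for t x
    using dt_has_derivative[where f=f and x=x, OF cf(1)[OF that] that] dt_has_derivative[where f=g and x=x, OF cf(2)[OF that] that]
    unfolding has_real_derivative_iff_has_vector_derivative[symmetric]
    by (intro DERIV_add DERIV_cmult)
  have Dx: "((\<lambda>h. ?h t (x + h *\<^sub>R axis i 1)) has_real_derivative (a * dx i f t x + b * dx i g t x)) (at 0)"
    if "t \<ge> 0" for t x i
    by (rule derivative_eq_intros dx_has_derivative[where f=f] dx_has_derivative[where f=g] cx that refl)+ simp
  then have Dx': "(\<lambda>h. ?h t (x + h *\<^sub>R axis i 1)) differentiable (at 0)" if "t \<ge> 0" for t x i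
    using that unfolding real_differentiable_def by blast
  have "continuous_on ({0..} \<times> UNIV) (\<lambda>(t, x). ?h t x)"
    using Suc.prems by (auto simp: case_prod_unfold intro!: continuous_intros)
  moreover have "C_k k (dt ?h)"
    by (rule C_k_cong[OF _ Suc.IH[of "dt f" "dt g"]]) (use Suc.prems dt_unique[of ?h, OF Dt] in auto)
  moreover have "C_k k (dx i ?h)" for i
    by (rule C_k_cong[OF _ Suc.IH[of "dx i f" "dx i g"]]) (use Suc.prems dx_unique[of ?h, OF Dx] in auto)
  ultimately show ?case
    using differentiableI_vector[OF Dt] Dx' unfolding C_k.simps by blast
qed

lemma C_k_one_minus_laplacian:
  assumes "C_k (Suc (Suc k)) f"
  shows "C_k k (one_minus_laplacian f)"
proof -
  have d: "C_k k (dx i (dx i f))" for i using assms by simp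
  have f: "C_k k f" using assms C_k_Suc_imp by blast
  have "C_k k (\<lambda>t x. 1 * f t x + (-1) * (1 * dx 1 (dx 1 f) t x + 1 * dx 2 (dx 2 f) t x))"
    by (intro C_k_lincomb d f)
  then show ?thesis
    by (rule C_k_cong[rotated]) (simp add: one_minus_laplacian_def laplacian_def UNIV_2)
qed

lemma C_1_grad: "C_k (Suc k) f \<Longrightarrow> t \<ge> 0 \<Longrightarrow>
    ((\<lambda>h. f t (x + h *\<^sub>R axis i 1)) has_real_derivative dx i f t x) (at 0)"
  by (rule dx_has_derivative) simp

lemma C_k_continuous: "C_k k f \<Longrightarrow> continuous_on ({0..} \<times> UNIV) (\<lambda>(t, x). f t x)"
  by (cases k) auto

lemma C_k_continuous_space: "C_k k f \<Longrightarrow> t \<ge> 0 \<Longrightarrow> continuous_on A (f t)"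
  using continuous_on_compose2[OF C_k_continuous, of k f A "\<lambda>x. (t, x)"]
  by (force intro!: continuous_intros)

subsection \<open>Maximum principle\<close>

text \<open>If c were positive, f' would vanish at 0 and be positive just to the right, and the mean
  value theorem would make f exceed its value at 0.\<close>

lemma second_derivative_nonpos_at_max:
  fixes f f' :: "real \<Rightarrow> real"
  assumes d: "d > 0" "\<And>h. \<bar>h\<bar> < d \<Longrightarrow> (f has_real_derivative f' h) (at h)"
    and d2: "(f' has_real_derivative c) (at 0)"
    and mx: "\<And>h. \<bar>h\<bar> < d \<Longrightarrow> f h \<le> f 0"
  shows "c \<le> 0"
proof (rule ccontr)
  assume "\<not> c \<le> 0"
  then have "c > 0" by simp
  have "f' 0 = 0"
    by (rule DERIV_local_max[OF d(2)[of 0] d(1)]) (use d mx in auto)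
  obtain e where e: "e > 0" "\<And>h. h > 0 \<Longrightarrow> h < e \<Longrightarrow> f' 0 < f' (0 + h)"
    using DERIV_pos_inc_right[OF d2 \<open>c > 0\<close>] by auto
  define h where "h = min d e / 2"
  have h: "h > 0" "h < d" "h < e" using d e by (auto simp: h_def min_def)
  have "\<exists>z. 0 < z \<and> z < h \<and> f h - f 0 = (h - 0) * f' z"
    by (rule MVT2) (use h d in auto)
  then obtain z where "0 < z" "z < h" "f h - f 0 = h * f' z" by auto
  then show False using e(2)[of z] h mx[of h] \<open>f' 0 = 0\<close>
    by (smt (verit) mult_pos_pos)
qed

text \<open>A positive maximum over \<open>K\<close> would lie in \<open>U\<close>; there every
  second partial is at most 0, so w minus their sum is positive, against \<open>sub\<close>. The
  points of \<open>K\<close> outside \<open>U\<close> act as the boundary, those of \<open>U\<close>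
  outside \<open>K\<close> as the neighbourhood of infinity, so one statement serves the whole plane
  and a half-plane. The partials are parameters because reflected functions and a barrier are to be
  inserted.\<close>

lemma maximum_principle:
  fixes w :: "real^2 \<Rightarrow> real" and w1 w2 :: "2 \<Rightarrow> real^2 \<Rightarrow> real"
  assumes U: "open U" and K: "compact K" "continuous_on K w"
    and bd: "\<And>x. x \<in> K \<Longrightarrow> x \<notin> U \<Longrightarrow> w x \<le> 0" "\<And>x. x \<in> U \<Longrightarrow> x \<notin> K \<Longrightarrow> w x \<le> 0"
    and D1: "\<And>x i. x \<in> U \<Longrightarrow> ((\<lambda>h. w (x + h *\<^sub>R axis i 1)) has_real_derivative w1 i x) (at 0)"
    and D2: "\<And>x i. x \<in> U \<Longrightarrow> ((\<lambda>h. w1 i (x + h *\<^sub>R axis i 1)) has_real_derivative w2 i x) (at 0)"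
    and sub: "\<And>x. x \<in> U \<Longrightarrow> w x - (\<Sum>i\<in>UNIV. w2 i x) \<le> 0"
    and x: "x \<in> U"
  shows "w x \<le> 0"
proof (rule ccontr)
  assume "\<not> w x \<le> 0"
  then have "x \<in> K" "w x > 0" using bd(2) x by auto
  then obtain p where p: "p \<in> K" "\<And>y. y \<in> K \<Longrightarrow> w y \<le> w p"
    using continuous_attains_sup[OF K(1) _ K(2)] by blast
  have "w p > 0" using p(2)[OF \<open>x \<in> K\<close>] \<open>w x > 0\<close> by simp
  then have pU: "p \<in> U" using bd(1) p(1) by force
  have mx: "w y \<le> w p" if "y \<in> U" for y
    using p(2) bd(2)[OF that] \<open>w p > 0\<close> by (cases "y \<in> K") auto
  obtain d where d: "d > 0" "ball p d \<subseteq> U" using U pU openE by blast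
  have inU: "p + h *\<^sub>R axis i 1 \<in> U" if "\<bar>h\<bar> < d" for h i
    by (rule subsetD[OF d(2)]) (use that in \<open>simp add: dist_norm norm_axis_1\<close>)
  have "w2 i p \<le> 0" for i
  proof (rule second_derivative_nonpos_at_max[of d "\<lambda>h. w (p + h *\<^sub>R axis i 1)" "\<lambda>h. w1 i (p + h *\<^sub>R axis i 1)"])
    fix h :: real assume "\<bar>h\<bar> < d"
    show "w (p + h *\<^sub>R axis i 1) \<le> w (p + 0 *\<^sub>R axis i 1)"
      using mx[OF inU[OF \<open>\<bar>h\<bar> < d\<close>]] by simp
    have "((\<lambda>k. w (p + h *\<^sub>R axis i 1 + k *\<^sub>R axis i 1)) has_real_derivative w1 i (p + h *\<^sub>R axis i 1)) (at 0)"
      by (rule D1[OF inU[OF \<open>\<bar>h\<bar> < d\<close>]])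
    then have "((\<lambda>k. w (p + (k + h) *\<^sub>R axis i 1)) has_real_derivative w1 i (p + h *\<^sub>R axis i 1)) (at 0)"
      by (simp add: algebra_simps)
    then show "((\<lambda>h. w (p + h *\<^sub>R axis i 1)) has_real_derivative w1 i (p + h *\<^sub>R axis i 1)) (at h)"
      using DERIV_shift[of "\<lambda>h. w (p + h *\<^sub>R axis i 1)" "w1 i (p + h *\<^sub>R axis i 1)" 0 h] by simp
  qed (use d D2[OF pU] in auto)
  then have "(\<Sum>i\<in>UNIV. w2 i p) \<le> 0" by (simp add: sum_nonpos)
  then show False using sub[OF pU] \<open>w p > 0\<close> by simp
qed

text \<open>Owing to the zero-order term, subtracting the constant N from a function lowers its
  image under 1 - Delta by N, so s * u - N is a subsolution for both signs s. Outside the support it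
  equals -N, hence nothing positive is left at infinity.\<close>

lemma elliptic_sup_bound:
  fixes u :: "real^2 \<Rightarrow> real"
  assumes u: "continuous_on UNIV u" "\<And>x. norm x > R \<Longrightarrow> u x = 0"
    and D1: "\<And>x i. ((\<lambda>h. u (x + h *\<^sub>R axis i 1)) has_real_derivative u1 i x) (at 0)"
    and D2: "\<And>x i. ((\<lambda>h. u1 i (x + h *\<^sub>R axis i 1)) has_real_derivative u2 i x) (at 0)"
    and N: "\<And>x. \<bar>u x - (\<Sum>i\<in>UNIV. u2 i x)\<bar> \<le> N"
  shows "\<bar>u x\<bar> \<le> N"
proof -
  have "N \<ge> 0" using N[of 0] by linarith
  have "s * u x - N \<le> 0" if s: "s = 1 \<or> s = -1" for s :: real
  proof (rule maximum_principle[of UNIV "cball 0 R" "\<lambda>x. s * u x - N" "\<lambda>i x. s * u1 i x" "\<lambda>i x. s * u2 i x"])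
    show "continuous_on (cball 0 R) (\<lambda>x. s * u x - N)"
      using u(1) by (auto intro!: continuous_intros intro: continuous_on_subset)
    show "s * u x - N \<le> 0" if "x \<notin> cball 0 R" for x
      using that u(2)[of x] \<open>N \<ge> 0\<close> by simp
    show "((\<lambda>h. s * u (x + h *\<^sub>R axis i 1) - N) has_real_derivative s * u1 i x) (at 0)" for x i
      by (rule derivative_eq_intros D1 refl)+ simp
    show "((\<lambda>h. s * u1 i (x + h *\<^sub>R axis i 1)) has_real_derivative s * u2 i x) (at 0)" for x i
      by (rule derivative_eq_intros D2 refl)+ simp
    show "s * u x - N - (\<Sum>i\<in>UNIV. s * u2 i x) \<le> 0" for x
      using N[of x] s by (auto simp: sum_distrib_left[symmetric])
  qed auto
  from this[of 1] this[of "-1"] show ?thesis by auto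
qed

text \<open>The odd part of \<open>u\<close> under reflection in the line through \<open>x\<close> orthogonal to the \<open>j\<close>-axis vanishes on that
  line and is therefore dominated by the barrier \<open>N (1 - exp (- d))\<close>, \<open>d\<close> the distance to the line.\<close>

lemma elliptic_gradient_bound:
  fixes u :: "real^2 \<Rightarrow> real"
  assumes u: "continuous_on UNIV u" "\<And>x. norm x > R \<Longrightarrow> u x = 0"
    and D1: "\<And>x i. ((\<lambda>h. u (x + h *\<^sub>R axis i 1)) has_real_derivative u1 i x) (at 0)"
    and D2: "\<And>x i. ((\<lambda>h. u1 i (x + h *\<^sub>R axis i 1)) has_real_derivative u2 i x) (at 0)"
    and N: "\<And>x. \<bar>u x - (\<Sum>i\<in>UNIV. u2 i x)\<bar> \<le> N"
  shows "\<bar>u1 j x\<bar> \<le> N"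
proof -
  have "N \<ge> 0" using N[of 0] by linarith
  define a where "a = x $ j"
  define S where "S = (\<lambda>y::real^2. y - (2 * (y $ j - a)) *\<^sub>R axis j 1)"
  \<comment> \<open>The chain-rule sign of the reflection \<open>S\<close>: first partials along
    \<open>j\<close> flip, second partials do not, since \<open>c i * c i = 1\<close>.\<close>
  define c :: "2 \<Rightarrow> real" where "c = (\<lambda>i. if i = j then -1 else 1)"
  have S_shift: "S (y + h *\<^sub>R axis i 1) = S y + (c i * h) *\<^sub>R axis i 1" for y h i
    by (simp add: S_def c_def vec_eq_iff axis_def algebra_simps)
  have cc: "c i * c i = 1" for i by (simp add: c_def)
  have Dc: "((\<lambda>h. c i * h) has_real_derivative c i) (at 0)" for i
    by (auto intro!: derivative_eq_intros)
  have DS1: "((\<lambda>h. u (S (y + h *\<^sub>R axis i 1))) has_real_derivative c i * u1 i (S y)) (at 0)" for y i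
    unfolding S_shift
    using DERIV_chain'[OF Dc[of i], where g="\<lambda>k. u (S y + k *\<^sub>R axis i 1)" and E="u1 i (S y)"] D1[where x="S y" and i=i]
    by (simp add: mult.commute[of "u1 i (S y)"])
  have DS2: "((\<lambda>h. c i * u1 i (S (y + h *\<^sub>R axis i 1))) has_real_derivative u2 i (S y)) (at 0)" for y i
  proof -
    have "((\<lambda>h. u1 i (S (y + h *\<^sub>R axis i 1))) has_real_derivative c i * u2 i (S y)) (at 0)"
      unfolding S_shift
      using DERIV_chain'[OF Dc[of i], where g="\<lambda>k. u1 i (S y + k *\<^sub>R axis i 1)" and E="u2 i (S y)"] D2[where x="S y" and i=i]
      by (simp add: mult.commute[of "u2 i (S y)"])
    from DERIV_cmult[OF this, of "c i"] show ?thesis using cc by (simp add: mult.assoc[symmetric])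
  qed
  \<comment> \<open>Beyond radius \<open>Q\<close> both y and its mirror image are outside the
    support. If the image had norm at most \<open>R\<close>, its coordinate 2a - y_j would force
    |y_j - a| <= R + |a|, and y is at distance 2 |y_j - a| from the image.\<close>
  define Q where "Q = R + 2 * (R + \<bar>a\<bar>)"
  have far: "norm (S y) > R" if "y $ j > a" "norm y > Q" for y
  proof (cases "R \<ge> 0")
    case False then show ?thesis by (smt (verit) norm_ge_zero)
  next
    case True
    show ?thesis
    proof (rule ccontr)
      assume "\<not> norm (S y) > R"
      then have 1: "norm (S y) \<le> R" by simp
      have "(S y) $ j = 2 * a - y $ j" by (simp add: S_def)
      then have "\<bar>2 * a - y $ j\<bar> \<le> R" using component_le_norm_cart[of "S y" j] 1 by simp
      then have "\<bar>y $ j - a\<bar> \<le> R + \<bar>a\<bar>" by linarith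
      have "norm y \<le> norm (S y) + norm ((2 * (y $ j - a)) *\<^sub>R (axis j 1 :: real^2))"
        using norm_triangle_ineq[of "S y" "(2 * (y $ j - a)) *\<^sub>R axis j 1"] by (simp add: S_def)
      then have "norm y \<le> Q" using 1 \<open>\<bar>y $ j - a\<bar> \<le> R + \<bar>a\<bar>\<close> by (simp add: Q_def norm_axis_1)
      then show False using that by simp
    qed
  qed
  have QR: "norm y > R" if "norm y > Q" for y :: "real^2"
    proof (cases "R \<ge> 0")
    case False then show ?thesis by (smt (verit) norm_ge_zero)
  qed (use that in \<open>auto simp: Q_def\<close>)
  have contS: "continuous_on UNIV (\<lambda>y. u (S y))"
    by (rule continuous_on_compose2[OF u(1)]) (auto simp: S_def intro!: continuous_intros)
  \<comment> \<open>\<open>E\<close> solves E - Delta E = 0, so 1 - Delta maps the barrier N (1 - E)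
    to the constant N, exactly the bound available for the odd part.\<close>
  define E where "E = (\<lambda>y::real^2. exp (a - y $ j))"
  have ES: "E (y + h *\<^sub>R axis i 1) = exp (a - y $ j - h * (if i = j then 1 else 0))" for y h i
    by (simp add: E_def axis_def algebra_simps)
  define k :: "2 \<Rightarrow> real" where "k = (\<lambda>i. if i = j then 1 else 0)"
  have DE: "((\<lambda>h. E (y + h *\<^sub>R axis i 1)) has_real_derivative - k i * E y) (at 0)" for y i
    unfolding ES by (auto intro!: derivative_eq_intros simp: E_def k_def)
  have sumk: "(\<Sum>i\<in>UNIV. k i * z) = z" for z
    using exhaust_2[of j] by (auto simp: UNIV_2 k_def)
  have main: "s * (u y - u (S y)) / 2 - N * (1 - E y) \<le> 0"
    if s: "s = 1 \<or> s = -1" and y: "y $ j > a" for s :: real and y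
  proof (rule maximum_principle[of "{y. y $ j > a}" "cball 0 Q \<inter> {y. y $ j \<ge> a}"
        "\<lambda>y. s * (u y - u (S y)) / 2 - N * (1 - E y)"
        "\<lambda>i y. s * (u1 i y - c i * u1 i (S y)) / 2 - N * (k i * E y)"
        "\<lambda>i y. s * (u2 i y - u2 i (S y)) / 2 + N * (k i * E y)"])
    show "open {y::real^2. a < y $ j}" by (rule open_halfspace_component_gt_cart)
    show "compact (cball 0 Q \<inter> {y::real^2. a \<le> y $ j})"
      by (intro compact_Int_closed compact_cball closed_halfspace_component_ge_cart)
    show "continuous_on (cball 0 Q \<inter> {y. a \<le> y $ j}) (\<lambda>y. s * (u y - u (S y)) / 2 - N * (1 - E y))"
      using u(1) contS by (auto simp: E_def intro!: continuous_intros intro: continuous_on_subset)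
    show "s * (u y - u (S y)) / 2 - N * (1 - E y) \<le> 0"
      if "y \<in> cball 0 Q \<inter> {y. a \<le> y $ j}" "y \<notin> {y. a < y $ j}" for y
    proof -
      have "y $ j = a" using that by auto
      then show ?thesis by (simp add: S_def E_def)
    qed
    show "s * (u y - u (S y)) / 2 - N * (1 - E y) \<le> 0"
      if "y \<in> {y. a < y $ j}" "y \<notin> cball 0 Q \<inter> {y. a \<le> y $ j}" for y
    proof -
      have "norm y > Q" "a < y $ j" using that by auto
      then have "u y = 0" "u (S y) = 0" using far QR u(2) by auto
      moreover have "E y \<le> 1" using \<open>a < y $ j\<close> by (simp add: E_def)
      ultimately show ?thesis using \<open>N \<ge> 0\<close> by simp
    qed
    show "((\<lambda>h. s * (u (y + h *\<^sub>R axis i 1) - u (S (y + h *\<^sub>R axis i 1))) / 2 - N * (1 - E (y + h *\<^sub>R axis i 1)))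
        has_real_derivative s * (u1 i y - c i * u1 i (S y)) / 2 - N * (k i * E y)) (at 0)" for y i
      by (auto intro!: derivative_eq_intros D1 DS1 DE)
    show "((\<lambda>h. s * (u1 i (y + h *\<^sub>R axis i 1) - c i * u1 i (S (y + h *\<^sub>R axis i 1))) / 2 - N * (k i * E (y + h *\<^sub>R axis i 1)))
        has_real_derivative s * (u2 i y - u2 i (S y)) / 2 + N * (k i * E y)) (at 0)" for y i
      using DERIV_diff[OF DERIV_cdivide[OF DERIV_cmult[OF DERIV_diff[OF D2[where x=y and i=i] DS2[where y=y and i=i]], of s], of 2]
          DERIV_cmult[OF DERIV_cmult[OF DE[where y=y and i=i], of "k i"], of N]]
      by (cases "i = j") (auto simp: k_def)
    show "s * (u y - u (S y)) / 2 - N * (1 - E y) -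
         (\<Sum>i\<in>UNIV. s * (u2 i y - u2 i (S y)) / 2 + N * (k i * E y)) \<le> 0" for y
    proof -
      have "(\<Sum>i\<in>UNIV. s * (u2 i y - u2 i (S y)) / 2 + N * (k i * E y))
          = s * ((\<Sum>i\<in>UNIV. u2 i y) - (\<Sum>i\<in>UNIV. u2 i (S y))) / 2 + N * E y"
        by (simp add: sum.distrib sum_distrib_left[symmetric] sum_divide_distrib[symmetric] sum_subtractf sumk)
      then have "s * (u y - u (S y)) / 2 - N * (1 - E y) -
         (\<Sum>i\<in>UNIV. s * (u2 i y - u2 i (S y)) / 2 + N * (k i * E y))
          = s * ((u y - (\<Sum>i\<in>UNIV. u2 i y)) - (u (S y) - (\<Sum>i\<in>UNIV. u2 i (S y)))) / 2 - N"
        by (simp add: field_simps)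
      then show ?thesis using N[of y] N[of "S y"] s by auto
    qed
  qed (use y in auto)
  have q: "\<bar>u (x + h *\<^sub>R axis j 1) - u (x + (- h) *\<^sub>R axis j 1)\<bar> / 2 \<le> N * (1 - exp (- h))" if "h > 0" for h
  proof -
    have "S (x + h *\<^sub>R axis j 1) = x + (- h) *\<^sub>R axis j 1"
      by (simp add: S_def a_def algebra_simps vec_eq_iff axis_def)
    moreover have "E (x + h *\<^sub>R axis j 1) = exp (- h)" by (simp add: E_def a_def)
    moreover have "(x + h *\<^sub>R axis j 1) $ j > a" using that by (simp add: a_def)
    ultimately show ?thesis
      using main[of 1 "x + h *\<^sub>R axis j 1"] main[of "-1" "x + h *\<^sub>R axis j 1"] by auto
  qed
  \<comment> \<open>The central difference has the same derivative at 0 as u along the axis, and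
    \<open>q\<close> bounds it by N (1 - exp (- h)) <= N h.\<close>
  have "((\<lambda>h. (u (x + h *\<^sub>R axis j 1) - u (x + (- h) *\<^sub>R axis j 1)) / 2) has_real_derivative u1 j x) (at 0)"
  proof -
    have "((\<lambda>h. u (x + (- h) *\<^sub>R axis j 1)) has_real_derivative - u1 j x) (at 0)"
      using DERIV_chain'[OF DERIV_minus[OF DERIV_ident], where g="\<lambda>k. u (x + k *\<^sub>R axis j 1)" and E="u1 j x"]
        D1[where x=x and i=j] by simp
    then show ?thesis using D1[where x=x and i=j] by (auto intro!: derivative_eq_intros)
  qed
  then have "((\<lambda>h. (u (x + h *\<^sub>R axis j 1) - u (x + (- h) *\<^sub>R axis j 1)) / 2 / h) \<longlongrightarrow> u1 j x) (at 0)"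
    by (simp add: DERIV_def)
  then have "((\<lambda>h. (u (x + h *\<^sub>R axis j 1) - u (x + (- h) *\<^sub>R axis j 1)) / 2 / h) \<longlongrightarrow> u1 j x) (at_right 0)"
    by (rule filterlim_mono) (auto simp: at_le)
  then have "((\<lambda>h. \<bar>(u (x + h *\<^sub>R axis j 1) - u (x + (- h) *\<^sub>R axis j 1)) / 2 / h\<bar>) \<longlongrightarrow> \<bar>u1 j x\<bar>) (at_right 0)"
    by (rule tendsto_rabs)
  moreover have "\<forall>\<^sub>F h in at_right 0. \<bar>(u (x + h *\<^sub>R axis j 1) - u (x + (- h) *\<^sub>R axis j 1)) / 2 / h\<bar> \<le> N"
    using eventually_at_right_less[of 0]
  proof eventually_elim
    case (elim h)
    have "1 - exp (- h) \<le> h" using exp_ge_add_one_self[of "-h"] by simp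
    then have "N * (1 - exp (- h)) \<le> N * h" using \<open>N \<ge> 0\<close> by (rule mult_left_mono)
    then show ?case using q[OF elim] elim by (simp add: abs_divide field_simps)
  qed
  ultimately show ?thesis by (rule tendsto_upperbound) simp
qed

subsection \<open>Functions with continuous partial derivatives\<close>

definition grad_x :: "(real \<Rightarrow> real^2 \<Rightarrow> real) \<Rightarrow> real \<Rightarrow> real^2 \<Rightarrow> real^2" where
  "grad_x f t x = (\<chi> i. dx i f t x)"

lemma C_k_dt: "C_k (Suc k) f \<Longrightarrow> C_k k (dt f)"
  and C_k_dx: "C_k (Suc k) f \<Longrightarrow> C_k k (dx i f)"
  by simp_all

lemma C_1_continuous_dx:
  assumes "C_k (Suc k) f"
  shows "continuous_on ({0..} \<times> UNIV) (\<lambda>(t, x). dx i f t x)"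
  using assms C_k_continuous[of k "dx i f"] by simp

lemma C_1_continuous_dt:
  assumes "C_k (Suc k) f"
  shows "continuous_on ({0..} \<times> UNIV) (\<lambda>(t, x). dt f t x)"
  using assms C_k_continuous[of k "dt f"] by simp

lemma C_1_continuous_grad:
  assumes "C_k (Suc k) f"
  shows "continuous_on ({0..} \<times> UNIV) (\<lambda>(t, x). grad_x f t x)"
  using C_1_continuous_dx[OF assms]
  by (auto simp: grad_x_def case_prod_unfold intro!: continuous_on_vec_lambda)

text \<open>Existence of both partials and continuity of one of them give total differentiability.
  The detour through \<open>vector [a, b]\<close> turns \<open>real^2\<close> into a product, the
  form that \<open>has_derivative_partialsI\<close> needs.\<close>

lemma C_1_has_derivative_space:
  assumes f: "C_k (Suc k) f" and t: "t \<ge> 0"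
  shows "(f t has_derivative (\<lambda>h. grad_x f t x \<bullet> h)) (at x)"
proof -
  let ?F = "\<lambda>a b. f t (vector [a, b])"
  have v: "vector [a, b] = (\<chi> i::2. if i = 1 then a else b)" for a b :: real
    by (simp add: vec_eq_iff forall_2)
  have cx: "continuous_on A (\<lambda>x. dx i f t x)" for A i
    using continuous_on_compose2[OF C_1_continuous_dx[OF f], of A "\<lambda>x. (t, x)"] t
    by (force intro!: continuous_intros)
  have D: "((\<lambda>h. f t (x + h *\<^sub>R axis i 1)) has_real_derivative dx i f t x) (at 0)" for x i
    by (rule C_1_grad[OF f t])
  have 1: "((\<lambda>a. ?F a b) has_derivative (\<lambda>h. dx 1 f t (vector [a, b]) * h)) (at a)" for a b
  proof -
    have e: "vector [a, b] + h *\<^sub>R axis 1 1 = (vector [h + a, b] :: real^2)" for h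
      by (simp add: vec_eq_iff forall_2 axis_def)
    have "((\<lambda>h. f t (vector [h + a, b])) has_real_derivative dx 1 f t (vector [a, b])) (at 0)"
      using D[where x="vector [a, b]" and i=1] unfolding e .
    then show ?thesis
      using DERIV_shift[of "\<lambda>a. ?F a b" "dx 1 f t (vector [a, b])" 0 a]
      by (simp add: has_field_derivative_def)
  qed
  have 2: "((\<lambda>b. ?F a b) has_derivative blinfun_apply (blinfun_scaleR_left (dx 2 f t (vector [a, b])))) (at b)" for a b
  proof -
    have e: "vector [a, b] + h *\<^sub>R axis 2 1 = (vector [a, h + b] :: real^2)" for h
      by (simp add: vec_eq_iff forall_2 axis_def)
    have "((\<lambda>h. f t (vector [a, h + b])) has_real_derivative dx 2 f t (vector [a, b])) (at 0)"
      using D[where x="vector [a, b]" and i=2] unfolding e .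
    then show ?thesis
      using DERIV_shift[of "\<lambda>b. ?F a b" "dx 2 f t (vector [a, b])" 0 b]
      by (simp add: has_field_derivative_def mult_commute_abs)
  qed
  have "continuous_on UNIV (\<lambda>(a, b). dx 2 f t (vector [a, b]))"
    unfolding v case_prod_unfold
  proof (rule continuous_on_compose2[OF cx])
    have "continuous_on UNIV (\<lambda>p. if i = 1 then fst p else snd p :: real)" for i :: 2
      by (cases "i = 1") (auto intro!: continuous_intros)
    then show "continuous_on UNIV (\<lambda>p. \<chi> i::2. if i = 1 then fst p else (snd p :: real))"
      by (rule continuous_on_vec_lambda)
  qed auto
  then have "continuous_on UNIV (\<lambda>(a, b). blinfun_scaleR_left (dx 2 f t (vector [a, b])) :: real \<Rightarrow>\<^sub>L real)"
    unfolding case_prod_unfold by (intro bounded_linear.continuous_on[OF bounded_linear_blinfun_scaleR_left])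
  then have c2: "continuous (at p within UNIV \<times> UNIV) (\<lambda>(a, b). blinfun_scaleR_left (dx 2 f t (vector [a, b])) :: real \<Rightarrow>\<^sub>L real)" for p
    by (cases p) (simp add: continuous_on_eq_continuous_within)
  have F: "((\<lambda>(a, b). ?F a b) has_derivative (\<lambda>(h, k). dx 1 f t (vector [a, b]) * h +
      blinfun_apply (blinfun_scaleR_left (dx 2 f t (vector [a, b]))) k)) (at (a, b))" for a b
    using has_derivative_partialsI[of ?F b "\<lambda>h. dx 1 f t (vector [a, b]) * h" a UNIV UNIV
        "\<lambda>a b. blinfun_scaleR_left (dx 2 f t (vector [a, b]))"] 1 2 c2 by simp
  have L: "((\<lambda>y::real^2. (y $ 1, y $ 2)) has_derivative (\<lambda>h. (h $ 1, h $ 2))) (at x)"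
    by (intro has_derivative_Pair bounded_linear_imp_has_derivative bounded_linear_vec_nth)
  have vx: "vector [y $ 1, y $ 2] = (y :: real^2)" for y by (simp add: vec_eq_iff forall_2)
  have "((\<lambda>y. f t (vector [y $ 1, y $ 2])) has_derivative (\<lambda>h. dx 1 f t x * h $ 1 + dx 2 f t x * h $ 2)) (at x)"
    using has_derivative_compose[OF L F[of "x $ 1" "x $ 2"]] by (simp add: vx mult.commute)
  then show ?thesis
    by (simp add: vx grad_x_def inner_vec_def UNIV_2 sum_2)
qed

text \<open>The same criterion with time as first factor: it uses the one-sided time derivative at t
  and the continuous spatial gradient, and so reaches the boundary t = 0.\<close>

lemma C_1_has_derivative:
  assumes f: "C_k (Suc k) f" and t: "t \<ge> 0"
  shows "((\<lambda>(t, x). f t x) has_derivative (\<lambda>(a, h). a * dt f t x + grad_x f t x \<bullet> h))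
    (at (t, x) within {0..} \<times> UNIV)"
proof -
  have "((\<lambda>s. f s x) has_derivative (\<lambda>a. a * dt f t x)) (at t within {0..})"
    using dt_has_derivative[of f x t] f t by (simp add: has_vector_derivative_def)
  moreover have "(f s has_derivative blinfun_apply (blinfun_inner_right (grad_x f s y))) (at y)"
    if "s \<ge> 0" for s y
    using C_1_has_derivative_space[OF f that] by simp
  moreover have "continuous (at (t, x) within {0..} \<times> UNIV) (\<lambda>(s, y). blinfun_inner_right (grad_x f s y))"
  proof -
    have "continuous_on ({0..} \<times> UNIV) (\<lambda>(s, y). blinfun_inner_right (grad_x f s y))"
      using C_1_continuous_grad[OF f] unfolding case_prod_unfold
      by (rule bounded_linear.continuous_on[OF bounded_linear_blinfun_inner_right])
    then show ?thesis using t by (simp add: continuous_on_eq_continuous_within)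
  qed
  ultimately show ?thesis
    using has_derivative_partialsI[of f x "\<lambda>a. a * dt f t x" t "{0..}" UNIV
        "\<lambda>s y. blinfun_inner_right (grad_x f s y)"] t by simp
qed

lemma C_1_along_curve:
  assumes f: "C_k (Suc k) f" and t: "t \<in> S" and S: "S \<subseteq> {0..}"
    and c: "(c has_vector_derivative c') (at t within S)"
  shows "((\<lambda>s. f s (c s)) has_real_derivative (dt f t (c t) + grad_x f t (c t) \<bullet> c')) (at t within S)"
proof -
  have "((\<lambda>s. (s, c s)) has_derivative (\<lambda>h. (h, h *\<^sub>R c'))) (at t within S)"
    using c by (auto simp: has_vector_derivative_def intro!: has_derivative_Pair)
  moreover have "((\<lambda>(t, x). f t x) has_derivative (\<lambda>(a, h). a * dt f t (c t) + grad_x f t (c t) \<bullet> h))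
    (at (t, c t) within (\<lambda>s. (s, c s)) ` S)"
    by (rule has_derivative_subset[OF C_1_has_derivative[OF f]]) (use S t in auto)
  from has_derivative_in_compose[OF calculation(1) this]
  have "((\<lambda>s. f s (c s)) has_derivative (\<lambda>h. h * dt f t (c t) + grad_x f t (c t) \<bullet> (h *\<^sub>R c'))) (at t within S)"
    by simp
  moreover have "(\<lambda>h. h * dt f t (c t) + grad_x f t (c t) \<bullet> (h *\<^sub>R c')) = (*) (dt f t (c t) + grad_x f t (c t) \<bullet> c')"
    by (auto simp: algebra_simps)
  ultimately show ?thesis by (simp add: has_field_derivative_def)
qed

lemma gradient_along_curve:
  fixes g :: "'a::euclidean_space \<Rightarrow> real"
  assumes g: "(g has_derivative (\<lambda>h. G \<bullet> h)) (at (c t))"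
    and c: "(c has_vector_derivative c') (at t within S)"
  shows "((\<lambda>s. g (c s)) has_real_derivative (G \<bullet> c')) (at t within S)"
proof -
  have "((\<lambda>s. g (c s)) has_derivative (\<lambda>h. G \<bullet> (h *\<^sub>R c'))) (at t within S)"
    using has_derivative_compose[OF c[unfolded has_vector_derivative_def] g] by simp
  then show ?thesis by (simp add: has_field_derivative_def mult_commute_abs)
qed

text \<open>\<open>C_k\<close> demands that both mixed partials exist, not that they agree, and at t
  = 0 there is no full neighbourhood in time. Symmetry is derived instead from writing f at time s
  as f at time 0 plus the time integral of \<open>dt f\<close>: differentiate this in x under the
  integral, then in s.\<close>

lemma C_2_mixed_partials:
  assumes f: "C_k (Suc (Suc k)) f" and t: "t \<ge> 0"
  shows "dt (dx i f) t x = dx i (dt f) t x"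
proof -
  have f1: "C_k (Suc k) f" and ft: "C_k (Suc k) (dt f)" and fx: "C_k (Suc k) (dx i f)"
    by (fact C_k_Suc_imp[OF f] C_k_dt[OF f] C_k_dx[OF f])+
  have cont: "continuous_on ({0..} \<times> UNIV) (\<lambda>(t, x). dx i (dt f) t x)"
    by (rule C_1_continuous_dx[OF ft])
  have contt: "continuous_on ({0..} \<times> UNIV) (\<lambda>(t, x). dt f t x)"
    by (rule C_1_continuous_dt[OF f1])
  have cont_slice: "continuous_on (cbox a s) (\<lambda>\<sigma>. F \<sigma> y)"
    if "continuous_on ({0..} \<times> UNIV) (\<lambda>(t, x). F t x)" "a \<ge> 0" for F :: "real \<Rightarrow> real^2 \<Rightarrow> real" and a s y
    using continuous_on_compose2[OF that(1), of "cbox a s" "\<lambda>\<sigma>. (\<sigma>, y)"] that(2)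
    by (simp add: continuous_intros image_subset_iff)
  have eq: "f s y = f 0 y + integral (cbox 0 s) (\<lambda>\<sigma>. dt f \<sigma> y)" if "s \<ge> 0" for s y
  proof -
    have "((\<lambda>\<sigma>. dt f \<sigma> y) has_integral (f s y - f 0 y)) {0..s}"
    proof (rule fundamental_theorem_of_calculus[OF that])
      fix \<sigma> assume "\<sigma> \<in> {0..s}"
      then show "((\<lambda>\<sigma>. f \<sigma> y) has_vector_derivative dt f \<sigma> y) (at \<sigma> within {0..s})"
        using has_vector_derivative_within_subset[OF dt_has_derivative[of f y \<sigma>], of "{0..s}"] f1 by simp
    qed
    then show ?thesis by (simp add: integral_unique)
  qed
  have eqx: "dx i f s x = dx i f 0 x + integral {0..s} (\<lambda>\<sigma>. dx i (dt f) \<sigma> x)" if "s \<ge> 0" for s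
  proof (rule dx_unique)
    have "((\<lambda>h. integral (cbox 0 s) (\<lambda>\<sigma>. dt f \<sigma> (x + h *\<^sub>R axis i 1))) has_real_derivative
        integral (cbox 0 s) (\<lambda>\<sigma>. dx i (dt f) \<sigma> (x + 0 *\<^sub>R axis i 1))) (at 0 within UNIV)"
    proof (rule leibniz_rule_field_derivative)
      show "((\<lambda>h. dt f \<sigma> (x + h *\<^sub>R axis i 1)) has_real_derivative dx i (dt f) \<sigma> (x + h *\<^sub>R axis i 1)) (at h)"
        if "\<sigma> \<in> cbox 0 s" for h \<sigma>
      proof -
        have "((\<lambda>k. dt f \<sigma> (x + h *\<^sub>R axis i 1 + k *\<^sub>R axis i 1)) has_real_derivative dx i (dt f) \<sigma> (x + h *\<^sub>R axis i 1)) (at 0)"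
          using C_1_grad[OF ft] that by auto
        then show ?thesis
          using DERIV_shift[of "\<lambda>h. dt f \<sigma> (x + h *\<^sub>R axis i 1)" _ 0 h] by (simp add: algebra_simps)
      qed
      show "(\<lambda>\<sigma>. dt f \<sigma> (x + h *\<^sub>R axis i 1)) integrable_on cbox 0 s" for h
        by (intro integrable_continuous cont_slice[OF contt]) simp
      show "continuous_on (UNIV \<times> cbox 0 s) (\<lambda>(h, \<sigma>). dx i (dt f) \<sigma> (x + h *\<^sub>R axis i 1))"
        using continuous_on_compose2[OF cont, of "UNIV \<times> cbox 0 s" "\<lambda>p. (snd p, x + fst p *\<^sub>R axis i 1)"]
        by (simp add: case_prod_unfold continuous_intros image_subset_iff)
    qed auto
    moreover have "((\<lambda>h. f 0 (x + h *\<^sub>R axis i 1)) has_real_derivative dx i f 0 x) (at 0)"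
      by (rule C_1_grad[OF f1]) simp
    ultimately show "((\<lambda>h. f s (x + h *\<^sub>R axis i 1)) has_real_derivative
        dx i f 0 x + integral {0..s} (\<lambda>\<sigma>. dx i (dt f) \<sigma> x)) (at 0)"
      unfolding eq[OF that] by (simp add: DERIV_add)
  qed
  \<comment> \<open>The interval extends to t + 1 so that near t it looks like \<open>{0..}\<close>;
    the derivative obtained is then the one that \<open>dt\<close> refers to.\<close>
  have "((\<lambda>s. integral {0..s} (\<lambda>\<sigma>. dx i (dt f) \<sigma> x)) has_vector_derivative dx i (dt f) t x) (at t within {0..t+1})"
    by (rule integral_has_vector_derivative) (use t cont_slice[OF cont, of 0 "t + 1"] in auto)
  moreover have "at t within {0..t+1} = at t within {0..}"
    by (rule at_within_nhd[of _ "{..<t+1}"]) auto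
  ultimately have "((\<lambda>s. dx i f 0 x + integral {0..s} (\<lambda>\<sigma>. dx i (dt f) \<sigma> x)) has_vector_derivative dx i (dt f) t x) (at t within {0..})"
    using has_vector_derivative_add[OF has_vector_derivative_const[of "dx i f 0 x"]] by fastforce
  then have "((\<lambda>s. dx i f s x) has_vector_derivative dx i (dt f) t x) (at t within {0..})"
    by (rule has_vector_derivative_transform[rotated 2]) (use t eqx[symmetric] in auto)
  then show ?thesis by (rule dt_unique[OF _ t])
qed

subsection \<open>Representation of the solution\<close>

definition er :: "real \<Rightarrow> real^2" where
  "er \<theta> = cos \<theta> *\<^sub>R axis 1 1 + sin \<theta> *\<^sub>R axis 2 1"

definition et :: "real \<Rightarrow> real^2" where
  "et \<theta> = (- sin \<theta>) *\<^sub>R axis 1 1 + cos \<theta> *\<^sub>R axis 2 1"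

lemma er_nth [simp]: "er \<theta> $ 1 = cos \<theta>" "er \<theta> $ 2 = sin \<theta>"
  and et_nth [simp]: "et \<theta> $ 1 = - sin \<theta>" "et \<theta> $ 2 = cos \<theta>"
  by (simp_all add: er_def et_def axis_def)

lemma continuous_on_er [continuous_intros]:
  fixes S :: "'a::t2_space set"
  shows "continuous_on S f \<Longrightarrow> continuous_on S (\<lambda>p. er (f p))"
    and "continuous_on S f \<Longrightarrow> continuous_on S (\<lambda>p. et (f p))"
  by (auto simp: er_def et_def intro!: continuous_intros)

lemma er_deriv: "(er has_vector_derivative et \<theta>) (at \<theta> within S)"
  unfolding er_def et_def by (auto intro!: derivative_eq_intros simp: algebra_simps)

lemma inner_real2: "(a :: real^2) \<bullet> b = a $ 1 * b $ 1 + a $ 2 * b $ 2"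
  by (simp add: inner_vec_def sum_2)

lemma norm_er [simp]: "norm (er \<theta>) = 1"
  by (simp add: norm_eq_1 inner_real2 power2_eq_square[symmetric])

lemma er_periodic_shift: "er (\<alpha> + pi) = er (\<alpha> - pi)" "et (\<alpha> + pi) = et (\<alpha> - pi)"
  by (simp_all add: er_def et_def)

lemma inner_er_et: "a \<bullet> b = (a \<bullet> er \<theta>) * (b \<bullet> er \<theta>) + (a \<bullet> et \<theta>) * (b \<bullet> et \<theta>)"
proof -
  have "(cos \<theta>)\<^sup>2 = 1 - (sin \<theta>)\<^sup>2" by (simp add: cos_squared_eq)
  then show ?thesis by (simp add: inner_real2) algebra
qed

section \<open>Total derivatives on boxes and integrals over the hemisphere\<close>

lemma box_integral_fst:
  fixes F :: "real \<Rightarrow> real \<Rightarrow> real"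
  assumes "a \<le> b" "continuous_on (cbox (a, c) (b, d)) (\<lambda>(x, y). F' x y)"
    and "\<And>x y. x \<in> {a..b} \<Longrightarrow> y \<in> {c..d} \<Longrightarrow> ((\<lambda>x. F x y) has_real_derivative F' x y) (at x within {a..b})"
  shows "integral (cbox (a, c) (b, d)) (\<lambda>(x, y). F' x y) = integral {c..d} (\<lambda>y. F b y - F a y)"
proof -
  have "integral (cbox (a, c) (b, d)) (\<lambda>(x, y). F' x y) = integral (cbox a b) (\<lambda>x. integral (cbox c d) (\<lambda>y. F' x y))"
    using integral_prod_continuous[OF assms(2)] by simp
  also have "\<dots> = integral (cbox c d) (\<lambda>y. integral (cbox a b) (\<lambda>x. F' x y))"
    by (rule integral_swap_continuous[OF assms(2)])
  also have "\<dots> = integral {c..d} (\<lambda>y. F b y - F a y)"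
    unfolding cbox_interval
  proof (rule integral_cong)
    fix y assume "y \<in> {c..d}"
    then have "((\<lambda>x. F' x y) has_integral (F b y - F a y)) {a..b}"
      using assms by (intro fundamental_theorem_of_calculus) (auto simp: has_real_derivative_iff_has_vector_derivative)
    then show "integral {a..b} (\<lambda>x. F' x y) = F b y - F a y" by (rule integral_unique)
  qed
  finally show ?thesis .
qed

lemma box_integral_snd:
  fixes F :: "real \<Rightarrow> real \<Rightarrow> real"
  assumes "c \<le> d" "continuous_on (cbox (a, c) (b, d)) (\<lambda>(x, y). F' x y)"
    and "\<And>x y. x \<in> {a..b} \<Longrightarrow> y \<in> {c..d} \<Longrightarrow> ((\<lambda>y. F x y) has_real_derivative F' x y) (at y within {c..d})"
  shows "integral (cbox (a, c) (b, d)) (\<lambda>(x, y). F' x y) = integral {a..b} (\<lambda>x. F x d - F x c)"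
proof -
  have "integral (cbox (a, c) (b, d)) (\<lambda>(x, y). F' x y) = integral (cbox a b) (\<lambda>x. integral (cbox c d) (\<lambda>y. F' x y))"
    using integral_prod_continuous[OF assms(2)] by simp
  also have "\<dots> = integral {a..b} (\<lambda>x. F x d - F x c)"
    unfolding cbox_interval
  proof (rule integral_cong)
    fix x assume "x \<in> {a..b}"
    then have "((\<lambda>y. F' x y) has_integral (F x d - F x c)) {c..d}"
      using assms by (intro fundamental_theorem_of_calculus) (auto simp: has_real_derivative_iff_has_vector_derivative)
    then show "integral {c..d} (\<lambda>y. F' x y) = F x d - F x c" by (rule integral_unique)
  qed
  finally show ?thesis .
qed

text \<open>The box of angles of a hemisphere, not the surface: phi is the angle from the pole, so
  phi = pi/2 is the equator. The theta-interval is centred at a free \<alpha>, later the polar angle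
  of x, so that |theta - \<alpha>| <= pi is the angle to x.\<close>

abbreviation half_sphere :: "real \<Rightarrow> (real \<times> real) set" where
  "half_sphere \<alpha> \<equiv> cbox (0, \<alpha> - pi) (pi / 2, \<alpha> + pi)"

abbreviation sphere_point :: "real^2 \<Rightarrow> real \<Rightarrow> real \<Rightarrow> real \<Rightarrow> real^2" where
  "sphere_point x \<tau> \<phi> \<theta> \<equiv> x - (\<tau> * sin \<phi>) *\<^sub>R er \<theta>"

lemma sphere_point_deriv_phi:
  "((\<lambda>\<phi>. sphere_point x \<tau> \<phi> \<theta>) has_vector_derivative (- (\<tau> * cos \<phi>)) *\<^sub>R er \<theta>) (at \<phi> within S)"
  by (auto intro!: derivative_eq_intros simp: algebra_simps)

lemma sphere_point_deriv_theta:
  "((\<lambda>\<theta>. sphere_point x \<tau> \<phi> \<theta>) has_vector_derivative (- (\<tau> * sin \<phi>)) *\<^sub>R et \<theta>) (at \<theta> within S)"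
  using has_vector_derivative_diff[OF has_vector_derivative_const[of x]
      has_vector_derivative_scaleR[OF DERIV_const er_deriv], of "\<tau> * sin \<phi>" \<theta> S]
  by simp

text \<open>In the application \<open>G\<close> is the gradient of v at a fixed time and
  \<open>K 1\<close>, \<open>K 2\<close> are the rows of its Hessian. Extend v constantly in a third
  variable: the expression multiplied by the outer sin phi is then tau times the Laplace-Beltrami
  operator of the sphere of radius tau applied to v. Its integral over the hemisphere vanishes,
  because the symmetric extension has no flux through the equator.\<close>

lemma half_sphere_laplacian_identity:
  fixes G :: "real^2 \<Rightarrow> real^2" and K :: "2 \<Rightarrow> real^2 \<Rightarrow> real^2"
  assumes G: "\<And>i y. ((\<lambda>y. G y $ i) has_derivative (\<lambda>h. K i y \<bullet> h)) (at y)"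
    and K: "\<And>i. continuous_on UNIV (K i)"
  defines "Q \<equiv> \<lambda>y \<theta>. cos \<theta> * (K 1 y \<bullet> er \<theta>) + sin \<theta> * (K 2 y \<bullet> er \<theta>)"
  shows "integral (half_sphere \<alpha>) (\<lambda>(\<phi>, \<theta>). sin \<phi> * (2 * sin \<phi> * (G (sphere_point x \<tau> \<phi> \<theta>) \<bullet> er \<theta>)
      + \<tau> * (K 1 (sphere_point x \<tau> \<phi> \<theta>) $ 1 + K 2 (sphere_point x \<tau> \<phi> \<theta>) $ 2
             - (sin \<phi>)\<^sup>2 * Q (sphere_point x \<tau> \<phi> \<theta>) \<theta>))) = 0"
proof -
  have "continuous_on UNIV (\<lambda>y. \<chi> i. G y $ i)"
    by (intro continuous_on_vec_lambda continuous_at_imp_continuous_on ballI has_derivative_continuous[OF G])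
  then have contG: "continuous_on UNIV G" by simp
  let ?y = "\<lambda>\<phi> \<theta>. sphere_point x \<tau> \<phi> \<theta>"
  have DG: "((\<lambda>s. G (c s) $ i) has_real_derivative (K i (c s) \<bullet> c')) (at s within S)"
    if "(c has_vector_derivative c') (at s within S)" for c c' s S i
    by (rule gradient_along_curve[where g="\<lambda>y. G y $ i", OF G that])
  \<comment> \<open>Up to the factor -tau, \<open>A\<close> is sin phi times the phi-derivative and
    \<open>B\<close> is 1 / sin phi times the theta-derivative of v on the sphere; in
    \<open>B\<close> the division has cancelled. \<open>A\<close> vanishes at the pole and on the
    equator, \<open>B\<close> is periodic.\<close>
  define A where "A = (\<lambda>\<phi> \<theta>. sin \<phi> * cos \<phi> * (G (?y \<phi> \<theta>) \<bullet> er \<theta>))"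
  define A' where "A' = (\<lambda>\<phi> \<theta>. ((cos \<phi>)\<^sup>2 - (sin \<phi>)\<^sup>2) * (G (?y \<phi> \<theta>) \<bullet> er \<theta>) - \<tau> * sin \<phi> * (cos \<phi>)\<^sup>2 * Q (?y \<phi> \<theta>) \<theta>)"
  define B where "B = (\<lambda>\<phi> \<theta>. G (?y \<phi> \<theta>) \<bullet> et \<theta>)"
  define B' where "B' = (\<lambda>\<phi> \<theta>. - (G (?y \<phi> \<theta>) \<bullet> er \<theta>) - \<tau> * sin \<phi> *
      (- sin \<theta> * (K 1 (?y \<phi> \<theta>) \<bullet> et \<theta>) + cos \<theta> * (K 2 (?y \<phi> \<theta>) \<bullet> et \<theta>)))"
  have cG: "continuous_on S (\<lambda>p. G (?y (fst p) (snd p)))" for S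
    by (rule continuous_on_compose2[OF contG]) (auto intro!: continuous_intros)
  have cK: "continuous_on S (\<lambda>p. K i (?y (fst p) (snd p)))" for S i
    by (rule continuous_on_compose2[OF K]) (auto intro!: continuous_intros)
  have cA': "continuous_on S (\<lambda>(\<phi>, \<theta>). A' \<phi> \<theta>)" for S
    unfolding A'_def Q_def case_prod_unfold by (intro continuous_intros cG cK)
  have cB': "continuous_on S (\<lambda>(\<phi>, \<theta>). B' \<phi> \<theta>)" for S
    unfolding B'_def case_prod_unfold by (intro continuous_intros cG cK)
  have "integral (half_sphere \<alpha>) (\<lambda>(\<phi>, \<theta>). A' \<phi> \<theta>) = integral {\<alpha> - pi..\<alpha> + pi} (\<lambda>\<theta>. A (pi/2) \<theta> - A 0 \<theta>)"
  proof (rule box_integral_fst[OF _ cA'])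
    fix \<phi> \<theta> :: real
    show "((\<lambda>\<phi>. A \<phi> \<theta>) has_real_derivative A' \<phi> \<theta>) (at \<phi> within {0..pi/2})"
      unfolding A_def inner_real2
      by (rule derivative_eq_intros DG sphere_point_deriv_phi refl)+
         (simp add: A'_def Q_def inner_real2 algebra_simps power2_eq_square)
  qed simp
  moreover have "integral (half_sphere \<alpha>) (\<lambda>(\<phi>, \<theta>). B' \<phi> \<theta>) = integral {0..pi/2} (\<lambda>\<phi>. B \<phi> (\<alpha> + pi) - B \<phi> (\<alpha> - pi))"
  proof (rule box_integral_snd[OF _ cB'])
    fix \<phi> \<theta> :: real
    show "((\<lambda>\<theta>. B \<phi> \<theta>) has_real_derivative B' \<phi> \<theta>) (at \<theta> within {\<alpha> - pi..\<alpha> + pi})"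
      unfolding B_def inner_real2 et_nth
      by (rule derivative_eq_intros DG sphere_point_deriv_theta refl)+
         (simp add: B'_def inner_real2 algebra_simps)
  qed simp
  moreover have "A (pi/2) \<theta> - A 0 \<theta> = 0" "B \<phi> (\<alpha> + pi) - B \<phi> (\<alpha> - pi) = 0" for \<phi> \<theta>
    by (simp_all add: A_def B_def er_periodic_shift)
  ultimately have z: "integral (half_sphere \<alpha>) (\<lambda>(\<phi>, \<theta>). A' \<phi> \<theta>) = 0"
    "integral (half_sphere \<alpha>) (\<lambda>(\<phi>, \<theta>). B' \<phi> \<theta>) = 0" by simp_all
  have eq: "sin \<phi> * (2 * sin \<phi> * (G (?y \<phi> \<theta>) \<bullet> er \<theta>) + \<tau> * (K 1 (?y \<phi> \<theta>) $ 1 + K 2 (?y \<phi> \<theta>) $ 2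
             - (sin \<phi>)\<^sup>2 * Q (?y \<phi> \<theta>) \<theta>)) = - (A' \<phi> \<theta> + B' \<phi> \<theta>)" for \<phi> \<theta>
  proof -
    define a b c d where "a = K 1 (?y \<phi> \<theta>) $ 1" "b = K 1 (?y \<phi> \<theta>) $ 2" "c = K 2 (?y \<phi> \<theta>) $ 1" "d = K 2 (?y \<phi> \<theta>) $ 2"
    define g where "g = G (?y \<phi> \<theta>) \<bullet> er \<theta>"
    have 1: "(cos \<phi>)\<^sup>2 = 1 - (sin \<phi>)\<^sup>2" "(cos \<theta>)\<^sup>2 = 1 - (sin \<theta>)\<^sup>2" by (simp_all add: cos_squared_eq)
    show ?thesis
      unfolding A'_def B'_def Q_def g_def[symmetric] inner_real2[of "K 1 _"] inner_real2[of "K 2 _"] er_nth et_nth a_b_c_d_def[symmetric]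
      using 1 by algebra
  qed
  have "((\<lambda>p. - ((case p of (\<phi>, \<theta>) \<Rightarrow> A' \<phi> \<theta>) + (case p of (\<phi>, \<theta>) \<Rightarrow> B' \<phi> \<theta>))) has_integral - (0 + 0)) (half_sphere \<alpha>)"
    using integrable_integral[OF integrable_continuous[OF cA']] integrable_integral[OF integrable_continuous[OF cB']] z
    by (intro has_integral_neg has_integral_add) metis+
  then show ?thesis unfolding eq by (simp add: integral_unique case_prod_unfold)
qed

section \<open>Representation formulas for v and its derivatives\<close>

lemma continuous_on_compose_pair:
  fixes F :: "real \<Rightarrow> 'a::topological_space \<Rightarrow> 'b::topological_space"
  assumes "continuous_on ({0..} \<times> UNIV) (\<lambda>(t, x). F t x)" "continuous_on S a" "continuous_on S b"
    and "\<And>p. p \<in> S \<Longrightarrow> a p \<ge> 0"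
  shows "continuous_on S (\<lambda>p. F (a p) (b p))"
  using continuous_on_compose2[OF assms(1), of S "\<lambda>p. (a p, b p)"] assms
  by (simp add: continuous_on_Pair image_subset_iff)

lemma integral_sin_half_sphere: "integral (half_sphere \<alpha>) (\<lambda>(\<phi>, \<theta>). sin \<phi> * c) = 2 * pi * c"
proof -
  have "continuous_on (half_sphere \<alpha>) (\<lambda>(\<phi>, \<theta>). sin \<phi> * c)"
    unfolding case_prod_unfold by (intro continuous_intros)
  then have "integral (half_sphere \<alpha>) (\<lambda>(\<phi>, \<theta>). sin \<phi> * c)
      = integral {\<alpha> - pi..\<alpha> + pi} (\<lambda>\<theta>. - cos (pi/2) * c - (- cos 0 * c))"
    by (intro box_integral_fst[where F="\<lambda>\<phi> \<theta>. - cos \<phi> * c"]) (auto intro!: derivative_eq_intros)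
  then show ?thesis by simp
qed

text \<open>Duhamel's principle along the backward cone of (T, x): \<open>I\<close> divided by 2 pi
  is the value at (T, x) of the free wave that continues the data of v from time s. The data vanish
  at s = 0, the value at s = T is v T x, and in between only the source changes it.\<close>

theorem wave_representation:
  assumes v: "solves_zero_cauchy H v" and T: "T \<ge> 0"
  shows "2 * pi * v T x = integral {0..T} (\<lambda>s. integral (half_sphere \<alpha>)
           (\<lambda>(\<phi>, \<theta>). (T - s) * (sin \<phi> * H s (sphere_point x (T - s) \<phi> \<theta>))))"
proof -
  have v2: "C_k 2 v" and Hv: "\<And>t x. t \<ge> 0 \<Longrightarrow> dalembertian v t x = H t x"
    and v0: "\<And>x. v 0 x = 0" "\<And>x. dt v 0 x = 0"
    using v by (auto simp: solves_zero_cauchy_def)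
  have v2': "C_k (Suc (Suc 0)) v" using v2 by (simp add: numeral_2_eq_2)
  have v1: "C_k (Suc 0) v" by (rule C_k_Suc_imp[OF v2'])
  have vt1: "C_k (Suc 0) (dt v)" by (rule C_k_dt[OF v2'])
  have vx1: "C_k (Suc 0) (dx i v)" for i by (rule C_k_dx[OF v2'])
  let ?y = "\<lambda>s \<phi> \<theta>. sphere_point x (T - s) \<phi> \<theta>"
  \<comment> \<open>Kirchhoff's integrand for the data at time s, with tau = T - s: sin phi times
    the sum of the tau-derivative of tau v(y) and tau times \<open>dt v\<close>. At s = T it reduces
    to sin phi times v T x.\<close>
  define k where "k = (\<lambda>s (\<phi>, \<theta>). sin \<phi> * (v s (?y s \<phi> \<theta>) + (T - s) * dt v s (?y s \<phi> \<theta>)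
     - (T - s) * sin \<phi> * (dx 1 v s (?y s \<phi> \<theta>) * cos \<theta> + dx 2 v s (?y s \<phi> \<theta>) * sin \<theta>)))"
  define m where "m = (\<lambda>s (\<phi>, \<theta>). sin \<phi> * (2 * sin \<phi> * (grad_x v s (?y s \<phi> \<theta>) \<bullet> er \<theta>)
      + (T - s) * (dx 1 (dx 1 v) s (?y s \<phi> \<theta>) + dx 2 (dx 2 v) s (?y s \<phi> \<theta>)
         - (sin \<phi>)\<^sup>2 * (cos \<theta> * (grad_x (dx 1 v) s (?y s \<phi> \<theta>) \<bullet> er \<theta>) + sin \<theta> * (grad_x (dx 2 v) s (?y s \<phi> \<theta>) \<bullet> er \<theta>)))))"
  define j where "j = (\<lambda>s (\<phi>, \<theta>). (T - s) * (sin \<phi> * H s (?y s \<phi> \<theta>)))"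
  have y_cont: "continuous_on S (\<lambda>p. ?y (fst p) (fst (snd p)) (snd (snd p)))" for S
    by (intro continuous_intros)
  have cH: "continuous_on ({0..} \<times> UNIV) (\<lambda>(t, x). H t x)"
  proof -
    have "continuous_on ({0..} \<times> UNIV) (\<lambda>(t, x). dalembertian v t x)"
      using C_1_continuous_dt[OF vt1] C_1_continuous_dx[OF vx1]
      unfolding dalembertian_def laplacian_def case_prod_unfold by (intro continuous_intros) auto
    then show ?thesis
      by (rule continuous_on_eq) (auto simp: Hv)
  qed
  note cs = continuous_on_compose_pair[OF C_k_continuous[OF v1]] continuous_on_compose_pair[OF C_k_continuous[OF vt1]]
    continuous_on_compose_pair[OF C_k_continuous[OF vx1]] continuous_on_compose_pair[OF C_1_continuous_grad[OF v1]]
    continuous_on_compose_pair[OF C_1_continuous_grad[OF vx1]] continuous_on_compose_pair[OF C_1_continuous_dx[OF vx1]]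
    continuous_on_compose_pair[OF cH]
  have ck: "continuous_on ({0..T} \<times> half_sphere \<alpha>) (\<lambda>(s, p). k s p)"
    unfolding k_def case_prod_unfold by (intro continuous_intros cs) auto
  have cm: "continuous_on ({0..T} \<times> half_sphere \<alpha>) (\<lambda>(s, p). m s p)"
    unfolding m_def case_prod_unfold by (intro continuous_intros cs) auto
  have cj: "continuous_on ({0..T} \<times> half_sphere \<alpha>) (\<lambda>(s, p). j s p)"
    unfolding j_def case_prod_unfold by (intro continuous_intros cs) auto
  have slice: "continuous_on (half_sphere \<alpha>) (F s)" if "continuous_on ({0..T} \<times> half_sphere \<alpha>) (\<lambda>(s, p). F s p)" "s \<in> {0..T}"
    for F :: "real \<Rightarrow> real \<times> real \<Rightarrow> real" and s
    using continuous_on_compose2[OF that(1) continuous_on_Pair[OF continuous_on_const[of "half_sphere \<alpha>" s] continuous_on_id]] that(2)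
    by (simp add: image_subset_iff)
  \<comment> \<open>As s grows the point moves with velocity sin phi times \<open>er\<close>. The
    mixed second derivatives cancel by symmetry, \<open>dt (dt v)\<close> is replaced through the
    equation, and what is left beside the source is the Laplace-Beltrami term
    \<open>m\<close>.\<close>
  have Dk: "((\<lambda>s. k s p) has_real_derivative (j s p + m s p)) (at s within {0..T})" if s: "s \<in> {0..T}" for s p
  proof -
    obtain \<phi> \<theta> where p: "p = (\<phi>, \<theta>)" by (cases p)
    have Dy: "((\<lambda>s. ?y s \<phi> \<theta>) has_vector_derivative sin \<phi> *\<^sub>R er \<theta>) (at s within {0..T})"
      by (auto intro!: derivative_eq_intros simp: algebra_simps)
    have D: "((\<lambda>s. f s (?y s \<phi> \<theta>)) has_real_derivative (dt f s (?y s \<phi> \<theta>) + grad_x f s (?y s \<phi> \<theta>) \<bullet> (sin \<phi> *\<^sub>R er \<theta>))) (at s within {0..T})"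
      if "C_k (Suc 0) f" for f
      by (rule C_1_along_curve[OF that s _ Dy]) simp
    have mixed: "dt (dx i v) s (?y s \<phi> \<theta>) = dx i (dt v) s (?y s \<phi> \<theta>)" for i
      using C_2_mixed_partials[OF v2'] s by simp
    have Hs: "H s (?y s \<phi> \<theta>) = dt (dt v) s (?y s \<phi> \<theta>) - (dx 1 (dx 1 v) s (?y s \<phi> \<theta>) + dx 2 (dx 2 v) s (?y s \<phi> \<theta>))"
      using Hv[of s] s by (simp add: dalembertian_def laplacian_def UNIV_2)
    show ?thesis
      unfolding p k_def case_prod_conv
      by (rule derivative_eq_intros D v1 vt1 vx1 refl)+
         (simp only: j_def m_def case_prod_conv mixed Hs,
          simp add: inner_real2 grad_x_def algebra_simps power2_eq_square)
  qed
  have m0: "integral (half_sphere \<alpha>) (m s) = 0" if s: "s \<in> {0..T}" for s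
  proof -
    have "((\<lambda>y. grad_x v s y $ i) has_derivative (\<lambda>h. grad_x (dx i v) s y \<bullet> h)) (at y)" for i y
      using C_1_has_derivative_space[OF vx1, of s i y] s by (simp add: grad_x_def)
    moreover have "continuous_on UNIV (grad_x (dx i v) s)" for i
      using continuous_on_compose_pair[OF C_1_continuous_grad[OF vx1], of UNIV "\<lambda>_. s" "\<lambda>y. y" i] s by simp
    ultimately show ?thesis
      using half_sphere_laplacian_identity[of "grad_x v s" "\<lambda>i. grad_x (dx i v) s" \<alpha> x "T - s"]
      by (simp add: m_def grad_x_def)
  qed
  define I where "I = (\<lambda>s. integral (half_sphere \<alpha>) (k s))"
  have DI: "(I has_real_derivative integral (half_sphere \<alpha>) (j s)) (at s within {0..T})" if s: "s \<in> {0..T}" for s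
  proof -
    have "(I has_real_derivative integral (half_sphere \<alpha>) (\<lambda>p. j s p + m s p)) (at s within {0..T})"
      unfolding I_def
    proof (rule leibniz_rule_field_derivative[OF Dk _ _ s])
      show "continuous_on ({0..T} \<times> half_sphere \<alpha>) (\<lambda>(s, p). j s p + m s p)"
        using continuous_on_add[OF cj cm] by (simp add: case_prod_unfold)
    qed (auto intro!: integrable_continuous slice[OF ck])
    moreover have "integral (half_sphere \<alpha>) (\<lambda>p. j s p + m s p) = integral (half_sphere \<alpha>) (j s)"
      using integral_add[OF integrable_continuous[OF slice[OF cj s]] integrable_continuous[OF slice[OF cm s]]] m0[OF s] by simp
    ultimately show ?thesis by simp
  qed
  have "((\<lambda>s. integral (half_sphere \<alpha>) (j s)) has_integral (I T - I 0)) {0..T}"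
    using DI T by (intro fundamental_theorem_of_calculus) (auto simp: has_real_derivative_iff_has_vector_derivative)
  moreover have "k 0 = (\<lambda>p. 0)"
  proof -
    have "dx i v 0 y = 0" for i y
      by (rule dx_unique) (simp add: v0)
    then show ?thesis by (auto simp: k_def v0)
  qed
  then have "I 0 = 0" by (simp add: I_def)
  moreover have "I T = 2 * pi * v T x"
    using integral_sin_half_sphere[of \<alpha> "v T x"] by (simp add: I_def k_def)
  ultimately show ?thesis by (simp add: integral_unique j_def)
qed

text \<open>The iterated integral is one integral over a three-dimensional box, so a single Leibniz
  rule differentiates it. \<open>U\<close> will be the whole line for a spatial variable and a
  right-sided interval for time.\<close>

lemma leibniz_time_half_sphere:
  fixes f :: "real \<Rightarrow> real \<Rightarrow> real \<times> real \<Rightarrow> real"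
  assumes D: "\<And>r s p. r \<in> U \<Longrightarrow> s \<in> {0..T} \<Longrightarrow> p \<in> half_sphere \<alpha> \<Longrightarrow>
      ((\<lambda>r. f r s p) has_real_derivative f' r s p) (at r within U)"
    and cf: "\<And>r. r \<in> U \<Longrightarrow> continuous_on ({0..T} \<times> half_sphere \<alpha>) (\<lambda>(s, p). f r s p)"
    and cf': "continuous_on (U \<times> ({0..T} \<times> half_sphere \<alpha>)) (\<lambda>(r, s, p). f' r s p)"
    and U: "r0 \<in> U" "convex U"
  shows "((\<lambda>r. integral {0..T} (\<lambda>s. integral (half_sphere \<alpha>) (f r s))) has_real_derivative
      integral {0..T} (\<lambda>s. integral (half_sphere \<alpha>) (f' r0 s))) (at r0 within U)"
proof -
  have box: "cbox (0, 0, \<alpha> - pi) (T, pi / 2, \<alpha> + pi) = {0..T} \<times> half_sphere \<alpha>"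
    by (simp add: cbox_Pair_eq)
  have triple: "integral (cbox (0, 0, \<alpha> - pi) (T, pi / 2, \<alpha> + pi)) (\<lambda>(s, p). g s p)
      = integral {0..T} (\<lambda>s. integral (half_sphere \<alpha>) (g s))"
    if "continuous_on ({0..T} \<times> half_sphere \<alpha>) (\<lambda>(s, p). g s p)" for g :: "real \<Rightarrow> real \<times> real \<Rightarrow> real"
    using integral_prod_continuous[of 0 "(0, \<alpha> - pi)" T "(pi / 2, \<alpha> + pi)" "\<lambda>(s, p). g s p"] that
    by (simp add: box)
  have cf0: "continuous_on ({0..T} \<times> half_sphere \<alpha>) (\<lambda>(s, p). f' r0 s p)"
    using continuous_on_compose2[OF cf' continuous_on_Pair[OF continuous_on_const[of "{0..T} \<times> half_sphere \<alpha>" r0] continuous_on_id]] U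
    by (simp add: image_subset_iff case_prod_unfold)
  have "((\<lambda>r. integral (cbox (0, 0, \<alpha> - pi) (T, pi / 2, \<alpha> + pi)) (\<lambda>(s, p). f r s p)) has_real_derivative
      integral (cbox (0, 0, \<alpha> - pi) (T, pi / 2, \<alpha> + pi)) (\<lambda>(s, p). f' r0 s p)) (at r0 within U)"
  proof (rule leibniz_rule_field_derivative)
    show "((\<lambda>r. case q of (s, p) \<Rightarrow> f r s p) has_real_derivative (case q of (s, p) \<Rightarrow> f' r s p)) (at r within U)"
      if "r \<in> U" "q \<in> cbox (0, 0, \<alpha> - pi) (T, pi / 2, \<alpha> + pi)" for r q
      using D[OF that(1), of "fst q" "snd q"] that(2) unfolding box by auto
    show "(\<lambda>(s, p). f r s p) integrable_on cbox (0, 0, \<alpha> - pi) (T, pi / 2, \<alpha> + pi)" if "r \<in> U" for r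
      by (rule integrable_continuous) (use cf[OF that] in \<open>simp add: box\<close>)
    show "continuous_on (U \<times> cbox (0, 0, \<alpha> - pi) (T, pi / 2, \<alpha> + pi)) (\<lambda>(r, s, p). f' r s p)"
      using cf' by (simp add: box)
  qed (use U in auto)
  then show ?thesis
    unfolding triple[OF cf0]
    by (rule has_field_derivative_transform_within[where d=1]) (use U triple[OF cf] in auto)
qed

text \<open>In the angles of the hemisphere x occurs only in the argument of H, so the derivative
  falls on H alone.\<close>

lemma wave_dx_representation:
  assumes v: "solves_zero_cauchy H v" and H: "C_k (Suc k) H" and T: "T \<ge> 0"
  shows "2 * pi * dx i v T x = integral {0..T} (\<lambda>s. integral (half_sphere \<alpha>)
           (\<lambda>(\<phi>, \<theta>). (T - s) * (sin \<phi> * dx i H s (sphere_point x (T - s) \<phi> \<theta>))))"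
proof -
  note cs = continuous_on_compose_pair[OF C_k_continuous[OF H]] continuous_on_compose_pair[OF C_1_continuous_dx[OF H]]
  let ?x = "\<lambda>h. x + h *\<^sub>R axis i 1"
  have "((\<lambda>h. integral {0..T} (\<lambda>s. integral (half_sphere \<alpha>)
           (\<lambda>(\<phi>, \<theta>). (T - s) * (sin \<phi> * H s (sphere_point (?x h) (T - s) \<phi> \<theta>))))) has_real_derivative
       integral {0..T} (\<lambda>s. integral (half_sphere \<alpha>)
           (\<lambda>(\<phi>, \<theta>). (T - s) * (sin \<phi> * dx i H s (sphere_point (?x 0) (T - s) \<phi> \<theta>))))) (at 0 within UNIV)"
  proof (rule leibniz_time_half_sphere)
    fix h s :: real and p :: "real \<times> real" assume s: "s \<in> {0..T}"
    obtain \<phi> \<theta> where p: "p = (\<phi>, \<theta>)" by (cases p)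
    have "((\<lambda>k. H s (sphere_point (?x h) (T - s) \<phi> \<theta> + k *\<^sub>R axis i 1)) has_real_derivative
        dx i H s (sphere_point (?x h) (T - s) \<phi> \<theta>)) (at 0)"
      using C_1_grad[OF H] s by auto
    then have "((\<lambda>h. H s (sphere_point (?x h) (T - s) \<phi> \<theta>)) has_real_derivative
        dx i H s (sphere_point (?x h) (T - s) \<phi> \<theta>)) (at h)"
      using DERIV_shift[of "\<lambda>h. H s (sphere_point (?x h) (T - s) \<phi> \<theta>)" _ 0 h] by (simp add: algebra_simps)
    then show "((\<lambda>h. (\<lambda>(\<phi>, \<theta>). (T - s) * (sin \<phi> * H s (sphere_point (?x h) (T - s) \<phi> \<theta>))) p) has_real_derivative
        (\<lambda>(\<phi>, \<theta>). (T - s) * (sin \<phi> * dx i H s (sphere_point (?x h) (T - s) \<phi> \<theta>))) p) (at h)"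
      unfolding p case_prod_conv by (intro DERIV_cmult)
  next
    fix h
    show "continuous_on ({0..T} \<times> half_sphere \<alpha>)
        (\<lambda>(s, p). (\<lambda>(\<phi>, \<theta>). (T - s) * (sin \<phi> * H s (sphere_point (?x h) (T - s) \<phi> \<theta>))) p)"
      unfolding case_prod_unfold by (intro continuous_intros cs) auto
  next
    show "continuous_on (UNIV \<times> {0..T} \<times> half_sphere \<alpha>)
        (\<lambda>(h, s, p). (\<lambda>(\<phi>, \<theta>). (T - s) * (sin \<phi> * dx i H s (sphere_point (?x h) (T - s) \<phi> \<theta>))) p)"
      unfolding case_prod_unfold by (intro continuous_intros cs) auto
  qed auto
  then have "((\<lambda>h. 2 * pi * v T (?x h)) has_real_derivative
       integral {0..T} (\<lambda>s. integral (half_sphere \<alpha>)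
           (\<lambda>(\<phi>, \<theta>). (T - s) * (sin \<phi> * dx i H s (sphere_point x (T - s) \<phi> \<theta>))))) (at 0)"
    unfolding wave_representation[OF v T, of _ \<alpha>, symmetric] by simp
  from DERIV_cdivide[OF this, of "2 * pi"] have "((\<lambda>h. v T (?x h)) has_real_derivative
       integral {0..T} (\<lambda>s. integral (half_sphere \<alpha>)
           (\<lambda>(\<phi>, \<theta>). (T - s) * (sin \<phi> * dx i H s (sphere_point x (T - s) \<phi> \<theta>)))) / (2 * pi)) (at 0)"
    by simp
  from dx_unique[of v, OF this] show ?thesis by simp
qed

text \<open>T occurs in the integrand and as the upper limit. The part over [T, r] is O((r - T)^2),
  because the kernel carries the factor r - s, so the moving limit contributes nothing to the
  derivative.\<close>

lemma wave_dt_representation: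
  assumes v: "solves_zero_cauchy H v" and H: "C_k (Suc k) H" and T: "T \<ge> 0"
  shows "2 * pi * dt v T x = integral {0..T} (\<lambda>s. integral (half_sphere \<alpha>)
           (\<lambda>(\<phi>, \<theta>). sin \<phi> * (H s (sphere_point x (T - s) \<phi> \<theta>)
              - (T - s) * sin \<phi> * (grad_x H s (sphere_point x (T - s) \<phi> \<theta>) \<bullet> er \<theta>))))"
    (is "_ = ?D")
proof -
  note cs = continuous_on_compose_pair[OF C_k_continuous[OF H]] continuous_on_compose_pair[OF C_1_continuous_grad[OF H]]
  \<comment> \<open>Right-sided, so that T = 0 is included; the right derivative already determines
    \<open>dt v T x\<close>.\<close>
  define U where "U = {T..T + 1}"
  define j where "j = (\<lambda>r s (\<phi>, \<theta>). (r - s) * (sin \<phi> * H s (sphere_point x (r - s) \<phi> \<theta>)))"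
  define J where "J = (\<lambda>r s. integral (half_sphere \<alpha>) (j r s))"
  define P where "P = (\<lambda>q. integral (half_sphere \<alpha>) (\<lambda>(\<phi>, \<theta>). sin \<phi> * H (snd q) (sphere_point x (fst q - snd q) \<phi> \<theta>)))"
  have DL: "((\<lambda>r. integral {0..T} (\<lambda>s. integral (half_sphere \<alpha>) (j r s))) has_real_derivative ?D) (at T within U)"
  proof (rule leibniz_time_half_sphere)
    fix r s :: real and p :: "real \<times> real" assume s: "s \<in> {0..T}"
    obtain \<phi> \<theta> where p: "p = (\<phi>, \<theta>)" by (cases p)
    have "((\<lambda>r. sphere_point x (r - s) \<phi> \<theta>) has_vector_derivative (- sin \<phi>) *\<^sub>R er \<theta>) (at r within U)"
      by (auto intro!: derivative_eq_intros simp: algebra_simps)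
    then have D: "((\<lambda>r. H s (sphere_point x (r - s) \<phi> \<theta>)) has_real_derivative
        (grad_x H s (sphere_point x (r - s) \<phi> \<theta>) \<bullet> ((- sin \<phi>) *\<^sub>R er \<theta>))) (at r within U)"
      by (rule gradient_along_curve[rotated]) (use s C_1_has_derivative_space[OF H] in auto)
    show "((\<lambda>r. j r s p) has_real_derivative
        (\<lambda>(\<phi>, \<theta>). sin \<phi> * (H s (sphere_point x (r - s) \<phi> \<theta>)
              - (r - s) * sin \<phi> * (grad_x H s (sphere_point x (r - s) \<phi> \<theta>) \<bullet> er \<theta>))) p) (at r within U)"
      unfolding p j_def case_prod_conv
      by (rule derivative_eq_intros D refl)+ (simp add: algebra_simps)
  next
    fix r
    show "continuous_on ({0..T} \<times> half_sphere \<alpha>) (\<lambda>(s, p). j r s p)"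
      unfolding j_def case_prod_unfold by (intro continuous_intros cs) auto
  next
    show "continuous_on (U \<times> {0..T} \<times> half_sphere \<alpha>)
        (\<lambda>(r, s, p). (\<lambda>(\<phi>, \<theta>). sin \<phi> * (H s (sphere_point x (r - s) \<phi> \<theta>)
              - (r - s) * sin \<phi> * (grad_x H s (sphere_point x (r - s) \<phi> \<theta>) \<bullet> er \<theta>))) p)"
      unfolding case_prod_unfold by (intro continuous_intros cs) auto
  qed (auto simp: U_def)
  have JP: "J r s = (r - s) * P (r, s)" for r s
    by (simp add: J_def j_def P_def case_prod_unfold)
  have cP: "continuous_on (UNIV \<times> {0..}) P"
    unfolding P_def by (rule integral_continuous_on_param)
      (auto simp: case_prod_unfold intro!: continuous_intros cs)
  have cJ: "continuous_on {a..b} (J r)" if "a \<ge> 0" for a b r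
    unfolding JP using that
    by (intro continuous_intros continuous_on_compose2[OF cP]) auto
  have "compact (P ` (U \<times> U))"
    by (rule compact_continuous_image[OF continuous_on_subset[OF cP]])
       (use T in \<open>auto simp: U_def intro!: compact_Times\<close>)
  then obtain C where C: "\<And>q. q \<in> U \<times> U \<Longrightarrow> \<bar>P q\<bar> \<le> C"
    by (metis bounded_real compact_imp_bounded imageI)
  have "C \<ge> 0" using C[of "(T, T)"] by (auto simp: U_def)
  define Rm where "Rm = (\<lambda>r. integral {T..r} (J r))"
  have Rb: "\<bar>Rm r\<bar> \<le> C * (r - T)\<^sup>2" if r: "r \<in> U" for r
  proof -
    have "norm (integral {T..r} (J r)) \<le> (C * (r - T)) * (r - T)"
    proof (rule integral_bound)
      show "norm (J r s) \<le> C * (r - T)" if "s \<in> {T..r}" for s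
      proof -
        have "\<bar>r - s\<bar> * \<bar>P (r, s)\<bar> \<le> (r - T) * C"
          by (rule mult_mono) (use that r C[of "(r, s)"] in \<open>auto simp: U_def\<close>)
        then show ?thesis by (simp add: JP abs_mult mult.commute)
      qed
    qed (use r T cJ in \<open>auto simp: U_def\<close>)
    then show ?thesis by (simp add: Rm_def power2_eq_square mult.assoc)
  qed
  have DR: "(Rm has_real_derivative 0) (at T within U)"
  proof -
    have "((\<lambda>r. (Rm r - Rm T) / (r - T)) \<longlongrightarrow> 0) (at T within U)"
    proof (rule Lim_null_comparison)
      show "\<forall>\<^sub>F r in at T within U. norm ((Rm r - Rm T) / (r - T)) \<le> C * (r - T)"
        unfolding eventually_at_filter
      proof (intro always_eventually allI impI)
        fix r assume r: "r \<noteq> T" "r \<in> U"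
        then have "r > T" by (simp add: U_def)
        have "Rm T = 0" by (simp add: Rm_def)
        then show "norm ((Rm r - Rm T) / (r - T)) \<le> C * (r - T)"
          using Rb[OF r(2)] \<open>r > T\<close> by (simp add: abs_divide divide_simps power2_eq_square mult.assoc)
      qed
      show "((\<lambda>r. C * (r - T)) \<longlongrightarrow> 0) (at T within U)"
        by (auto intro!: tendsto_eq_intros)
    qed
    then show ?thesis by (simp add: has_field_derivative_iff)
  qed
  have eq: "integral {0..T} (\<lambda>s. integral (half_sphere \<alpha>) (j r s)) + Rm r = 2 * pi * v r x" if "r \<in> U" for r
  proof -
    have "integral {0..T} (J r) + integral {T..r} (J r) = integral {0..r} (J r)"
      by (rule Henstock_Kurzweil_Integration.integral_combine) (use T that cJ in \<open>auto simp: U_def intro: integrable_continuous_real\<close>)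
    then show ?thesis
      using wave_representation[OF v, of r x \<alpha>] that T by (simp add: U_def Rm_def J_def j_def)
  qed
  have "((\<lambda>r. 2 * pi * v r x) has_real_derivative ?D) (at T within U)"
    by (rule has_field_derivative_transform_within[OF DERIV_add[OF DL DR, simplified], of 1])
       (use eq in \<open>auto simp: U_def\<close>)
  moreover have "((\<lambda>r. 2 * pi * v r x) has_real_derivative 2 * pi * dt v T x) (at T within U)"
  proof -
    have "C_k (Suc 1) v" using v by (simp add: solves_zero_cauchy_def numeral_2_eq_2)
    then have "((\<lambda>r. v r x) has_vector_derivative dt v T x) (at T within {0..})"
      using T by (intro dt_has_derivative) auto
    then have "((\<lambda>r. v r x) has_vector_derivative dt v T x) (at T within U)"
      by (rule has_vector_derivative_within_subset) (use T in \<open>auto simp: U_def\<close>)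
    then show ?thesis
      by (intro DERIV_cmult) (simp add: has_real_derivative_iff_has_vector_derivative)
  qed
  moreover have "T islimpt U"
    by (rule connected_imp_perfect) (auto simp: U_def atLeastAtMost_singleton_iff)
  ultimately show ?thesis
    by (intro vector_derivative_unique_within[of T U "\<lambda>r. 2 * pi * v r x"])
       (auto simp: trivial_limit_within has_real_derivative_iff_has_vector_derivative)
qed

subsection \<open>Decay of the kernels\<close>

lemma jordan_sin_ge:
  fixes u :: real
  assumes "0 \<le> u" "u \<le> pi / 2"
  shows "2 * u / pi \<le> sin u"
proof -
  have "concave_on {0..pi/2} (sin :: real \<Rightarrow> real)"
    by (rule f''_le0_imp_concave[where f'=cos and f''="\<lambda>x. - sin x"])
       (auto intro!: derivative_eq_intros sin_ge_zero)
  then have "(1 - t) * sin 0 + t * sin (pi/2) \<le> sin ((1 - t) * 0 + t * (pi/2))" if "0 \<le> t" "t \<le> 1" for t :: real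
    using that concave_onD[of "{0..pi/2}" sin t 0 "pi/2"] by simp
  from this[of "2 * u / pi"] show ?thesis using assms by (simp add: field_simps)
qed

lemma norm_diff_er:
  "(norm (r *\<^sub>R er \<alpha> - \<rho> *\<^sub>R er \<theta>))\<^sup>2 = (r - \<rho>)\<^sup>2 + 4 * r * \<rho> * (sin ((\<theta> - \<alpha>) / 2))\<^sup>2"
proof -
  have "cos (\<theta> - \<alpha>) = 1 - 2 * (sin ((\<theta> - \<alpha>) / 2))\<^sup>2"
    using cos_double_sin[of "(\<theta> - \<alpha>) / 2"] by (simp only: times_divide_eq_right nonzero_mult_div_cancel_left[OF zero_neq_numeral[symmetric]])
  moreover have "(norm (r *\<^sub>R er \<alpha> - \<rho> *\<^sub>R er \<theta>))\<^sup>2 = r\<^sup>2 + \<rho>\<^sup>2 - 2 * r * \<rho> * cos (\<theta> - \<alpha>)"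
  proof -
    have "(cos \<theta>)\<^sup>2 = 1 - (sin \<theta>)\<^sup>2" "(cos \<alpha>)\<^sup>2 = 1 - (sin \<alpha>)\<^sup>2" by (simp_all add: cos_squared_eq)
    then show ?thesis unfolding power2_norm_eq_inner cos_diff by (simp add: inner_real2) algebra
  qed
  ultimately show ?thesis by algebra
qed

text \<open>By \<open>norm_diff_er\<close> the squared distance is a radial plus an angular part,
  each below R^2. If r >= 2 R, the radial part forces \<rho> >= r/2 and the angular part gives r sin
  (|theta - \<alpha>| / 2) <= R, which \<open>jordan_sin_ge\<close> converts into an angle. If r < 2
  R, the claimed bound is at least pi.\<close>

lemma ray_meets_disc:
  assumes R: "R \<ge> 1" and r: "r \<ge> 0" and \<rho>: "\<rho> \<ge> 0" and \<theta>: "\<bar>\<theta> - \<alpha>\<bar> \<le> pi"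
    and n: "norm (r *\<^sub>R er \<alpha> - \<rho> *\<^sub>R er \<theta>) < R"
  shows "\<bar>r - \<rho>\<bar> < R" "\<bar>\<theta> - \<alpha>\<bar> \<le> 2 * pi * (R + 1) / (1 + r)"
proof -
  have sq: "(r - \<rho>)\<^sup>2 + 4 * r * \<rho> * (sin ((\<theta> - \<alpha>) / 2))\<^sup>2 < R\<^sup>2"
    using power_strict_mono[OF n, of 2] by (simp add: norm_diff_er)
  have "0 \<le> 4 * r * \<rho> * (sin ((\<theta> - \<alpha>) / 2))\<^sup>2" using r \<rho> by simp
  then have "(r - \<rho>)\<^sup>2 < R\<^sup>2" using sq by linarith
  then show *: "\<bar>r - \<rho>\<bar> < R" using R by (metis abs_of_nonneg order_trans power2_abs power2_less_imp_less zero_le_one)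
  show "\<bar>\<theta> - \<alpha>\<bar> \<le> 2 * pi * (R + 1) / (1 + r)"
  proof (cases "r \<ge> 2 * R")
    case False
    then have "1 + r \<le> 2 * (R + 1)" by simp
    then have "pi * (1 + r) \<le> pi * (2 * (R + 1))" by (intro mult_left_mono) auto
    then have "pi \<le> 2 * pi * (R + 1) / (1 + r)" using r by (simp add: field_simps)
    then show ?thesis using \<theta> by linarith
  next
    case True
    define u where "u = \<bar>\<theta> - \<alpha>\<bar> / 2"
    have u: "0 \<le> u" "u \<le> pi / 2" using \<theta> by (auto simp: u_def)
    have s: "(sin ((\<theta> - \<alpha>) / 2))\<^sup>2 = (sin u)\<^sup>2" by (auto simp: u_def abs_if) (metis minus_diff_eq minus_divide_left power2_minus sin_minus)
    have "\<rho> \<ge> r / 2" using * True by linarith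
    then have "4 * r * \<rho> \<ge> 2 * r\<^sup>2" using r mult_left_mono[of "r/2" \<rho> "4 * r"] by (simp add: power2_eq_square)
    then have "2 * r\<^sup>2 * (sin u)\<^sup>2 \<le> 4 * r * \<rho> * (sin u)\<^sup>2" by (intro mult_right_mono) auto
    also have "\<dots> \<le> R\<^sup>2" using sq unfolding s by (smt (verit) zero_le_power2)
    finally have "(r * sin u)\<^sup>2 \<le> R\<^sup>2" using mult_nonneg_nonneg[OF zero_le_power2[of r] zero_le_power2[of "sin u"]]
      unfolding power_mult_distrib by linarith
    then have "r * sin u \<le> R" by (rule power2_le_imp_le) (use R in simp)
    moreover have "r * (2 * u / pi) \<le> r * sin u" using jordan_sin_ge[OF u] r by (rule mult_left_mono)
    ultimately have "r * (2 * u / pi) \<le> R" by linarith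
    then have "r * (2 * u) \<le> pi * R" by (simp add: field_simps)
    then have 1: "r * \<bar>\<theta> - \<alpha>\<bar> \<le> pi * R" by (simp add: u_def)
    have 2: "pi * R * (1 + r) \<le> r * (2 * pi * (R + 1))"
    proof -
      have "R \<le> r * R" using True R mult_right_mono[of 1 r R] by simp
      then have "R * (1 + r) \<le> r * (2 * (R + 1))" using r by (simp add: algebra_simps)
      then show ?thesis using mult_left_mono[of "R * (1 + r)" "r * (2 * (R + 1))" pi] by (simp add: algebra_simps)
    qed
    have "r > 0" using True R by linarith
    have "r * \<bar>\<theta> - \<alpha>\<bar> * (1 + r) \<le> pi * R * (1 + r)" using 1 r by (intro mult_right_mono) auto
    also note 2
    finally have "r * (\<bar>\<theta> - \<alpha>\<bar> * (1 + r)) \<le> r * (2 * pi * (R + 1))" by (simp add: mult.assoc)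
    then have "\<bar>\<theta> - \<alpha>\<bar> * (1 + r) \<le> 2 * pi * (R + 1)" using \<open>r > 0\<close> by simp
    then show ?thesis using r by (simp add: pos_le_divide_eq)
  qed
qed

lemma integral_abs_le_subinterval:
  fixes w F F' :: "real \<Rightarrow> real"
  assumes w: "w integrable_on {a..b}" and cd: "c \<le> d" "{c..d} \<subseteq> {a..b}"
    and z: "\<And>x. x \<in> {a..b} \<Longrightarrow> x \<notin> {c..d} \<Longrightarrow> w x = 0"
    and le: "\<And>x. x \<in> {c..d} \<Longrightarrow> \<bar>w x\<bar> \<le> F' x"
    and F: "\<And>x. x \<in> {c..d} \<Longrightarrow> (F has_real_derivative F' x) (at x within {c..d})"
  shows "\<bar>integral {a..b} w\<bar> \<le> F d - F c"
proof -
  have "(F' has_integral (F d - F c)) {c..d}"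
    using F cd(1) by (intro fundamental_theorem_of_calculus) (auto simp: has_real_derivative_iff_has_vector_derivative)
  then have I: "((\<lambda>x. if x \<in> {c..d} then F' x else 0) has_integral (F d - F c)) {a..b}"
    using has_integral_restrict[OF cd(2)] by blast
  have "norm (integral {a..b} w) \<le> integral {a..b} (\<lambda>x. if x \<in> {c..d} then F' x else 0)"
    by (rule integral_norm_bound_integral[OF w]) (use I z le in \<open>auto simp: has_integral_integrable\<close>)
  then show ?thesis using integral_unique[OF I] by simp
qed

text \<open>The directions from x that meet the disc fill an angle of at most 2 \<delta>, and
  projected radii below r - R miss it, which leaves phi >= \<open>\<phi>1\<close>. Hence the product
  of 2 \<delta> and the increment of an antiderivative of the majorant. For \<tau> = 0 the equation
  for \<open>\<phi>1\<close> does not determine it; the clause for r <= R then puts it at 0.\<close>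

lemma half_sphere_integral_bound:
  fixes W :: "real \<Rightarrow> real \<Rightarrow> real"
  assumes W: "continuous_on (cbox (0, \<alpha> - pi) (\<phi>m, \<alpha> + pi)) (\<lambda>(\<phi>, \<theta>). W \<phi> \<theta>)"
    and supp: "\<And>\<phi> \<theta>. R \<le> norm (sphere_point (r *\<^sub>R er \<alpha>) \<tau> \<phi> \<theta>) \<Longrightarrow> W \<phi> \<theta> = 0"
    and R: "R \<ge> 1" and r: "r \<ge> 0" and \<tau>: "\<tau> \<ge> 0"
    and \<phi>1: "0 \<le> \<phi>1" "\<phi>1 \<le> \<phi>m" "\<phi>m \<le> pi / 2" "\<tau> * sin \<phi>1 = max 0 (r - R)" "r \<le> R \<Longrightarrow> \<phi>1 = 0"
    and le: "\<And>\<phi> \<theta>. \<phi> \<in> {\<phi>1..\<phi>m} \<Longrightarrow> \<bar>W \<phi> \<theta>\<bar> \<le> F' \<phi>"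
    and F: "\<And>\<phi>. \<phi> \<in> {\<phi>1..\<phi>m} \<Longrightarrow> (F has_real_derivative F' \<phi>) (at \<phi> within {\<phi>1..\<phi>m})"
  shows "\<bar>integral (cbox (0, \<alpha> - pi) (\<phi>m, \<alpha> + pi)) (\<lambda>(\<phi>, \<theta>). W \<phi> \<theta>)\<bar> \<le> 4 * pi * (R + 1) / (1 + r) * (F \<phi>m - F \<phi>1)"
proof -
  define D where "D = F \<phi>m - F \<phi>1"
  define \<delta> where "\<delta> = 2 * pi * (R + 1) / (1 + r)"
  have "\<delta> \<ge> 0" using R r by (simp add: \<delta>_def)
  have "continuous_on (cbox (\<alpha> - pi, 0) (\<alpha> + pi, \<phi>m)) (\<lambda>(\<theta>, \<phi>). W \<phi> \<theta>)"
    by (rule swap_continuous[OF W])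
  then have cI: "continuous_on {\<alpha> - pi..\<alpha> + pi} (\<lambda>\<theta>. integral {0..\<phi>m} (\<lambda>\<phi>. W \<phi> \<theta>))"
    using integral_continuous_on_param[of "{\<alpha> - pi..\<alpha> + pi}" 0 \<phi>m "\<lambda>\<theta> \<phi>. W \<phi> \<theta>"] by (simp add: cbox_Pair_eq)
  have cW: "continuous_on {0..\<phi>m} (\<lambda>\<phi>. W \<phi> \<theta>)" if "\<theta> \<in> {\<alpha> - pi..\<alpha> + pi}" for \<theta>
    using continuous_on_compose2[OF W continuous_on_Pair[OF continuous_on_id continuous_on_const[of "{0..\<phi>m}" \<theta>]]] that
    by (simp add: cbox_Pair_eq image_subset_iff)
  have pt: "sphere_point (r *\<^sub>R er \<alpha>) \<tau> \<phi> \<theta> = r *\<^sub>R er \<alpha> - (\<tau> * sin \<phi>) *\<^sub>R er \<theta>" for \<phi> \<theta> by simp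
  have z: "W \<phi> \<theta> = 0" if "\<phi> \<in> {0..\<phi>m}" "\<theta> \<in> {\<alpha> - pi..\<alpha> + pi}" "\<phi> \<notin> {\<phi>1..\<phi>m} \<or> \<bar>\<theta> - \<alpha>\<bar> > \<delta>" for \<phi> \<theta>
  proof (rule supp, rule ccontr)
    assume "\<not> R \<le> norm (sphere_point (r *\<^sub>R er \<alpha>) \<tau> \<phi> \<theta>)"
    then have n: "norm (r *\<^sub>R er \<alpha> - (\<tau> * sin \<phi>) *\<^sub>R er \<theta>) < R" by simp
    have "\<bar>\<theta> - \<alpha>\<bar> \<le> pi" using that(2) by auto
    have "0 \<le> sin \<phi>" using that(1) \<phi>1 by (intro sin_ge_zero) auto
    then have "0 \<le> \<tau> * sin \<phi>" using \<tau> by simp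
    note ray = ray_meets_disc[OF R r this \<open>\<bar>\<theta> - \<alpha>\<bar> \<le> pi\<close> n]
    then have "\<phi> < \<phi>1" using that(1,3) by (auto simp: \<delta>_def)
    then have "sin \<phi> \<le> sin \<phi>1" using that(1) \<phi>1 by (intro sin_monotone_2pi_le) auto
    then have "\<tau> * sin \<phi> \<le> max 0 (r - R)" using \<phi>1(4) \<tau> by (metis mult_left_mono)
    moreover have "r - R < \<tau> * sin \<phi>" using ray(1) by linarith
    ultimately have "r \<le> R" by linarith
    then show False using \<phi>1(5) \<open>\<phi> < \<phi>1\<close> that(1) by simp
  qed
  have inner: "\<bar>integral {0..\<phi>m} (\<lambda>\<phi>. W \<phi> \<theta>)\<bar> \<le> D" if "\<theta> \<in> {\<alpha> - pi..\<alpha> + pi}" for \<theta>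
    unfolding D_def
    by (rule integral_abs_le_subinterval[where F=F and F'=F'])
       (use that cW z le F \<phi>1 in \<open>auto intro!: integrable_continuous_real\<close>)
  have "D \<ge> 0" using inner[of \<alpha>] by auto
  \<comment> \<open>The cap at pi keeps the sector inside the range of theta.\<close>
  have "\<bar>integral {\<alpha> - pi..\<alpha> + pi} (\<lambda>\<theta>. integral {0..\<phi>m} (\<lambda>\<phi>. W \<phi> \<theta>))\<bar>
      \<le> D * (\<alpha> + min \<delta> pi) - D * (\<alpha> - min \<delta> pi)"
  proof (rule integral_abs_le_subinterval[where F="\<lambda>x. D * x" and F'="\<lambda>_. D"])
    show "(\<lambda>\<theta>. integral {0..\<phi>m} (\<lambda>\<phi>. W \<phi> \<theta>)) integrable_on {\<alpha> - pi..\<alpha> + pi}"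
      by (rule integrable_continuous_real[OF cI])
    show "integral {0..\<phi>m} (\<lambda>\<phi>. W \<phi> \<theta>) = 0"
      if "\<theta> \<in> {\<alpha> - pi..\<alpha> + pi}" "\<theta> \<notin> {\<alpha> - min \<delta> pi..\<alpha> + min \<delta> pi}" for \<theta>
    proof -
      have "\<bar>\<theta> - \<alpha>\<bar> > \<delta>" using that by (auto simp: min_def split: if_splits)
      then have "integral {0..\<phi>m} (\<lambda>\<phi>. W \<phi> \<theta>) = integral {0..\<phi>m} (\<lambda>\<phi>. 0)"
        by (intro integral_cong z) (use that in auto)
      then show ?thesis by simp
    qed
    show "\<bar>integral {0..\<phi>m} (\<lambda>\<phi>. W \<phi> \<theta>)\<bar> \<le> D" if "\<theta> \<in> {\<alpha> - min \<delta> pi..\<alpha> + min \<delta> pi}" for \<theta>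
      by (rule inner) (use that in auto)
  qed (use \<open>\<delta> \<ge> 0\<close> pi_ge_zero in \<open>auto intro!: derivative_eq_intros simp: min_def\<close>)
  also have "\<dots> \<le> 2 * \<delta> * D"
    using mult_right_mono[of "min \<delta> pi" \<delta> D] \<open>D \<ge> 0\<close> by (simp add: algebra_simps)
  finally have "\<bar>integral {\<alpha> - pi..\<alpha> + pi} (\<lambda>\<theta>. integral {0..\<phi>m} (\<lambda>\<phi>. W \<phi> \<theta>))\<bar> \<le> 2 * \<delta> * D" .
  moreover have "integral (cbox (0, \<alpha> - pi) (\<phi>m, \<alpha> + pi)) (\<lambda>(\<phi>, \<theta>). W \<phi> \<theta>)
     = integral {\<alpha> - pi..\<alpha> + pi} (\<lambda>\<theta>. integral {0..\<phi>m} (\<lambda>\<phi>. W \<phi> \<theta>))"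
    using integral_prod_continuous[OF W] integral_swap_continuous[OF W] by simp
  ultimately show ?thesis by (simp add: \<delta>_def D_def)
qed

lemma max_diff_facts:
  fixes r R :: real
  assumes "R \<ge> 1" "r \<ge> 0"
  defines "\<rho> \<equiv> max 0 (r - R)"
  shows "0 \<le> \<rho>" "\<rho> \<le> r" "r + R - \<rho> \<le> 2 * R" "r - R \<le> \<rho>"
  using assms by (auto simp: \<rho>_def max_def)

section \<open>Kernel bounds on either side of tau = r + R + 1\<close>

definition decay :: "real \<Rightarrow> real \<Rightarrow> real" where
  "decay r \<tau> = (1 + r) powr (- 1 / 2) * (1 + \<bar>\<tau> - r\<bar>) powr (- 3 / 2)"

text \<open>One constant for both regimes: 4 pi (R + 1) is the width of the sector, (R + 2)^2 pays
  for passing to the weight 1 + |tau - r|, and the last factor dominates both 2 R + 3 (early) and 2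
  R^2 (late).\<close>

definition kernel_const :: "real \<Rightarrow> real" where
  "kernel_const R = 4 * pi * (R + 1) * (R + 2)\<^sup>2 * (2 * R\<^sup>2 + 2 * R + 3)"

lemma powr_3_2_le_square:
  assumes "(x::real) \<ge> 1"
  shows "x powr (3 / 2) \<le> x\<^sup>2"
  using powr_mono[of "3/2" 2 x] assms by simp

text \<open>The majorant integrates to m (1 + tau) cos phi1, and tau cos phi1 = sqrt (tau^2 - rho^2)
  is of order sqrt (1 + r), since tau - rho <= 2 (R + 1). With the sector width 1 / (1 + r) this
  gives the first factor of \<open>decay\<close>. Where the integral is not zero, |tau - r| <= R +
  1, so the second factor costs only a constant.\<close>

lemma near_kernel_bound:
  fixes W :: "real \<Rightarrow> real \<Rightarrow> real"
  assumes W: "continuous_on (half_sphere \<alpha>) (\<lambda>(\<phi>, \<theta>). W \<phi> \<theta>)"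
    and supp: "\<And>\<phi> \<theta>. R \<le> norm (sphere_point (r *\<^sub>R er \<alpha>) \<tau> \<phi> \<theta>) \<Longrightarrow> W \<phi> \<theta> = 0"
    and R: "R \<ge> 1" and r: "r \<ge> 0" and \<tau>: "0 \<le> \<tau>" "\<tau> \<le> r + R + 1" and m: "m \<ge> 0"
    and le: "\<And>\<phi> \<theta>. \<phi> \<in> {0..pi/2} \<Longrightarrow> \<bar>W \<phi> \<theta>\<bar> \<le> m * (1 + \<tau>) * sin \<phi>"
  shows "\<bar>integral (half_sphere \<alpha>) (\<lambda>(\<phi>, \<theta>). W \<phi> \<theta>)\<bar> \<le> kernel_const R * m * decay r \<tau>"
proof -
  define \<rho> where "\<rho> = max 0 (r - R)"
  note \<rho> = max_diff_facts[OF R r, folded \<rho>_def]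
  show ?thesis
  proof (cases "\<rho> \<le> \<tau>")
    \<comment> \<open>Finite speed of propagation: the hemisphere does not yet reach the
      support.\<close>
    case False
    have "W \<phi> \<theta> = 0" if "\<phi> \<in> {0..pi/2}" for \<phi> \<theta>
    proof (rule supp)
      have "0 \<le> sin \<phi>" using that by (intro sin_ge_zero) auto
      then have "\<tau> * sin \<phi> \<le> \<tau>" "0 \<le> \<tau> * sin \<phi>" using mult_left_mono[OF sin_le_one[of \<phi>] \<tau>(1)] \<tau> by auto
      moreover have "r - R \<ge> \<tau>" using False \<tau>(1) by (auto simp: \<rho>_def max_def split: if_splits)
      ultimately show "R \<le> norm (sphere_point (r *\<^sub>R er \<alpha>) \<tau> \<phi> \<theta>)"
        using norm_triangle_ineq2[of "r *\<^sub>R er \<alpha>" "(\<tau> * sin \<phi>) *\<^sub>R er \<theta>"] r by simp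
    qed
    then have "integral (half_sphere \<alpha>) (\<lambda>(\<phi>, \<theta>). W \<phi> \<theta>) = integral (half_sphere \<alpha>) (\<lambda>p. 0)"
      by (intro integral_cong) (auto simp: cbox_Pair_eq)
    then show ?thesis using m R by (simp add: kernel_const_def decay_def)
  next
    case True
    \<comment> \<open>Division by zero gives 0: for \<tau> = 0 also \<rho> = 0, so \<tau> q = \<rho>
      holds in that case too.\<close>
    define q where "q = \<rho> / \<tau>"
    have q: "0 \<le> q" "q \<le> 1" using True \<rho>(1) \<tau>(1) by (auto simp: q_def divide_le_eq_1)
    have \<tau>q: "\<tau> * q = \<rho>" using True \<rho>(1) by (cases "\<tau> = 0") (auto simp: q_def)
    define \<phi>1 where "\<phi>1 = arcsin q"
    have \<phi>1: "0 \<le> \<phi>1" "\<phi>1 \<le> pi/2" "sin \<phi>1 = q" "cos \<phi>1 = sqrt (1 - q\<^sup>2)"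
      using q arcsin_nonneg[of q] arcsin_ubound[of q] by (auto simp: \<phi>1_def cos_arcsin)
    have "\<bar>integral (half_sphere \<alpha>) (\<lambda>(\<phi>, \<theta>). W \<phi> \<theta>)\<bar>
        \<le> 4 * pi * (R + 1) / (1 + r) * (m * (1 + \<tau>) * (- cos (pi/2)) - m * (1 + \<tau>) * (- cos \<phi>1))"
    proof (rule half_sphere_integral_bound[OF W supp R r \<tau>(1) \<phi>1(1,2), where F'="\<lambda>\<phi>. m * (1 + \<tau>) * sin \<phi>"])
      show "\<tau> * sin \<phi>1 = max 0 (r - R)" using \<phi>1 \<tau>q by (simp add: \<rho>_def)
      show "\<phi>1 = 0" if "r \<le> R" using that by (simp add: \<phi>1_def q_def \<rho>_def)
      show "\<bar>W \<phi> \<theta>\<bar> \<le> m * (1 + \<tau>) * sin \<phi>" if "\<phi> \<in> {\<phi>1..pi/2}" for \<phi> \<theta>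
        using le[of \<phi> \<theta>] that \<phi>1 by auto
    qed (auto intro!: derivative_eq_intros)
    then have 1: "\<bar>integral (half_sphere \<alpha>) (\<lambda>(\<phi>, \<theta>). W \<phi> \<theta>)\<bar>
        \<le> 4 * pi * (R + 1) / (1 + r) * m * ((1 + \<tau>) * cos \<phi>1)" by simp
    have 2: "(1 + \<tau>) * cos \<phi>1 \<le> (2 * R + 3) * sqrt (1 + r)"
    proof -
      have "\<tau> * cos \<phi>1 = sqrt (\<tau>\<^sup>2 * (1 - q\<^sup>2))" using \<tau> \<phi>1 by (simp add: real_sqrt_mult)
      also have "\<tau>\<^sup>2 * (1 - q\<^sup>2) = (\<tau> - \<rho>) * (\<tau> + \<rho>)" unfolding \<tau>q[symmetric] by (simp add: algebra_simps power2_eq_square)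
      also have "\<dots> \<le> (2 * (R + 1)) * (2 * (R + 1) * (1 + r))"
      proof (rule mult_mono)
        show "\<tau> - \<rho> \<le> 2 * (R + 1)" using \<tau>(2) \<rho>(3) by (simp add: algebra_simps)
        have "\<tau> + \<rho> \<le> 2 * (r + R + 1)" using \<tau>(2) \<rho>(2) R by (simp add: algebra_simps)
        also have "\<dots> \<le> 2 * (R + 1) * (1 + r)" using R r by (simp add: algebra_simps)
        finally show "\<tau> + \<rho> \<le> 2 * (R + 1) * (1 + r)" .
      qed (use \<tau> \<rho> R True in auto)
      also have "\<dots> = (2 * (R + 1))\<^sup>2 * (1 + r)" by (simp add: power2_eq_square)
      finally have "\<tau> * cos \<phi>1 \<le> 2 * (R + 1) * sqrt (1 + r)" using R by (simp add: real_sqrt_mult real_sqrt_le_iff)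
      moreover have "cos \<phi>1 \<le> sqrt (1 + r)" using r cos_le_one[of \<phi>1] by (metis le_add_same_cancel1 order_trans real_sqrt_ge_one)
      ultimately show ?thesis by (simp add: algebra_simps)
    qed
    have "4 * pi * (R + 1) / (1 + r) * m * ((1 + \<tau>) * cos \<phi>1) \<le> 4 * pi * (R + 1) / (1 + r) * m * ((2 * R + 3) * sqrt (1 + r))"
      by (rule mult_left_mono[OF 2]) (use R r m in auto)
    note order_trans[OF 1 this]
    also have "4 * pi * (R + 1) / (1 + r) * m * ((2 * R + 3) * sqrt (1 + r)) = 4 * pi * (R + 1) * (2 * R + 3) * m * (1 + r) powr (-1/2)"
    proof -
      have "(1 + r) powr (-1/2) = sqrt (1 + r) / (1 + r)"
        using r powr_diff[of "1 + r" "1/2" 1] by (simp add: powr_half_sqrt)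
      then show ?thesis by simp
    qed
    also have "\<dots> \<le> 4 * pi * (R + 1) * (2 * R + 3) * m * (1 + r) powr (-1/2) * ((R + 2)\<^sup>2 * (1 + \<bar>\<tau> - r\<bar>) powr (- 3 / 2))"
    proof -
      have "\<bar>\<tau> - r\<bar> \<le> R + 1" using \<tau> \<rho> True by auto
      then have "(1 + \<bar>\<tau> - r\<bar>) powr (3/2) \<le> (R + 2) powr (3/2)" by (intro powr_mono2) auto
      also have "\<dots> \<le> (R + 2)\<^sup>2" using R by (intro powr_3_2_le_square) auto
      finally have "1 \<le> (R + 2)\<^sup>2 * (1 + \<bar>\<tau> - r\<bar>) powr (- (3/2))" by (simp add: powr_minus divide_simps)
      then have "1 \<le> (R + 2)\<^sup>2 * (1 + \<bar>\<tau> - r\<bar>) powr (- 3 / 2)" by simp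
      from mult_left_mono[OF this, of "4 * pi * (R + 1) * (2 * R + 3) * m * (1 + r) powr (-1/2)"]
      show ?thesis using R m by simp
    qed
    also have "\<dots> = 4 * pi * (R + 1) * (R + 2)\<^sup>2 * (2 * R + 3) * (m * decay r \<tau>)"
      by (simp add: decay_def)
    also have "\<dots> \<le> kernel_const R * (m * decay r \<tau>)"
      unfolding kernel_const_def by (intro mult_right_mono mult_left_mono) (use R m in \<open>auto simp: decay_def\<close>)
    finally show ?thesis by (simp add: mult.assoc)
  qed
qed

text \<open>The majorant has the antiderivative m / cos phi, so the phi-integral is m (1 / c2 - 1 /
  c1), with c1 and c2 the cosines at the projected radii max 0 (r - R) and r + R. Bounding 1 / c2
  alone would lose the decay. The difference equals (c1^2 - c2^2) / (c1 c2 (c1 + c2)); its numerator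
  is at most 4 R (r + R) / tau^2, and c2^2 >= (tau - r - R) / tau produces the power -3/2.\<close>

lemma far_kernel_bound:
  fixes W :: "real \<Rightarrow> real \<Rightarrow> real"
  assumes W: "continuous_on (cbox (0, \<alpha> - pi) (arcsin ((r + R) / \<tau>), \<alpha> + pi)) (\<lambda>(\<phi>, \<theta>). W \<phi> \<theta>)"
    and supp: "\<And>\<phi> \<theta>. R \<le> norm (sphere_point (r *\<^sub>R er \<alpha>) \<tau> \<phi> \<theta>) \<Longrightarrow> W \<phi> \<theta> = 0"
    and R: "R \<ge> 1" and r: "r \<ge> 0" and \<tau>: "r + R + 1 < \<tau>" and m: "m \<ge> 0"
    and le: "\<And>\<phi> \<theta>. \<phi> \<in> {0..<pi/2} \<Longrightarrow> \<bar>W \<phi> \<theta>\<bar> \<le> m * sin \<phi> / (cos \<phi>)\<^sup>2"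
  shows "\<bar>integral (cbox (0, \<alpha> - pi) (arcsin ((r + R) / \<tau>), \<alpha> + pi)) (\<lambda>(\<phi>, \<theta>). W \<phi> \<theta>)\<bar> \<le> kernel_const R * m * decay r \<tau>"
proof -
  define \<rho> where "\<rho> = max 0 (r - R)"
  note \<rho> = max_diff_facts[OF R r, folded \<rho>_def]
  define q p where "q = \<rho> / \<tau>" "p = (r + R) / \<tau>"
  have "\<tau> > 0" using \<tau> r R by linarith
  have q: "0 \<le> q" "q \<le> p" "0 < p" "p < 1" using \<tau> \<rho> r R \<open>\<tau> > 0\<close> by (auto simp: q_p_def divide_right_mono)
  have \<tau>q: "\<tau> * q = \<rho>" "\<tau> * p = r + R" using \<open>\<tau> > 0\<close> by (auto simp: q_p_def)
  define \<phi>1 \<phi>2 where "\<phi>1 = arcsin q" "\<phi>2 = arcsin p"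
  define c1 c2 where "c1 = sqrt (1 - q\<^sup>2)" "c2 = sqrt (1 - p\<^sup>2)"
  have \<phi>: "0 \<le> \<phi>1" "\<phi>1 \<le> \<phi>2" "\<phi>2 < pi/2" "sin \<phi>1 = q" "cos \<phi>1 = c1" "cos \<phi>2 = c2"
    using q arcsin_nonneg[of q] arcsin_lt_bounded[of p] by (auto simp: \<phi>1_\<phi>2_def c1_c2_def cos_arcsin intro!: arcsin_le_arcsin)
  have p2: "p\<^sup>2 < 1" "q\<^sup>2 \<le> p\<^sup>2" using q by (auto simp: power_strict_mono power2_less_1_iff abs_square_less_1 intro: power_mono)
  have c: "0 < c2" "c2 \<le> c1" using p2 by (auto simp: c1_c2_def)
  have "\<bar>integral (cbox (0, \<alpha> - pi) (\<phi>2, \<alpha> + pi)) (\<lambda>(\<phi>, \<theta>). W \<phi> \<theta>)\<bar>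
      \<le> 4 * pi * (R + 1) / (1 + r) * (m / cos \<phi>2 - m / cos \<phi>1)"
  proof (rule half_sphere_integral_bound[OF _ supp R r _ \<phi>(1,2), where F'="\<lambda>\<phi>. m * sin \<phi> / (cos \<phi>)\<^sup>2"])
    show "continuous_on (cbox (0, \<alpha> - pi) (\<phi>2, \<alpha> + pi)) (\<lambda>(\<phi>, \<theta>). W \<phi> \<theta>)"
      using W by (simp add: \<phi>1_\<phi>2_def q_p_def)
    show "\<tau> * sin \<phi>1 = max 0 (r - R)" using \<phi> \<tau>q by (simp add: \<rho>_def)
    show "\<phi>1 = 0" if "r \<le> R" using that by (simp add: \<phi>1_\<phi>2_def q_p_def \<rho>_def)
    show "\<bar>W \<phi> \<theta>\<bar> \<le> m * sin \<phi> / (cos \<phi>)\<^sup>2" if "\<phi> \<in> {\<phi>1..\<phi>2}" for \<phi> \<theta>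
      using le[of \<phi> \<theta>] that \<phi> by auto
    show "((\<lambda>\<phi>. m / cos \<phi>) has_real_derivative m * sin \<phi> / (cos \<phi>)\<^sup>2) (at \<phi> within {\<phi>1..\<phi>2})" if "\<phi> \<in> {\<phi>1..\<phi>2}" for \<phi>
    proof -
      have "cos \<phi> > 0" using that \<phi> by (intro cos_gt_zero_pi) auto
      then show ?thesis by (auto intro!: derivative_eq_intros simp: power2_eq_square)
    qed
  qed (use \<open>\<tau> > 0\<close> \<phi> in auto)
  then have 1: "\<bar>integral (cbox (0, \<alpha> - pi) (\<phi>2, \<alpha> + pi)) (\<lambda>(\<phi>, \<theta>). W \<phi> \<theta>)\<bar>
      \<le> 4 * pi * (R + 1) / (1 + r) * m * (1 / c2 - 1 / c1)" using \<phi> by (simp add: right_diff_distrib)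
  have "1 / c2 - 1 / c1 \<le> 2 * R * (r + R) / (\<tau>\<^sup>2 * c2 ^ 3)"
  proof -
    have "c1\<^sup>2 - c2\<^sup>2 = p\<^sup>2 - q\<^sup>2" using p2 by (simp add: c1_c2_def)
    also have "\<dots> = (r + R - \<rho>) * (r + R + \<rho>) / \<tau>\<^sup>2"
      using \<open>\<tau> > 0\<close> by (simp add: q_p_def power2_eq_square field_simps)
    also have "\<dots> \<le> (2 * R) * (2 * (r + R)) / \<tau>\<^sup>2"
      by (intro divide_right_mono mult_mono) (use \<rho> R r in auto)
    finally have 1: "c1\<^sup>2 - c2\<^sup>2 \<le> 4 * R * (r + R) / \<tau>\<^sup>2" by (simp add: mult_ac algebra_simps)
    have "1 / c2 - 1 / c1 = (c1\<^sup>2 - c2\<^sup>2) / (c1 * c2 * (c1 + c2))"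
    proof -
      have "(c1\<^sup>2 - c2\<^sup>2) / (c1 * c2 * (c1 + c2)) = ((c1 - c2) * (c1 + c2)) / ((c1 * c2) * (c1 + c2))"
        by (simp add: power2_eq_square algebra_simps)
      also have "\<dots> = (c1 - c2) / (c1 * c2)" using c by simp
      also have "\<dots> = 1 / c2 - 1 / c1" using c by (simp add: diff_divide_distrib)
      finally show ?thesis by simp
    qed
    also have "\<dots> \<le> (c1\<^sup>2 - c2\<^sup>2) / (c2 * c2 * (c2 + c2))"
      by (intro divide_left_mono mult_mono mult_pos_pos add_mono) (use c in \<open>auto intro!: power_mono mult_pos_pos\<close>)
    also have "\<dots> = (c1\<^sup>2 - c2\<^sup>2) / (2 * c2 ^ 3)" by (simp add: power3_eq_cube)
    also have "\<dots> \<le> (4 * R * (r + R) / \<tau>\<^sup>2) / (2 * c2 ^ 3)"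
      using 1 c by (intro divide_right_mono) auto
    finally show ?thesis by (simp add: mult.assoc)
  qed
  also have "2 * R * (r + R) / (\<tau>\<^sup>2 * c2 ^ 3) \<le> 2 * R * (r + R) / (\<tau>\<^sup>2 * ((\<tau> - r - R) / \<tau>) powr (3/2))"
  proof -
    have "(\<tau> - r - R) / \<tau> = 1 - p" using \<open>\<tau> > 0\<close> by (simp add: q_p_def field_simps)
    also have "\<dots> \<le> (1 - p) * (1 + p)" using q by (simp add: algebra_simps)
    also have "\<dots> = c2\<^sup>2" using p2 by (simp add: c1_c2_def algebra_simps power2_eq_square)
    finally have "((\<tau> - r - R) / \<tau>) powr (3/2) \<le> (c2\<^sup>2) powr (3/2)"
      using \<tau> \<open>\<tau> > 0\<close> by (intro powr_mono2) auto
    also have "\<dots> = c2 ^ 3" using c by (simp add: powr_powr flip: powr_numeral)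
    finally show ?thesis using \<tau> \<open>\<tau> > 0\<close> R r c by (intro divide_left_mono mult_left_mono mult_pos_pos) auto
  qed
  also have "2 * R * (r + R) / (\<tau>\<^sup>2 * ((\<tau> - r - R) / \<tau>) powr (3/2)) = 2 * R * (r + R) * (\<tau> powr (-1/2) * (\<tau> - r - R) powr (-3/2))"
  proof -
    have "\<tau>\<^sup>2 = \<tau> powr (1/2) * \<tau> powr (3/2)" using \<open>\<tau> > 0\<close> by (simp flip: powr_add)
    then have "\<tau>\<^sup>2 * ((\<tau> - r - R) / \<tau>) powr (3/2) = \<tau> powr (1/2) * (\<tau> - r - R) powr (3/2)"
      using \<open>\<tau> > 0\<close> \<tau> by (simp add: powr_divide)
    moreover have "\<tau> powr (-1/2) = 1 / \<tau> powr (1/2)" "(\<tau> - r - R) powr (-3/2) = 1 / (\<tau> - r - R) powr (3/2)"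
      using powr_minus_divide[of \<tau> "1/2"] powr_minus_divide[of "\<tau> - r - R" "3/2"] by simp_all
    ultimately show ?thesis by simp
  qed
  also have "\<dots> \<le> 2 * R * (R * (1 + r)) * ((1 + r) powr (-1/2) * ((R + 2)\<^sup>2 * (1 + \<bar>\<tau> - r\<bar>) powr (-3/2)))"
  proof (intro mult_mono)
    show "r + R \<le> R * (1 + r)" using mult_right_mono[of 1 R r] R r by (simp add: algebra_simps)
    show "\<tau> powr (-1/2) \<le> (1 + r) powr (-1/2)" using \<tau> r R by (intro powr_mono2') auto
    \<comment> \<open>Here tau - r - R > 1 is used: it allows the distance past the support to be
      traded for 1 + |tau - r|.\<close>
    have "(R + 1) * 1 \<le> (R + 1) * (\<tau> - r - R)" using \<tau> R by (intro mult_left_mono) auto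
    then have "1 + \<bar>\<tau> - r\<bar> \<le> (R + 2) * (\<tau> - r - R)" using \<tau> R by (simp add: algebra_simps)
    then have "(1 + \<bar>\<tau> - r\<bar>) powr (3/2) \<le> ((R + 2) * (\<tau> - r - R)) powr (3/2)" by (intro powr_mono2) auto
    also have "\<dots> = (R + 2) powr (3/2) * (\<tau> - r - R) powr (3/2)" using R \<tau> by (simp add: powr_mult)
    also have "\<dots> \<le> (R + 2)\<^sup>2 * (\<tau> - r - R) powr (3/2)"
      using R by (intro mult_right_mono powr_3_2_le_square) auto
    finally have "(\<tau> - r - R) powr (- (3/2)) \<le> (R + 2)\<^sup>2 * (1 + \<bar>\<tau> - r\<bar>) powr (- (3/2))"
      using \<tau> by (simp add: powr_minus field_simps)
    then show "(\<tau> - r - R) powr (-3/2) \<le> (R + 2)\<^sup>2 * (1 + \<bar>\<tau> - r\<bar>) powr (-3/2)" by simp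
  qed (use R r \<tau> in auto)
  finally have 2: "1 / c2 - 1 / c1 \<le> 2 * R * (R * (1 + r)) * ((1 + r) powr (-1/2) * ((R + 2)\<^sup>2 * (1 + \<bar>\<tau> - r\<bar>) powr (-3/2)))" .
  have "4 * pi * (R + 1) / (1 + r) * m * (1 / c2 - 1 / c1)
     \<le> 4 * pi * (R + 1) / (1 + r) * m * (2 * R * (R * (1 + r)) * ((1 + r) powr (-1/2) * ((R + 2)\<^sup>2 * (1 + \<bar>\<tau> - r\<bar>) powr (-3/2))))"
    by (rule mult_left_mono[OF 2]) (use R r m in auto)
  note order_trans[OF 1 this]
  also have "4 * pi * (R + 1) / (1 + r) * m * (2 * R * (R * (1 + r)) * ((1 + r) powr (-1/2) * ((R + 2)\<^sup>2 * (1 + \<bar>\<tau> - r\<bar>) powr (-3/2))))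
    = 4 * pi * (R + 1) * (R + 2)\<^sup>2 * (2 * R\<^sup>2) * (m * decay r \<tau>)"
    using r by (simp add: decay_def power2_eq_square)
  also have "\<dots> \<le> kernel_const R * (m * decay r \<tau>)"
    unfolding kernel_const_def by (intro mult_right_mono mult_left_mono) (use R m in \<open>auto simp: decay_def\<close>)
  finally show ?thesis by (simp add: \<phi>1_\<phi>2_def q_p_def mult.assoc)
qed

section \<open>Late times: integration by parts away from the equator\<close>

lemma sphere_point_far:
  assumes "r \<ge> 0" "\<tau> * sin \<phi> \<ge> r + R"
  shows "R \<le> norm (sphere_point (r *\<^sub>R er \<alpha>) \<tau> \<phi> \<theta>)"
  using norm_triangle_ineq2[of "(\<tau> * sin \<phi>) *\<^sub>R er \<theta>" "r *\<^sub>R er \<alpha>"] assms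
  by (simp add: norm_minus_commute)

text \<open>Past the cut angle the projected radius is at least r + R and the support has been left.
  On the smaller box cos phi is bounded away from 0, so tan phi may enter.\<close>

lemma half_sphere_integral_cut:
  fixes W :: "real \<Rightarrow> real \<Rightarrow> real"
  assumes W: "continuous_on (half_sphere \<alpha>) (\<lambda>(\<phi>, \<theta>). W \<phi> \<theta>)"
    and supp: "\<And>\<phi> \<theta>. R \<le> norm (sphere_point (r *\<^sub>R er \<alpha>) \<tau> \<phi> \<theta>) \<Longrightarrow> W \<phi> \<theta> = 0"
    and R: "R \<ge> 1" and r: "r \<ge> 0" and \<tau>: "r + R + 1 < \<tau>"
  shows "integral (half_sphere \<alpha>) (\<lambda>(\<phi>, \<theta>). W \<phi> \<theta>)
    = integral (cbox (0, \<alpha> - pi) (arcsin ((r + R) / \<tau>), \<alpha> + pi)) (\<lambda>(\<phi>, \<theta>). W \<phi> \<theta>)"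
proof -
  define p where "p = (r + R) / \<tau>"
  have "\<tau> > 0" using \<tau> r R by linarith
  have p: "0 < p" "p < 1" "\<tau> * p = r + R" using \<tau> r R \<open>\<tau> > 0\<close> by (auto simp: p_def)
  have a: "0 \<le> arcsin p" "arcsin p \<le> pi / 2" "sin (arcsin p) = p"
    using p arcsin_nonneg[of p] arcsin_ubound[of p] by auto
  let ?S = "cbox (0, \<alpha> - pi) (arcsin p, \<alpha> + pi)"
  have sub: "?S \<subseteq> half_sphere \<alpha>" using a by (auto simp: cbox_Pair_eq)
  have "((\<lambda>(\<phi>, \<theta>). W \<phi> \<theta>) has_integral integral ?S (\<lambda>(\<phi>, \<theta>). W \<phi> \<theta>)) ?S"
    by (intro integrable_integral integrable_continuous continuous_on_subset[OF W sub])
  then have "((\<lambda>q. if q \<in> ?S then (\<lambda>(\<phi>, \<theta>). W \<phi> \<theta>) q else 0) has_integral integral ?S (\<lambda>(\<phi>, \<theta>). W \<phi> \<theta>)) (half_sphere \<alpha>)"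
    using has_integral_restrict[OF sub] by blast
  moreover have "(if q \<in> ?S then (\<lambda>(\<phi>, \<theta>). W \<phi> \<theta>) q else 0) = (\<lambda>(\<phi>, \<theta>). W \<phi> \<theta>) q" if q: "q \<in> half_sphere \<alpha>" for q
  proof (cases "q \<in> ?S")
    case False
    obtain \<phi> \<theta> where qq: "q = (\<phi>, \<theta>)" by (cases q)
    have "arcsin p \<le> \<phi>" "\<phi> \<le> pi / 2" using q False by (auto simp: qq cbox_Pair_eq)
    then have "p \<le> sin \<phi>" using sin_monotone_2pi_le[of "arcsin p" \<phi>] a by simp
    then have "\<tau> * sin \<phi> \<ge> r + R" using p(3) \<open>\<tau> > 0\<close> by (metis less_eq_real_def mult_left_mono)
    then have "W \<phi> \<theta> = 0" by (intro supp sphere_point_far r)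
    then show ?thesis by (simp add: qq)
  qed simp
  ultimately have "((\<lambda>(\<phi>, \<theta>). W \<phi> \<theta>) has_integral integral ?S (\<lambda>(\<phi>, \<theta>). W \<phi> \<theta>)) (half_sphere \<alpha>)"
    by (rule has_integral_eq[rotated])
  then show ?thesis by (simp add: integral_unique p_def)
qed

text \<open>Along the hemisphere the phi-derivative of h is -tau cos phi times the
  \<open>er\<close>-component of \<open>G\<close>; multiplying it by tan phi produces the wanted tau
  sin phi. The exact terms are therefore the phi-derivatives of h (er . a) tan phi and of h sin phi
  tan phi, which vanish at the cut, where h does, and at the pole, where tan does. The
  \<open>et\<close>-component of a comes from the theta-derivative of the periodic h (et . a), whose
  extra term turns 1 + tan^2 into tan^2.\<close>

lemma far_integral_by_parts:
  fixes h :: "real^2 \<Rightarrow> real" and G :: "real^2 \<Rightarrow> real^2" and \<alpha> :: real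
  assumes h: "\<And>y. (h has_derivative (\<lambda>k. G y \<bullet> k)) (at y)" and G: "continuous_on UNIV G"
    and z: "\<And>y. R \<le> norm y \<Longrightarrow> h y = 0"
    and R: "R \<ge> 1" and r: "r \<ge> 0" and \<tau>: "r + R + 1 < \<tau>"
  defines "S \<equiv> cbox (0, \<alpha> - pi) (arcsin ((r + R) / \<tau>), \<alpha> + pi)"
    and "y \<equiv> \<lambda>\<phi> \<theta>. sphere_point (r *\<^sub>R er \<alpha>) \<tau> \<phi> \<theta>"
  shows "integral S (\<lambda>(\<phi>, \<theta>). \<tau> * (sin \<phi> * (G (y \<phi> \<theta>) \<bullet> a)))
       = integral S (\<lambda>(\<phi>, \<theta>). h (y \<phi> \<theta>) * (er \<theta> \<bullet> a) * (tan \<phi>)\<^sup>2)"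
    and "integral S (\<lambda>(\<phi>, \<theta>). sin \<phi> * (h (y \<phi> \<theta>) - \<tau> * sin \<phi> * (G (y \<phi> \<theta>) \<bullet> er \<theta>)))
       = integral S (\<lambda>(\<phi>, \<theta>). - (h (y \<phi> \<theta>) * sin \<phi> * (1 + (tan \<phi>)\<^sup>2)))"
    and "continuous_on S (\<lambda>(\<phi>, \<theta>). h (y \<phi> \<theta>) * (er \<theta> \<bullet> a) * (tan \<phi>)\<^sup>2)"
    and "continuous_on S (\<lambda>(\<phi>, \<theta>). - (h (y \<phi> \<theta>) * sin \<phi> * (1 + (tan \<phi>)\<^sup>2)))"
proof -
  define p where "p = (r + R) / \<tau>"
  define \<phi>2 where "\<phi>2 = arcsin p"
  have "\<tau> > 0" using \<tau> r R by linarith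
  have p: "0 < p" "p < 1" "\<tau> * p = r + R" using \<tau> r R \<open>\<tau> > 0\<close> by (auto simp: p_def)
  have \<phi>2: "0 \<le> \<phi>2" "\<phi>2 < pi / 2" "\<tau> * sin \<phi>2 = r + R"
    using p arcsin_nonneg[of p] arcsin_lt_bounded[of p] by (auto simp: \<phi>2_def)
  have S: "S = cbox (0, \<alpha> - pi) (\<phi>2, \<alpha> + pi)" by (simp add: S_def \<phi>2_def p_def)
  have cos_pos: "cos \<phi> > 0" if "\<phi> \<in> {0..\<phi>2}" for \<phi> using that \<phi>2 by (intro cos_gt_zero_pi) auto
  have ct: "cos \<phi> * tan \<phi> = sin \<phi>" if "\<phi> \<in> {0..\<phi>2}" for \<phi> using cos_pos[OF that] by (simp add: tan_def)
  have Dtan: "(tan has_real_derivative 1 + (tan \<phi>)\<^sup>2) (at \<phi> within T)" if "\<phi> \<in> {0..\<phi>2}" for \<phi> T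
    using cos_pos[OF that] DERIV_tan[of \<phi>] tan_sec[of \<phi>] by (auto intro: has_field_derivative_at_within simp: power_inverse)
  \<comment> \<open>The product rule with c, s, t for cos phi, sin phi, tan phi, g for G . er, e for
    er . a and H for the value of h; c t = s removes the cosine.\<close>
  have alg1: "(- (T * c * g) * e + 0 * H) * t + (1 + t\<^sup>2) * (H * e) = - (T * s * g * e) + H * e * (1 + t\<^sup>2)"
    and alg2: "(- (T * c * g) * s + c * H) * t + (1 + t\<^sup>2) * (H * s) = - (T * s\<^sup>2 * g) + H * (s + s * (1 + t\<^sup>2))"
    if "c * t = s" for c s t T g e H :: real
    unfolding that[symmetric] by (simp_all add: algebra_simps power2_eq_square)
  have hc: "continuous_on UNIV h"
    by (intro continuous_at_imp_continuous_on ballI has_derivative_continuous[OF h])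
  have cy: "continuous_on T (\<lambda>q. y (fst q) (snd q))" for T unfolding y_def by (intro continuous_intros)
  have ch: "continuous_on T (\<lambda>q. h (y (fst q) (snd q)))" for T
    by (rule continuous_on_compose2[OF hc cy]) auto
  have cG: "continuous_on T (\<lambda>q. G (y (fst q) (snd q)))" for T
    by (rule continuous_on_compose2[OF G cy]) auto
  have ctan: "continuous_on S (\<lambda>q. tan (fst q))"
  proof -
    have "continuous_on S (\<lambda>q. sin (fst q) / cos (fst q))"
      by (intro continuous_intros) (auto simp: S cbox_Pair_eq dest!: cos_pos[simplified])
    then show ?thesis by (simp add: tan_def)
  qed
  have Dphi: "((\<lambda>\<phi>. h (y \<phi> \<theta>)) has_real_derivative - (\<tau> * cos \<phi> * (G (y \<phi> \<theta>) \<bullet> er \<theta>))) (at \<phi> within T)" for \<phi> \<theta> T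
    using gradient_along_curve[OF h, OF sphere_point_deriv_phi, of "r *\<^sub>R er \<alpha>" \<tau> \<theta> \<phi> T] by (simp add: y_def)
  have Dtheta: "((\<lambda>\<theta>. h (y \<phi> \<theta>)) has_real_derivative - (\<tau> * sin \<phi> * (G (y \<phi> \<theta>) \<bullet> et \<theta>))) (at \<theta> within T)" for \<phi> \<theta> T
    using gradient_along_curve[OF h, OF sphere_point_deriv_theta, of "r *\<^sub>R er \<alpha>" \<tau> \<phi> \<theta> T] by (simp add: y_def)
  have Der: "((\<lambda>\<theta>. et \<theta> \<bullet> a) has_real_derivative - (er \<theta> \<bullet> a)) (at \<theta> within T)" for \<theta> T
    unfolding inner_real2 by (auto intro!: derivative_eq_intros)
  have z2: "h (y \<phi>2 \<theta>) = 0" for \<theta>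
    unfolding y_def using \<phi>2 by (intro z sphere_point_far r) simp
  define A1' where "A1' = (\<lambda>\<phi> \<theta>. - (\<tau> * sin \<phi> * (G (y \<phi> \<theta>) \<bullet> er \<theta>) * (er \<theta> \<bullet> a)) + h (y \<phi> \<theta>) * (er \<theta> \<bullet> a) * (1 + (tan \<phi>)\<^sup>2))"
  define B1' where "B1' = (\<lambda>\<phi> \<theta>. - (\<tau> * sin \<phi> * (G (y \<phi> \<theta>) \<bullet> et \<theta>) * (et \<theta> \<bullet> a)) - h (y \<phi> \<theta>) * (er \<theta> \<bullet> a))"
  define A2' where "A2' = (\<lambda>\<phi> \<theta>. - (\<tau> * (sin \<phi>)\<^sup>2 * (G (y \<phi> \<theta>) \<bullet> er \<theta>)) + h (y \<phi> \<theta>) * (sin \<phi> + sin \<phi> * (1 + (tan \<phi>)\<^sup>2)))"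
  have cA1: "continuous_on S (\<lambda>(\<phi>, \<theta>). A1' \<phi> \<theta>)" and cB1: "continuous_on S (\<lambda>(\<phi>, \<theta>). B1' \<phi> \<theta>)"
    and cA2: "continuous_on S (\<lambda>(\<phi>, \<theta>). A2' \<phi> \<theta>)"
    unfolding A1'_def B1'_def A2'_def case_prod_unfold by (intro continuous_intros ch cG ctan)+
  show V1: "continuous_on S (\<lambda>(\<phi>, \<theta>). h (y \<phi> \<theta>) * (er \<theta> \<bullet> a) * (tan \<phi>)\<^sup>2)"
    and V2: "continuous_on S (\<lambda>(\<phi>, \<theta>). - (h (y \<phi> \<theta>) * sin \<phi> * (1 + (tan \<phi>)\<^sup>2)))"
    unfolding case_prod_unfold by (intro continuous_intros ch ctan)+
  have IA1: "integral S (\<lambda>(\<phi>, \<theta>). A1' \<phi> \<theta>) = 0"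
  proof -
    have "integral S (\<lambda>(\<phi>, \<theta>). A1' \<phi> \<theta>) = integral {\<alpha> - pi..\<alpha> + pi}
        (\<lambda>\<theta>. h (y \<phi>2 \<theta>) * (er \<theta> \<bullet> a) * tan \<phi>2 - h (y 0 \<theta>) * (er \<theta> \<bullet> a) * tan 0)"
      unfolding S
    proof (rule box_integral_fst[OF \<phi>2(1) cA1[unfolded S]])
      fix \<phi> \<theta> assume \<phi>: "\<phi> \<in> {0..\<phi>2}"
      show "((\<lambda>\<phi>. h (y \<phi> \<theta>) * (er \<theta> \<bullet> a) * tan \<phi>) has_real_derivative A1' \<phi> \<theta>) (at \<phi> within {0..\<phi>2})"
        unfolding A1'_def
        by (rule DERIV_cong[OF DERIV_mult[OF DERIV_mult[OF Dphi DERIV_const] Dtan[OF \<phi>]]]) (rule alg1[OF ct[OF \<phi>]])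
    qed
    then show ?thesis by (simp add: z2)
  qed
  have IA2: "integral S (\<lambda>(\<phi>, \<theta>). A2' \<phi> \<theta>) = 0"
  proof -
    have "integral S (\<lambda>(\<phi>, \<theta>). A2' \<phi> \<theta>) = integral {\<alpha> - pi..\<alpha> + pi}
        (\<lambda>\<theta>. h (y \<phi>2 \<theta>) * sin \<phi>2 * tan \<phi>2 - h (y 0 \<theta>) * sin 0 * tan 0)"
      unfolding S
    proof (rule box_integral_fst[OF \<phi>2(1) cA2[unfolded S]])
      fix \<phi> \<theta> assume \<phi>: "\<phi> \<in> {0..\<phi>2}"
      show "((\<lambda>\<phi>. h (y \<phi> \<theta>) * sin \<phi> * tan \<phi>) has_real_derivative A2' \<phi> \<theta>) (at \<phi> within {0..\<phi>2})"
        unfolding A2'_def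
        by (rule DERIV_cong[OF DERIV_mult[OF DERIV_mult[OF Dphi has_field_derivative_at_within[OF DERIV_sin]] Dtan[OF \<phi>]]])
           (rule alg2[OF ct[OF \<phi>]])
    qed
    then show ?thesis by (simp add: z2)
  qed
  have IB1: "integral S (\<lambda>(\<phi>, \<theta>). B1' \<phi> \<theta>) = 0"
  proof -
    have "integral S (\<lambda>(\<phi>, \<theta>). B1' \<phi> \<theta>) = integral {0..\<phi>2}
        (\<lambda>\<phi>. h (y \<phi> (\<alpha> + pi)) * (et (\<alpha> + pi) \<bullet> a) - h (y \<phi> (\<alpha> - pi)) * (et (\<alpha> - pi) \<bullet> a))"
      unfolding S
    proof (rule box_integral_snd[OF _ cB1[unfolded S]])
      fix \<phi> \<theta> :: real
      show "((\<lambda>\<theta>. h (y \<phi> \<theta>) * (et \<theta> \<bullet> a)) has_real_derivative B1' \<phi> \<theta>) (at \<theta> within {\<alpha> - pi..\<alpha> + pi})"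
        unfolding B1'_def by (rule derivative_eq_intros Dtheta Der refl)+ (simp add: algebra_simps)
    qed simp
    then show ?thesis by (simp add: y_def er_periodic_shift)
  qed
  have I: "(f has_integral integral S f) S" if "continuous_on S f" for f :: "real \<times> real \<Rightarrow> real"
    using that unfolding S by (intro integrable_integral integrable_continuous)
  note hi = I[OF cA1, unfolded IA1] I[OF cB1, unfolded IB1] I[OF cA2, unfolded IA2]
  let ?V1 = "\<lambda>(\<phi>, \<theta>). h (y \<phi> \<theta>) * (er \<theta> \<bullet> a) * (tan \<phi>)\<^sup>2"
  let ?V2 = "\<lambda>(\<phi>, \<theta>). - (h (y \<phi> \<theta>) * sin \<phi> * (1 + (tan \<phi>)\<^sup>2))"
  note hV = I[OF V1] I[OF V2]
  have "((\<lambda>q. ?V1 q - (\<lambda>(\<phi>, \<theta>). A1' \<phi> \<theta>) q - (\<lambda>(\<phi>, \<theta>). B1' \<phi> \<theta>) q) has_integral (integral S ?V1 - 0 - 0)) S"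
    by (rule has_integral_diff[OF has_integral_diff[OF hV(1) hi(1)] hi(2)])
  moreover have "(\<lambda>q. ?V1 q - (\<lambda>(\<phi>, \<theta>). A1' \<phi> \<theta>) q - (\<lambda>(\<phi>, \<theta>). B1' \<phi> \<theta>) q)
      = (\<lambda>(\<phi>, \<theta>). \<tau> * (sin \<phi> * (G (y \<phi> \<theta>) \<bullet> a)))"
  proof
    fix q :: "real \<times> real"
    obtain \<phi> \<theta> where q: "q = (\<phi>, \<theta>)" by (cases q)
    have "G (y \<phi> \<theta>) \<bullet> a = (G (y \<phi> \<theta>) \<bullet> er \<theta>) * (er \<theta> \<bullet> a) + (G (y \<phi> \<theta>) \<bullet> et \<theta>) * (et \<theta> \<bullet> a)"
      using inner_er_et[of "G (y \<phi> \<theta>)" a \<theta>] by (simp only: inner_commute[of a])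
    then show "?V1 q - (\<lambda>(\<phi>, \<theta>). A1' \<phi> \<theta>) q - (\<lambda>(\<phi>, \<theta>). B1' \<phi> \<theta>) q
        = (\<lambda>(\<phi>, \<theta>). \<tau> * (sin \<phi> * (G (y \<phi> \<theta>) \<bullet> a))) q"
      by (simp add: q A1'_def B1'_def algebra_simps)
  qed
  ultimately show "integral S (\<lambda>(\<phi>, \<theta>). \<tau> * (sin \<phi> * (G (y \<phi> \<theta>) \<bullet> a))) = integral S ?V1"
    by (simp add: integral_unique)
  have "((\<lambda>q. ?V2 q + (\<lambda>(\<phi>, \<theta>). A2' \<phi> \<theta>) q) has_integral (integral S ?V2 + 0)) S"
    by (rule has_integral_add[OF hV(2) hi(3)])
  moreover have "(\<lambda>q. ?V2 q + (\<lambda>(\<phi>, \<theta>). A2' \<phi> \<theta>) q)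
      = (\<lambda>(\<phi>, \<theta>). sin \<phi> * (h (y \<phi> \<theta>) - \<tau> * sin \<phi> * (G (y \<phi> \<theta>) \<bullet> er \<theta>)))"
    by (auto simp: A2'_def algebra_simps power2_eq_square)
  ultimately show "integral S (\<lambda>(\<phi>, \<theta>). sin \<phi> * (h (y \<phi> \<theta>) - \<tau> * sin \<phi> * (G (y \<phi> \<theta>) \<bullet> er \<theta>))) = integral S ?V2"
    by (simp add: integral_unique)
qed

text \<open>Up to tau = r + R + 1 the bounds on h and G enter directly, afterwards only the bound on
  h. The late kernels tan^2 phi and sin phi (1 + tan^2 phi) are both at most sin phi / cos^2 phi.
  The first claim, with a on an axis, serves the spatial derivatives of v, the second serves
  \<open>dt\<close>.\<close>

lemma kernel_decay:
  fixes h :: "real^2 \<Rightarrow> real" and G :: "real^2 \<Rightarrow> real^2"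
  assumes h: "\<And>y. (h has_derivative (\<lambda>k. G y \<bullet> k)) (at y)" and G: "continuous_on UNIV G"
    and z: "\<And>y. R \<le> norm y \<Longrightarrow> h y = 0" "\<And>y. R \<le> norm y \<Longrightarrow> G y = 0"
    and m: "\<And>y. \<bar>h y\<bar> \<le> m" "\<And>y. norm (G y) \<le> m"
    and R: "R \<ge> 1" and r: "r \<ge> 0" and \<tau>: "\<tau> \<ge> 0" and a: "norm a = 1"
  shows "\<bar>integral (half_sphere \<alpha>) (\<lambda>(\<phi>, \<theta>). \<tau> * (sin \<phi> * (G (sphere_point (r *\<^sub>R er \<alpha>) \<tau> \<phi> \<theta>) \<bullet> a)))\<bar>
      \<le> kernel_const R * m * decay r \<tau>" (is "\<bar>integral _ ?W1\<bar> \<le> _")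
    and "\<bar>integral (half_sphere \<alpha>) (\<lambda>(\<phi>, \<theta>). sin \<phi> * (h (sphere_point (r *\<^sub>R er \<alpha>) \<tau> \<phi> \<theta>)
         - \<tau> * sin \<phi> * (G (sphere_point (r *\<^sub>R er \<alpha>) \<tau> \<phi> \<theta>) \<bullet> er \<theta>)))\<bar>
      \<le> kernel_const R * m * decay r \<tau>" (is "\<bar>integral _ ?W2\<bar> \<le> _")
proof -
  let ?y = "\<lambda>\<phi> \<theta>. sphere_point (r *\<^sub>R er \<alpha>) \<tau> \<phi> \<theta>"
  have m0: "m \<ge> 0" using m(1)[of 0] by linarith
  have Gm: "\<bar>G y \<bullet> b\<bar> \<le> m" if "norm b = 1" for y b
    using Cauchy_Schwarz_ineq2[of "G y" b] m(2)[of y] that by simp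
  have hc: "continuous_on UNIV h"
    by (intro continuous_at_imp_continuous_on ballI has_derivative_continuous[OF h])
  have ch: "continuous_on T (\<lambda>q. h (?y (fst q) (snd q)))" for T
    by (rule continuous_on_compose2[OF hc]) (auto intro!: continuous_intros)
  have cG: "continuous_on T (\<lambda>q. G (?y (fst q) (snd q)))" for T
    by (rule continuous_on_compose2[OF G]) (auto intro!: continuous_intros)
  have W1: "continuous_on (half_sphere \<alpha>) ?W1" and W2: "continuous_on (half_sphere \<alpha>) ?W2"
    unfolding case_prod_unfold by (intro continuous_intros ch cG)+
  have s1: "\<tau> * (sin \<phi> * (G (?y \<phi> \<theta>) \<bullet> a)) = 0" and s2: "sin \<phi> * (h (?y \<phi> \<theta>) - \<tau> * sin \<phi> * (G (?y \<phi> \<theta>) \<bullet> er \<theta>)) = 0"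
    and s3: "h (?y \<phi> \<theta>) * (er \<theta> \<bullet> a) * (tan \<phi>)\<^sup>2 = 0" and s4: "- (h (?y \<phi> \<theta>) * sin \<phi> * (1 + (tan \<phi>)\<^sup>2)) = 0"
    if "R \<le> norm (?y \<phi> \<theta>)" for \<phi> \<theta>
    using z[OF that] by simp_all
  have "\<bar>integral (half_sphere \<alpha>) ?W1\<bar> \<le> kernel_const R * m * decay r \<tau> \<and> \<bar>integral (half_sphere \<alpha>) ?W2\<bar> \<le> kernel_const R * m * decay r \<tau>"
  proof (cases "\<tau> \<le> r + R + 1")
    case True
    have "\<bar>\<tau> * (sin \<phi> * (G (?y \<phi> \<theta>) \<bullet> a))\<bar> \<le> m * (1 + \<tau>) * sin \<phi>"
      and "\<bar>sin \<phi> * (h (?y \<phi> \<theta>) - \<tau> * sin \<phi> * (G (?y \<phi> \<theta>) \<bullet> er \<theta>))\<bar> \<le> m * (1 + \<tau>) * sin \<phi>"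
      if "\<phi> \<in> {0..pi/2}" for \<phi> \<theta>
    proof -
      have s: "0 \<le> sin \<phi>" using that by (intro sin_ge_zero) auto
      have "\<tau> * \<bar>G (?y \<phi> \<theta>) \<bullet> a\<bar> \<le> \<tau> * m" using Gm[OF a] \<tau> by (intro mult_left_mono) auto
      also have "\<dots> \<le> m * (1 + \<tau>)" using m0 by (simp add: algebra_simps)
      finally have "\<tau> * \<bar>G (?y \<phi> \<theta>) \<bullet> a\<bar> * sin \<phi> \<le> m * (1 + \<tau>) * sin \<phi>" using s by (rule mult_right_mono)
      then show "\<bar>\<tau> * (sin \<phi> * (G (?y \<phi> \<theta>) \<bullet> a))\<bar> \<le> m * (1 + \<tau>) * sin \<phi>"
        using s \<tau> by (simp add: abs_mult algebra_simps)
      have "\<bar>\<tau> * sin \<phi> * (G (?y \<phi> \<theta>) \<bullet> er \<theta>)\<bar> \<le> \<tau> * 1 * m"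
        unfolding abs_mult using Gm[of "er \<theta>"] \<tau> m0 by (intro mult_mono) auto
      then have "\<bar>h (?y \<phi> \<theta>) - \<tau> * sin \<phi> * (G (?y \<phi> \<theta>) \<bullet> er \<theta>)\<bar> \<le> m * (1 + \<tau>)"
        using m(1)[of "?y \<phi> \<theta>"] by (simp add: algebra_simps)
      then have "\<bar>h (?y \<phi> \<theta>) - \<tau> * sin \<phi> * (G (?y \<phi> \<theta>) \<bullet> er \<theta>)\<bar> * sin \<phi> \<le> m * (1 + \<tau>) * sin \<phi>"
        using s by (rule mult_right_mono)
      then show "\<bar>sin \<phi> * (h (?y \<phi> \<theta>) - \<tau> * sin \<phi> * (G (?y \<phi> \<theta>) \<bullet> er \<theta>))\<bar> \<le> m * (1 + \<tau>) * sin \<phi>"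
        using s by (simp add: abs_mult mult.commute)
    qed
    then show ?thesis
      by (intro conjI near_kernel_bound[OF W1 s1 R r \<tau> True m0] near_kernel_bound[OF W2 s2 R r \<tau> True m0])
  next
    case False
    then have far: "r + R + 1 < \<tau>" by simp
    note parts = far_integral_by_parts[where \<alpha>=\<alpha>, OF h G z(1) R r far]
    have bnd1: "\<bar>h (?y \<phi> \<theta>) * (er \<theta> \<bullet> a) * (tan \<phi>)\<^sup>2\<bar> \<le> m * sin \<phi> / (cos \<phi>)\<^sup>2"
      and bnd2: "\<bar>- (h (?y \<phi> \<theta>) * sin \<phi> * (1 + (tan \<phi>)\<^sup>2))\<bar> \<le> m * sin \<phi> / (cos \<phi>)\<^sup>2"
      if "\<phi> \<in> {0..<pi/2}" for \<phi> \<theta>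
    proof -
      have s: "0 \<le> sin \<phi>" "sin \<phi> \<le> 1" using that by (auto intro: sin_ge_zero)
      have c: "0 < cos \<phi>" using that by (intro cos_gt_zero_pi) auto
      have "\<bar>er \<theta> \<bullet> a\<bar> \<le> 1" using Cauchy_Schwarz_ineq2[of "er \<theta>" a] a by simp
      then have "\<bar>h (?y \<phi> \<theta>)\<bar> * \<bar>er \<theta> \<bullet> a\<bar> * (sin \<phi>)\<^sup>2 \<le> m * 1 * sin \<phi>"
        using m m0 s by (intro mult_mono) (auto simp: power2_eq_square mult_left_le)
      then show "\<bar>h (?y \<phi> \<theta>) * (er \<theta> \<bullet> a) * (tan \<phi>)\<^sup>2\<bar> \<le> m * sin \<phi> / (cos \<phi>)\<^sup>2"
        using c by (simp add: tan_def power_divide abs_mult divide_right_mono)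
      have "1 + (tan \<phi>)\<^sup>2 = 1 / (cos \<phi>)\<^sup>2" using c tan_sec[of \<phi>] by (simp add: inverse_eq_divide power_divide)
      moreover have "\<bar>h (?y \<phi> \<theta>)\<bar> * sin \<phi> \<le> m * sin \<phi>" using m s by (intro mult_right_mono) auto
      ultimately show "\<bar>- (h (?y \<phi> \<theta>) * sin \<phi> * (1 + (tan \<phi>)\<^sup>2))\<bar> \<le> m * sin \<phi> / (cos \<phi>)\<^sup>2"
        using c s by (simp add: abs_mult divide_right_mono)
    qed
    let ?S = "cbox (0, \<alpha> - pi) (arcsin ((r + R) / \<tau>), \<alpha> + pi)"
    let ?V1 = "\<lambda>(\<phi>, \<theta>). h (?y \<phi> \<theta>) * (er \<theta> \<bullet> a) * (tan \<phi>)\<^sup>2"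
    let ?V2 = "\<lambda>(\<phi>, \<theta>). - (h (?y \<phi> \<theta>) * sin \<phi> * (1 + (tan \<phi>)\<^sup>2))"
    have "integral (half_sphere \<alpha>) ?W1 = integral ?S ?V1"
      by (rule trans[OF half_sphere_integral_cut[OF W1 s1 R r far] parts(1)])
    moreover have "integral (half_sphere \<alpha>) ?W2 = integral ?S ?V2"
      by (rule trans[OF half_sphere_integral_cut[OF W2 s2 R r far] parts(2)])
    moreover have "\<bar>integral ?S ?V1\<bar> \<le> kernel_const R * m * decay r \<tau>"
      by (rule far_kernel_bound[OF parts(3) s3 R r far m0 bnd1])
    moreover have "\<bar>integral ?S ?V2\<bar> \<le> kernel_const R * m * decay r \<tau>"
      by (rule far_kernel_bound[OF parts(4) s4 R r far m0 bnd2])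
    ultimately show ?thesis by simp
  qed
  then show "\<bar>integral (half_sphere \<alpha>) ?W1\<bar> \<le> kernel_const R * m * decay r \<tau>"
    and "\<bar>integral (half_sphere \<alpha>) ?W2\<bar> \<le> kernel_const R * m * decay r \<tau>" by auto
qed

subsection \<open>Convolution in time\<close>

lemma integral_powr_3_2_up:
  fixes a b c :: real
  assumes "c \<le> a" "a \<le> b"
  shows "integral {a..b} (\<lambda>s. (1 + \<bar>c - s\<bar>) powr (-3/2)) \<le> 2" (is "integral _ ?f \<le> _")
proof -
  have "(?f has_integral (- 2 * (1 + b - c) powr (-1/2) - (- 2 * (1 + a - c) powr (-1/2)))) {a..b}"
  proof (rule fundamental_theorem_of_calculus[OF assms(2)])
    fix s assume s: "s \<in> {a..b}"
    then have "((\<lambda>s. - 2 * (1 + s - c) powr (-1/2)) has_real_derivative (1 + s - c) powr (-3/2)) (at s within {a..b})"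
      using assms by (auto intro!: derivative_eq_intros)
    moreover have "\<bar>c - s\<bar> = s - c" using s assms by auto
    ultimately show "((\<lambda>s. - 2 * (1 + s - c) powr (-1/2)) has_vector_derivative ?f s) (at s within {a..b})"
      by (simp add: has_real_derivative_iff_has_vector_derivative algebra_simps)
  qed
  then have "integral {a..b} ?f = 2 * (1 + a - c) powr (-1/2) - 2 * (1 + b - c) powr (-1/2)"
    by (simp add: integral_unique)
  also have "\<dots> \<le> 2"
  proof -
    have "(1 + a - c) powr (-1/2) \<le> 1 powr (-1/2)" using assms by (intro powr_mono2') auto
    moreover have "0 \<le> (1 + b - c) powr (-1/2)" by simp
    ultimately show ?thesis by (simp only: powr_one_eq_one)
  qed
  finally show ?thesis .
qed

lemma integral_powr_3_2_down:
  fixes a b c :: real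
  assumes "b \<le> c" "a \<le> b"
  shows "integral {a..b} (\<lambda>s. (1 + \<bar>c - s\<bar>) powr (-3/2)) \<le> 2"
proof -
  have "integral {a..b} (\<lambda>s. (1 + \<bar>c - s\<bar>) powr (-3/2)) = integral {-b..-a} (\<lambda>s. (1 + \<bar>c - (- s)\<bar>) powr (-3/2))"
    by (rule Henstock_Kurzweil_Integration.integral_reflect_real[where f="\<lambda>s. (1 + \<bar>c - s\<bar>) powr (-3/2)", symmetric])
  also have "\<dots> = integral {-b..-a} (\<lambda>s. (1 + \<bar>(- c) - s\<bar>) powr (-3/2))"
    by (rule integral_cong) (simp add: abs_minus_commute add.commute)
  also have "\<dots> \<le> 2" by (rule integral_powr_3_2_up) (use assms in auto)
  finally show ?thesis .
qed

lemma integral_powr_3_2: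
  fixes a b c :: real
  assumes "a \<le> b"
  shows "integral {a..b} (\<lambda>s. (1 + \<bar>c - s\<bar>) powr (-3/2)) \<le> 4"
proof -
  have i: "(\<lambda>s. (1 + \<bar>c - s\<bar>) powr (-3/2)) integrable_on {a..b}" for a b :: real
    by (intro integrable_continuous_real continuous_intros) auto
  consider "c \<le> a" | "b \<le> c" | "a \<le> c" "c \<le> b" by linarith
  then show ?thesis
  proof cases
    case 3
    have "integral {a..c} (\<lambda>s. (1 + \<bar>c - s\<bar>) powr (-3/2)) + integral {c..b} (\<lambda>s. (1 + \<bar>c - s\<bar>) powr (-3/2))
        = integral {a..b} (\<lambda>s. (1 + \<bar>c - s\<bar>) powr (-3/2))"
      by (rule Henstock_Kurzweil_Integration.integral_combine[OF 3 i])
    then show ?thesis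
      using integral_powr_3_2_down[OF order_refl 3(1)] integral_powr_3_2_up[OF order_refl 3(2)] by linarith
  qed (use integral_powr_3_2_up[of c a b] integral_powr_3_2_down[of b c a] assms in auto)
qed

text \<open>Multiplication by a + b >= D leaves b powr (-3/2) and the mixed term 1/a b powr (-1/2),
  which is at most the pure power -3/2 of the smaller of a and b. This replaces a splitting of the
  time interval.\<close>

lemma product_decay_le:
  fixes a b D :: real
  assumes a: "a \<ge> 1" and b: "b \<ge> 1" and D: "0 < D" "D \<le> a + b"
  shows "1 / a * b powr (-3/2) \<le> (a powr (-3/2) + 2 * b powr (-3/2)) / D"
proof -
  have split: "x powr (-3/2) = 1 / x * x powr (-1/2)" if "x \<ge> 1" for x :: real
    using that powr_add[of x "-1" "-1/2"] by (simp add: powr_minus_divide)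
  have "D * (1 / a * b powr (-3/2)) \<le> (a + b) * (1 / a * b powr (-3/2))"
    using D a by (intro mult_right_mono) auto
  also have "\<dots> = b powr (-3/2) + 1 / a * b powr (-1/2)"
    using a b split[OF b] by (simp add: field_simps)
  also have "1 / a * b powr (-1/2) \<le> a powr (-3/2) + b powr (-3/2)"
  proof (cases "a \<le> b")
    case True
    have "1 / a * b powr (-1/2) \<le> 1 / a * a powr (-1/2)"
      using True a by (intro mult_left_mono powr_mono2') auto
    also have "\<dots> = a powr (-3/2)" using split[OF a] by simp
    finally show ?thesis by (simp add: add_increasing2)
  next
    case False
    have "1 / a * b powr (-1/2) \<le> 1 / b * b powr (-1/2)"
      using False b by (intro mult_right_mono divide_left_mono) auto
    also have "\<dots> = b powr (-3/2)" using split[OF b] by simp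
    finally show ?thesis by (simp add: add_increasing)
  qed
  finally show ?thesis using D(1) by (simp add: field_simps)
qed

text \<open>With a = 1 + s and b = 1 + |t - s - r|, the triangle inequality gives a + b >= 1 + |t -
  r| for every s. The 10 is 2 + 2 * 4: the first integral starts at its peak, the second may
  straddle its peak.\<close>

lemma time_convolution_decay:
  fixes t r :: real
  assumes t: "t \<ge> 0" and r: "r \<ge> 0"
  shows "integral {0..t} (\<lambda>s. 1 / (1 + s) * (1 + \<bar>t - s - r\<bar>) powr (-3/2)) \<le> 10 / (1 + \<bar>t - r\<bar>)"
proof -
  define D where "D = 1 + \<bar>t - r\<bar>"
  have "D > 0" unfolding D_def by (rule add_pos_nonneg) auto
  have i: "(\<lambda>s. (1 + \<bar>c - s\<bar>) powr (-3/2)) integrable_on {0..t}" for c :: real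
    by (intro integrable_continuous_real continuous_intros) auto
  have "integral {0..t} (\<lambda>s. 1 / (1 + s) * (1 + \<bar>t - s - r\<bar>) powr (-3/2))
      \<le> integral {0..t} (\<lambda>s. ((1 + \<bar>0 - s\<bar>) powr (-3/2) + 2 * (1 + \<bar>(t - r) - s\<bar>) powr (-3/2)) / D)"
  proof (rule integral_le)
    show "(\<lambda>s. 1 / (1 + s) * (1 + \<bar>t - s - r\<bar>) powr (-3/2)) integrable_on {0..t}"
      by (intro integrable_continuous_real continuous_intros) auto
    show "(\<lambda>s. ((1 + \<bar>0 - s\<bar>) powr (-3/2) + 2 * (1 + \<bar>(t - r) - s\<bar>) powr (-3/2)) / D) integrable_on {0..t}"
      using \<open>D > 0\<close> by (intro integrable_continuous_real continuous_intros) auto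
    fix s assume s: "s \<in> {0..t}"
    have "D \<le> (1 + s) + (1 + \<bar>t - s - r\<bar>)" using s unfolding D_def by auto
    moreover have "\<bar>(t - r) - s\<bar> = \<bar>t - s - r\<bar>" "\<bar>0 - s\<bar> = s" using s by auto
    ultimately show "1 / (1 + s) * (1 + \<bar>t - s - r\<bar>) powr (-3/2) \<le> ((1 + \<bar>0 - s\<bar>) powr (-3/2) + 2 * (1 + \<bar>(t - r) - s\<bar>) powr (-3/2)) / D"
      using product_decay_le[of "1 + s" "1 + \<bar>t - s - r\<bar>" D] s \<open>D > 0\<close> by (simp only:)
  qed
  also have "\<dots> = (integral {0..t} (\<lambda>s. (1 + \<bar>0 - s\<bar>) powr (-3/2)) + 2 * integral {0..t} (\<lambda>s. (1 + \<bar>(t - r) - s\<bar>) powr (-3/2))) / D"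
    by (rule integral_unique[OF has_integral_divide[OF has_integral_add[OF integrable_integral[OF i]
          has_integral_mult_right[OF integrable_integral[OF i]]]]])
  also have "\<dots> \<le> 10 / D"
    using integral_powr_3_2_up[OF order_refl t] integral_powr_3_2[OF t, of "t - r"] \<open>D > 0\<close>
    by (intro divide_right_mono) auto
  finally show ?thesis by (simp add: D_def)
qed

lemma polar_coordinates: "\<exists>\<alpha>. x = norm x *\<^sub>R er \<alpha>"
proof (cases "x = 0")
  case False
  then have n: "norm x > 0" by simp
  have "(x $ 1)\<^sup>2 + (x $ 2)\<^sup>2 = (norm x)\<^sup>2"
    using power2_norm_eq_inner[of x] inner_real2[of x x] by (simp add: power2_eq_square)
  then have "(x $ 1 / norm x)\<^sup>2 + (x $ 2 / norm x)\<^sup>2 = 1"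
    using n by (simp add: power_divide flip: add_divide_distrib)
  then obtain \<alpha> where "x $ 1 / norm x = cos \<alpha>" "x $ 2 / norm x = sin \<alpha>"
    using sincos_total_2pi by metis
  then have "x $ 1 = norm x * cos \<alpha>" "x $ 2 = norm x * sin \<alpha>" using n by (simp_all add: field_simps)
  then have "x $ i = (norm x *\<^sub>R er \<alpha>) $ i" for i using exhaust_2[of i] by auto
  then show ?thesis using vec_eq_iff by blast
qed simp

lemma japanese_bracket_bounds:
  "japanese_bracket y \<le> 1 + norm y" "(1 + norm y) / 2 \<le> japanese_bracket y" "japanese_bracket y > 0"
proof -
  show "japanese_bracket y \<le> 1 + norm y"
    unfolding japanese_bracket_def by (rule real_le_lsqrt) (auto simp: power2_eq_square algebra_simps)
  have "((1 + norm y) / 2)\<^sup>2 \<le> 1 + (norm y)\<^sup>2"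
  proof -
    have "1 + (norm y)\<^sup>2 = ((1 + norm y) / 2)\<^sup>2 + (((1 - norm y) / 2)\<^sup>2 + (1 + (norm y)\<^sup>2) / 2)"
      by (simp add: power2_eq_square field_simps)
    moreover have "0 \<le> ((1 - norm y) / 2)\<^sup>2 + (1 + (norm y)\<^sup>2) / 2"
      by (intro add_nonneg_nonneg) auto
    ultimately show ?thesis by linarith
  qed
  then show "(1 + norm y) / 2 \<le> japanese_bracket y"
    unfolding japanese_bracket_def by (rule real_le_rsqrt)
  show "japanese_bracket y > 0" unfolding japanese_bracket_def by (simp add: add_pos_nonneg)
qed

subsection \<open>Bounds on the source\<close>

text \<open>The strict inequality makes the region open, so the function vanishes near y as well;
  the property passes to the derivative in the same form and can be iterated.\<close>

lemma dx_zero_outside: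
  assumes "\<And>y. norm y > R \<Longrightarrow> f t y = 0" "norm y > R"
  shows "dx i f t y = 0"
proof (rule dx_unique)
  have "open {h::real. norm (y + h *\<^sub>R axis i 1) > R}"
    by (intro open_Collect_less continuous_intros)
  then show "((\<lambda>h. f t (y + h *\<^sub>R axis i 1)) has_real_derivative 0) (at 0)"
    by (rule has_field_derivative_transform_within_open[OF DERIV_const]) (use assms in auto)
qed

lemma one_minus_laplacian_zero_outside:
  assumes "\<And>y. norm y > R \<Longrightarrow> f t y = 0" "norm y > R"
  shows "one_minus_laplacian f t y = 0"
proof -
  have "dx i f t z = 0" if "norm z > R" for i z
    by (rule dx_zero_outside[where R=R]) (use assms(1) that in auto)
  then have "dx i (dx i f) t y = 0" for i
    using dx_zero_outside[of R "dx i f" t y i] assms(2) by simp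
  then show ?thesis using assms by (simp add: one_minus_laplacian_def laplacian_def)
qed

lemma C_2_elliptic_bound:
  assumes f: "C_k (Suc (Suc k)) f" and t: "t \<ge> 0" and z: "\<And>y. norm y > R \<Longrightarrow> f t y = 0"
    and N: "\<And>y. \<bar>one_minus_laplacian f t y\<bar> \<le> N"
  shows "\<bar>f t y\<bar> \<le> N" "\<bar>dx i f t y\<bar> \<le> N"
proof -
  have c: "continuous_on UNIV (f t)" by (rule C_k_continuous_space[OF f t])
  have D1: "((\<lambda>h. f t (x + h *\<^sub>R axis i 1)) has_real_derivative dx i f t x) (at 0)" for x i
    by (rule C_1_grad[OF f t])
  have D2: "((\<lambda>h. dx i f t (x + h *\<^sub>R axis i 1)) has_real_derivative dx i (dx i f) t x) (at 0)" for x i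
    by (rule C_1_grad[OF C_k_dx[OF f] t])
  have N': "\<bar>f t x - (\<Sum>i\<in>UNIV. dx i (dx i f) t x)\<bar> \<le> N" for x
    using N[of x] by (simp add: one_minus_laplacian_def laplacian_def)
  show "\<bar>f t y\<bar> \<le> N" by (rule elliptic_sup_bound[OF c z D1 D2 N'])
  show "\<bar>dx i f t y\<bar> \<le> N" by (rule elliptic_gradient_bound[OF c z D1 D2 N'])
qed

lemma one_minus_laplacian_iterates:
  "(one_minus_laplacian ^^ 2) H = one_minus_laplacian (one_minus_laplacian H)"
  "(one_minus_laplacian ^^ 3) H = one_minus_laplacian ((one_minus_laplacian ^^ 2) H)"
  by (simp_all add: numeral_2_eq_2 numeral_3_eq_3)

lemma one_minus_laplacian_power_facts:
  assumes H: "C_k 6 H" and z: "\<forall>t\<ge>0. \<forall>y. norm y > R \<longrightarrow> H t y = 0"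
  shows "C_k 4 (one_minus_laplacian H)" "C_k 2 ((one_minus_laplacian ^^ 2) H)" "C_k 0 ((one_minus_laplacian ^^ 3) H)"
    and "t \<ge> 0 \<Longrightarrow> norm y > R \<Longrightarrow> (one_minus_laplacian ^^ n) H t y = 0"
proof -
  have e: "(6::nat) = Suc (Suc 4)" "(4::nat) = Suc (Suc 2)" "(2::nat) = Suc (Suc 0)" by simp_all
  show 4: "C_k 4 (one_minus_laplacian H)"
    by (rule C_k_one_minus_laplacian[OF H[unfolded e(1)]])
  show 2: "C_k 2 ((one_minus_laplacian ^^ 2) H)"
    unfolding one_minus_laplacian_iterates by (rule C_k_one_minus_laplacian[OF 4[unfolded e(2)]])
  show "C_k 0 ((one_minus_laplacian ^^ 3) H)"
    unfolding one_minus_laplacian_iterates(2)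
    by (rule C_k_one_minus_laplacian, unfold e(3)[symmetric]) (rule 2)
  show "(one_minus_laplacian ^^ n) H t y = 0" if "t \<ge> 0" "norm y > R" for t y
    using that(2)
  proof (induction n arbitrary: y)
    case (Suc n)
    then show ?case
      using one_minus_laplacian_zero_outside[of R "(one_minus_laplacian ^^ n) H" t y] by simp
  qed (use z that in auto)
qed

text \<open>A real \<open>SUP\<close> bounds its members only if the set is bounded above;
  compactness of [0, t] times the closed ball provides this.\<close>

lemma continuous_compact_support_bdd_above:
  fixes F :: "real \<Rightarrow> real^2 \<Rightarrow> real"
  assumes c: "continuous_on ({0..} \<times> UNIV) (\<lambda>(t, x). F t x)"
    and z: "\<And>s y. s \<ge> 0 \<Longrightarrow> norm y > R \<Longrightarrow> F s y = 0"
  shows "bdd_above ((\<lambda>(s, y). F s y) ` ({0..t} \<times> UNIV))"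
proof -
  have "compact ((\<lambda>(s, y). F s y) ` ({0..t} \<times> cball 0 R))"
    by (intro compact_continuous_image continuous_on_subset[OF c] compact_Times) auto
  then obtain B where B: "\<And>s y. s \<in> {0..t} \<Longrightarrow> norm y \<le> R \<Longrightarrow> F s y \<le> B"
    using compact_imp_bounded bounded_imp_bdd_above by (fastforce simp: bdd_above_def)
  have "F s y \<le> max B 0" if "s \<in> {0..t}" for s y
    using B[of s y] z[of s y] that by (cases "norm y \<le> R") auto
  then show ?thesis by (auto intro!: bdd_aboveI[of _ "max B 0"])
qed

text \<open>Three elliptic steps with one and the same bound N lead from the third power of 1 -
  Delta down to H, the last one giving the partials too. They take place at a fixed time, so the
  weight in s passes through. The 4 is 2 from \<open>japanese_bracket_bounds(2)\<close> times 2 for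
  the two components of the gradient.\<close>

lemma source_bounds:
  assumes H: "C_k 6 H" and z: "\<forall>t\<ge>0. \<forall>y. norm y > R \<longrightarrow> H t y = 0"
    and s: "s \<in> {0..t}"
  defines "M \<equiv> SUP (s, y) \<in> {0..t} \<times> UNIV. japanese_bracket s * \<bar>(one_minus_laplacian ^^ 3) H s y\<bar>"
  shows "M \<ge> 0" "\<bar>H s y\<bar> \<le> 4 * M / (1 + s)" "norm (grad_x H s y) \<le> 4 * M / (1 + s)"
proof -
  note L = one_minus_laplacian_power_facts[OF H z]
  let ?F = "\<lambda>s y. japanese_bracket s * \<bar>(one_minus_laplacian ^^ 3) H s y\<bar>"
  have "continuous_on ({0..} \<times> UNIV) (\<lambda>(s, y). ?F s y)"
    using C_k_continuous[OF L(3)] unfolding japanese_bracket_def case_prod_unfold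
    by (intro continuous_intros) auto
  then have bdd: "bdd_above ((\<lambda>(s, y). ?F s y) ` ({0..t} \<times> UNIV))"
    by (rule continuous_compact_support_bdd_above[where R=R]) (simp add: L(4))
  have le: "?F s y \<le> M" for y
    unfolding M_def using cSUP_upper[OF _ bdd, of "(s, y)"] s by simp
  have jb: "0 < japanese_bracket s" "(1 + s) / 2 \<le> japanese_bracket s"
    using japanese_bracket_bounds(2,3)[of s] s by auto
  have "0 \<le> ?F s 0" using jb by simp
  also note le
  finally show M: "M \<ge> 0" .
  define N where "N = 2 * M / (1 + s)"
  have s0: "s \<ge> 0" using s by simp
  have b3: "\<bar>(one_minus_laplacian ^^ 3) H s y\<bar> \<le> N" for y
  proof -
    have "(1 + s) / 2 * \<bar>(one_minus_laplacian ^^ 3) H s y\<bar> \<le> ?F s y"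
      using jb by (intro mult_right_mono) auto
    also note le
    finally show ?thesis using s0 by (simp add: N_def field_simps)
  qed
  have e: "(6::nat) = Suc (Suc 4)" "(4::nat) = Suc (Suc 2)" "(2::nat) = Suc (Suc 0)" by simp_all
  have L2: "C_k (Suc (Suc 0)) ((one_minus_laplacian ^^ 2) H)"
    unfolding e(3)[symmetric] by (rule L(2))
  have b2: "\<bar>(one_minus_laplacian ^^ 2) H s y\<bar> \<le> N" for y
    by (rule C_2_elliptic_bound(1)[OF L2 s0, where R=R])
       (use L(4)[OF s0] b3 one_minus_laplacian_iterates(2)[of H] in \<open>auto simp only:\<close>)
  have b1: "\<bar>one_minus_laplacian H s y\<bar> \<le> N" for y
    by (rule C_2_elliptic_bound(1)[OF L(1)[unfolded e(2)] s0, where R=R])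
       (use L(4)[OF s0, where n=1] b2 one_minus_laplacian_iterates(1)[of H] in \<open>auto simp: funpow_simps_right\<close>)
  note H6 = H[unfolded e(1)]
  have b0: "\<bar>H s y\<bar> \<le> N" "\<bar>dx i H s y\<bar> \<le> N" for y i
    using C_2_elliptic_bound[OF H6 s0, where R=R] z s0 b1 by blast+
  have "N \<ge> 0" using M s0 by (simp add: N_def)
  have "4 * M / (1 + s) = 2 * N" by (simp add: N_def)
  then show "\<bar>H s y\<bar> \<le> 4 * M / (1 + s)" using b0(1)[of y] \<open>N \<ge> 0\<close> by simp
  have "norm (grad_x H s y) \<le> (\<Sum>i\<in>UNIV. \<bar>grad_x H s y $ i\<bar>)" by (rule norm_le_l1_cart)
  also have "\<dots> \<le> 2 * N" using b0(2)[of 1 y] b0(2)[of 2 y] by (simp add: grad_x_def sum_2)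
  finally show "norm (grad_x H s y) \<le> 4 * M / (1 + s)" using \<open>4 * M / (1 + s) = 2 * N\<close> by simp
qed

section \<open>Assembly of the pointwise estimate\<close>

lemma wave_integral_decay:
  assumes c: "continuous_on {0..t} w" and t: "t \<ge> 0" and r: "r \<ge> 0" and A: "A \<ge> 0"
    and le: "\<And>s. s \<in> {0..t} \<Longrightarrow> \<bar>w s\<bar> \<le> A / (1 + s) * decay r (t - s)"
  shows "\<bar>integral {0..t} w\<bar> \<le> 10 * A * (1 + r) powr (-1/2) / (1 + \<bar>t - r\<bar>)"
proof -
  let ?g = "\<lambda>s. 1 / (1 + s) * (1 + \<bar>t - s - r\<bar>) powr (-3/2)"
  have ig: "?g integrable_on {0..t}"
    by (intro integrable_continuous_real continuous_intros) auto
  have "norm (integral {0..t} w) \<le> integral {0..t} (\<lambda>s. A * (1 + r) powr (-1/2) * ?g s)"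
  proof (rule integral_norm_bound_integral)
    show "w integrable_on {0..t}" by (rule integrable_continuous_real[OF c])
    show "(\<lambda>s. A * (1 + r) powr (-1/2) * ?g s) integrable_on {0..t}"
      by (intro integrable_continuous_real continuous_intros) auto
    show "norm (w s) \<le> A * (1 + r) powr (-1/2) * ?g s" if "s \<in> {0..t}" for s
      using le[OF that] by (simp add: decay_def mult_ac)
  qed
  also have "\<dots> = A * (1 + r) powr (-1/2) * integral {0..t} ?g"
    by (rule integral_mult_right)
  also have "\<dots> \<le> A * (1 + r) powr (-1/2) * (10 / (1 + \<bar>t - r\<bar>))"
    using time_convolution_decay[OF t r] A by (intro mult_left_mono) auto
  finally show ?thesis by (simp add: mult_ac)
qed

text \<open>\<open>kernel_decay\<close> asks for a radius of at least 1 and for vanishing on its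
  circle already, whereas H is given to vanish for norm y > R only; the radius R + 1 meets both
  demands.\<close>

lemma wave_kernel_bounds:
  assumes R: "R \<ge> 0" and H1: "C_k (Suc k) H" and z: "\<And>y. norm y > R \<Longrightarrow> H s y = 0"
    and m: "\<And>y. \<bar>H s y\<bar> \<le> m" "\<And>y. norm (grad_x H s y) \<le> m"
    and s: "0 \<le> s" "s \<le> t" and r: "r \<ge> 0"
  shows "\<bar>integral (half_sphere \<alpha>) (\<lambda>(\<phi>, \<theta>). (t - s) * (sin \<phi> * dx i H s (sphere_point (r *\<^sub>R er \<alpha>) (t - s) \<phi> \<theta>)))\<bar>
      \<le> kernel_const (R + 1) * m * decay r (t - s)"
    and "\<bar>integral (half_sphere \<alpha>) (\<lambda>(\<phi>, \<theta>). sin \<phi> * (H s (sphere_point (r *\<^sub>R er \<alpha>) (t - s) \<phi> \<theta>)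
          - (t - s) * sin \<phi> * (grad_x H s (sphere_point (r *\<^sub>R er \<alpha>) (t - s) \<phi> \<theta>) \<bullet> er \<theta>)))\<bar>
      \<le> kernel_const (R + 1) * m * decay r (t - s)"
proof -
  have cG: "continuous_on UNIV (grad_x H s)"
    using continuous_on_compose_pair[OF C_1_continuous_grad[OF H1], of UNIV "\<lambda>_. s" "\<lambda>y. y"] s by simp
  have zH: "H s y = 0" if "R + 1 \<le> norm y" for y using z that by simp
  have zG: "grad_x H s y = 0" if "R + 1 \<le> norm y" for y
  proof -
    have "dx i H s y = 0" for i by (rule dx_zero_outside[where R=R]) (use z that in auto)
    then show ?thesis by (simp add: grad_x_def vec_eq_iff)
  qed
  have D: "(H s has_derivative (\<lambda>k. grad_x H s y \<bullet> k)) (at y)" for y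
    by (rule C_1_has_derivative_space[OF H1 s(1)])
  have ts: "0 \<le> t - s" "1 \<le> R + 1" using s R by auto
  have gx: "dx i H s y = grad_x H s y \<bullet> axis i 1" for y by (simp add: grad_x_def inner_axis)
  show "\<bar>integral (half_sphere \<alpha>) (\<lambda>(\<phi>, \<theta>). (t - s) * (sin \<phi> * dx i H s (sphere_point (r *\<^sub>R er \<alpha>) (t - s) \<phi> \<theta>)))\<bar>
      \<le> kernel_const (R + 1) * m * decay r (t - s)"
    unfolding gx by (rule kernel_decay(1)[where h="H s"]) (simp_all add: D cG zH zG m r ts R s)
  show "\<bar>integral (half_sphere \<alpha>) (\<lambda>(\<phi>, \<theta>). sin \<phi> * (H s (sphere_point (r *\<^sub>R er \<alpha>) (t - s) \<phi> \<theta>)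
          - (t - s) * sin \<phi> * (grad_x H s (sphere_point (r *\<^sub>R er \<alpha>) (t - s) \<phi> \<theta>) \<bullet> er \<theta>)))\<bar>
      \<le> kernel_const (R + 1) * m * decay r (t - s)"
    by (rule kernel_decay(2)[where a="axis 1 1"]) (simp_all add: D cG zH zG m r ts R s)
qed

lemma continuous_on_wave_kernels:
  assumes H1: "C_k (Suc k) H"
  shows "continuous_on {0..t} (\<lambda>s. integral (half_sphere \<alpha>)
           (\<lambda>(\<phi>, \<theta>). (t - s) * (sin \<phi> * dx i H s (sphere_point x (t - s) \<phi> \<theta>))))"
    and "continuous_on {0..t} (\<lambda>s. integral (half_sphere \<alpha>)
           (\<lambda>(\<phi>, \<theta>). sin \<phi> * (H s (sphere_point x (t - s) \<phi> \<theta>)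
              - (t - s) * sin \<phi> * (grad_x H s (sphere_point x (t - s) \<phi> \<theta>) \<bullet> er \<theta>))))"
proof -
  note cs = continuous_on_compose_pair[OF C_k_continuous[OF H1]] continuous_on_compose_pair[OF C_1_continuous_dx[OF H1]]
    continuous_on_compose_pair[OF C_1_continuous_grad[OF H1]]
  have "continuous_on ({0..t} \<times> half_sphere \<alpha>) (\<lambda>(s, p). case p of (\<phi>, \<theta>) \<Rightarrow>
      (t - s) * (sin \<phi> * dx i H s (sphere_point x (t - s) \<phi> \<theta>)))"
    unfolding case_prod_unfold by (intro continuous_intros cs) auto
  then show "continuous_on {0..t} (\<lambda>s. integral (half_sphere \<alpha>)
           (\<lambda>(\<phi>, \<theta>). (t - s) * (sin \<phi> * dx i H s (sphere_point x (t - s) \<phi> \<theta>))))"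
    by (rule integral_continuous_on_param)
  have "continuous_on ({0..t} \<times> half_sphere \<alpha>) (\<lambda>(s, p). case p of (\<phi>, \<theta>) \<Rightarrow>
      sin \<phi> * (H s (sphere_point x (t - s) \<phi> \<theta>)
              - (t - s) * sin \<phi> * (grad_x H s (sphere_point x (t - s) \<phi> \<theta>) \<bullet> er \<theta>)))"
    unfolding case_prod_unfold by (intro continuous_intros cs) auto
  then show "continuous_on {0..t} (\<lambda>s. integral (half_sphere \<alpha>)
           (\<lambda>(\<phi>, \<theta>). sin \<phi> * (H s (sphere_point x (t - s) \<phi> \<theta>)
              - (t - s) * sin \<phi> * (grad_x H s (sphere_point x (t - s) \<phi> \<theta>) \<bullet> er \<theta>))))"
    by (rule integral_continuous_on_param)
qed

theorem lemma3p9: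
  fixes R :: real
  assumes "R > 1"
  shows "\<exists>C>0. \<forall>(H :: real \<Rightarrow> real^2 \<Rightarrow> real) (v :: real \<Rightarrow> real^2 \<Rightarrow> real).
           C_k 6 H \<longrightarrow>
           (\<forall>t\<ge>0. closure {x. H t x \<noteq> 0} \<subseteq> {x. norm x \<le> R}) \<longrightarrow>
           solves_zero_cauchy H v \<longrightarrow>
           (\<forall>t\<ge>0. \<forall>x :: real^2.
              japanese_bracket x powr (1/2) * japanese_bracket (t - norm x) * norm (grad_tx v t x)
              \<le> C * (SUP (s, y) \<in> {0..t} \<times> UNIV.
                        japanese_bracket s * \<bar>(one_minus_laplacian ^^ 3) H s y\<bar>))"
proof -
  define K where "K = kernel_const (R + 1)"
  have "0 < 2 * (R + 1)\<^sup>2 + 2 * (R + 1) + 3" using assms by (intro add_nonneg_pos add_nonneg_nonneg) auto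
  then have "K > 0" using assms by (simp add: K_def kernel_const_def)
  \<comment> \<open>120 = 3 * 10 * 4: three components of the gradient, 10 from
    \<open>time_convolution_decay\<close> and 4 from \<open>source_bounds\<close>. The factor 2 pi
    of the representation is at least 1 and is given away.\<close>
  have "japanese_bracket x powr (1/2) * japanese_bracket (t - norm x) * norm (grad_tx v t x)
      \<le> 120 * K * (SUP (s, y) \<in> {0..t} \<times> UNIV. japanese_bracket s * \<bar>(one_minus_laplacian ^^ 3) H s y\<bar>)"
    if H: "C_k 6 H" and supp: "\<forall>t\<ge>0. closure {x. H t x \<noteq> 0} \<subseteq> {x. norm x \<le> R}"
      and v: "solves_zero_cauchy H v" and t: "t \<ge> 0" for H v t and x :: "real^2"
  proof -
    define M where "M = (SUP (s, y) \<in> {0..t} \<times> UNIV. japanese_bracket s * \<bar>(one_minus_laplacian ^^ 3) H s y\<bar>)"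
    have z: "\<forall>t\<ge>0. \<forall>y. norm y > R \<longrightarrow> H t y = 0"
    proof (intro allI impI, rule ccontr)
      fix t :: real and y :: "real^2" assume that: "(0::real) \<le> t" "R < norm y"
      assume "H t y \<noteq> 0"
      then have "y \<in> closure {x. H t x \<noteq> 0}" by (intro subsetD[OF closure_subset]) simp
      from subsetD[OF supp[rule_format, OF that(1)] this] have "norm y \<le> R" by simp
      then show False using that(2) by simp
    qed
    have M: "M \<ge> 0" using source_bounds(1)[OF H z, of 0 t] t by (simp add: M_def)
    have six: "(6::nat) = Suc 5" by simp
    note H1 = H[unfolded six]
    define r where "r = norm x"
    have r: "r \<ge> 0" by (simp add: r_def)
    obtain \<alpha> where "x = norm x *\<^sub>R er \<alpha>" using polar_coordinates by blast
    then have x: "x = r *\<^sub>R er \<alpha>" by (simp add: r_def)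
    have kernel: "m * (4 * M / (1 + s)) * decay r (t - s) = 4 * m * M / (1 + s) * decay r (t - s)" for m s
      by simp
    have m: "\<bar>H s y\<bar> \<le> 4 * M / (1 + s)" "norm (grad_x H s y) \<le> 4 * M / (1 + s)" if "s \<in> {0..t}" for s y
      using source_bounds(2,3)[OF H z that] by (simp_all add: M_def)
    have zs: "H s y = 0" if "s \<in> {0..t}" "norm y > R" for s y using z that by simp
    note kb = wave_kernel_bounds[where R=R and H=H and t=t and r=r and \<alpha>=\<alpha>, OF _ H1 zs m, folded K_def x, unfolded kernel]
    define b where "b = 40 * K * M * (1 + r) powr (-1/2) / (1 + \<bar>t - r\<bar>)"
    have A: "4 * K * M \<ge> 0" using \<open>K > 0\<close> M by simp
    have bx: "\<bar>2 * pi * dx i v t x\<bar> \<le> b" for i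
    proof -
      have "\<bar>integral {0..t} (\<lambda>s. integral (half_sphere \<alpha>)
           (\<lambda>(\<phi>, \<theta>). (t - s) * (sin \<phi> * dx i H s (sphere_point x (t - s) \<phi> \<theta>))))\<bar>
         \<le> 10 * (4 * K * M) * (1 + r) powr (-1/2) / (1 + \<bar>t - r\<bar>)"
        by (rule wave_integral_decay[OF continuous_on_wave_kernels(1)[OF H1] t r A kb(1)])
           (use assms r in auto)
      then show ?thesis by (simp add: wave_dx_representation[OF v H1 t, of _ x \<alpha>] b_def)
    qed
    have bt: "\<bar>2 * pi * dt v t x\<bar> \<le> b"
    proof -
      have "\<bar>integral {0..t} (\<lambda>s. integral (half_sphere \<alpha>)
           (\<lambda>(\<phi>, \<theta>). sin \<phi> * (H s (sphere_point x (t - s) \<phi> \<theta>)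
              - (t - s) * sin \<phi> * (grad_x H s (sphere_point x (t - s) \<phi> \<theta>) \<bullet> er \<theta>))))\<bar>
         \<le> 10 * (4 * K * M) * (1 + r) powr (-1/2) / (1 + \<bar>t - r\<bar>)"
        by (rule wave_integral_decay[OF continuous_on_wave_kernels(2)[OF H1] t r A kb(2)])
           (use assms r in auto)
      then show ?thesis by (simp add: wave_dt_representation[OF v H1 t, of x \<alpha>] b_def)
    qed
    have pi_drop: "\<bar>q\<bar> \<le> b" if "\<bar>2 * pi * q\<bar> \<le> b" for q
    proof -
      have "1 * \<bar>q\<bar> \<le> (2 * pi) * \<bar>q\<bar>" using pi_gt3 by (intro mult_right_mono) auto
      then show ?thesis using that by (simp add: abs_mult)
    qed
    have "norm (grad_tx v t x) \<le> norm (dt v t x) + norm (\<chi> i. dx i v t x)"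
      unfolding grad_tx_def by (rule norm_Pair_le)
    also have "\<dots> \<le> \<bar>dt v t x\<bar> + (\<Sum>i\<in>UNIV. \<bar>(\<chi> i. dx i v t x) $ i\<bar>)"
      using norm_le_l1_cart[of "\<chi> i. dx i v t x"] by simp
    also have "\<dots> \<le> 3 * b"
      using pi_drop[OF bt] pi_drop[OF bx, of 1] pi_drop[OF bx, of 2] by (simp add: sum_2)
    finally have g: "norm (grad_tx v t x) \<le> 3 * b" .
    have j1: "japanese_bracket x powr (1/2) \<le> (1 + r) powr (1/2)"
      using japanese_bracket_bounds(1,3)[of x] by (intro powr_mono2) (auto simp: r_def)
    have j2: "japanese_bracket (t - norm x) \<le> 1 + \<bar>t - r\<bar>"
      using japanese_bracket_bounds(1)[of "t - norm x"] by (simp add: r_def)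
    have "japanese_bracket x powr (1/2) * japanese_bracket (t - norm x) * norm (grad_tx v t x)
        \<le> (1 + r) powr (1/2) * (1 + \<bar>t - r\<bar>) * (3 * b)"
      using japanese_bracket_bounds(3)[of "t - norm x"] by (intro mult_mono j1 j2 g) auto
    also have "\<dots> = 120 * K * M"
    proof -
      have "(1 + r) powr (1/2) * (1 + r) powr (-1/2) = 1" using r by (simp flip: powr_add)
      moreover have "1 + \<bar>t - r\<bar> \<noteq> 0" by linarith
      ultimately show ?thesis by (simp add: b_def)
    qed
    finally show ?thesis by (simp add: M_def)
  qed
  then show ?thesis using \<open>K > 0\<close> by (intro exI[of _ "120 * K"]) auto
qed

end
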